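(* Let $X=(X,d)$ be a nonempty metric space and let $a<b$ be real numbers. Let $\gamma:[a,b]\to X$ be a map such that $h\circ\gamma\in C([a,b])\cap BV([a,b])$ for every Lipschitz function $h:X\to\mathbb{R}$. Then $\gamma\in C([a,b],X)\cap BV([a,b],X)$ and, writing $\Gamma:=\gamma([a,b])$, there exists a residual set $S\subset \mathrm{BLIP}_1(X)$ such that, for each $h\in S$, $\mathcal{J}_\Gamma h(x)=1$ for $\mathcal{H}^1$-a.e. $x\in\Gamma$ and, for each $h\in S$, $$V_{h\circ\gamma}([c,d])=V_\gamma([c,d])\quad\text{for all } a\le c\le d\le b.$$
   Context: For a metric space $(Y,\rho)$ and a map $g:[a,b]\to Y$, the variation on a closed interval $[c,d]\subset[a,b]$ is $V_g([c,d]):=\sup\sum_{i=1}^N\rho(g(t_{i-1}),g(t_i))$, the supremum being over all finite partitions $c=t_0<\dots<t_N=d$ (it is $0$ when $c=d$). $BV([a,b],Y)$ is the set of maps $g:[a,b]\to Y$ with $V_g([a,b])<+\infty$, and $BV([a,b]):=BV([a,b],\mathbb{R})$. $C([a,b],Y)$ is the set of continuous maps, $C([a,b]):=C([a,b],\mathbb{R})$. $\mathrm{BLIP}_1(X)$ is the set of all bounded $1$-Lipschitz functions $h:X\to\mathbb{R}$ equipped with the supremum norm distance (a complete metric space). A subset of $\mathrm{BLIP}_1(X)$ is residual if it contains a countable intersection of open dense subsets. $\mathcal{H}^1$ is the $1$-dimensional Hausdorff measure: $\mathcal{H}^1(E)=\lim_{\delta\to+0}\inf\sum_{k=1}^{\infty}\operatorname{diam}U_k$,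 the infimum over countable coverings $\{U_k\}$ of $E$ with $\operatorname{diam}U_k<\delta$. Jacobian: let $x\in\Gamma$ and suppose there are sets $E\subset\Gamma$, $S'\subset\mathbb{R}$ and a biLipschitz map $\overline\gamma:S'\to E$ such that $x\in E$ is a density point of $E$ (with respect to $\mathcal{H}^1$ restricted to $\Gamma$). Suppose that the metric speed $|\dot{\overline\gamma}|(t):=\lim_{s\to t,\,s\in S'}\frac{d(\overline\gamma(s),\overline\gamma(t))}{|s-t|}$ exists and is positive at $t=\overline\gamma^{-1}(x)$, and that for a Lipschitz function $h:X\to\mathbb{R}$ the derivative $(h\circ\overline\gamma)'(\overline\gamma^{-1}(x))$ (limit of difference quotients along $S'$) exists. Then the Jacobian of $h$ at $x$ with respect to $\Gamma$ is $$\mathcal{J}_\Gamma h(x):=\frac{|(h\circ\overline\gamma)'(\overline\gamma^{-1}(x))|}{|\dot{\overline\gamma}|(\overline\gamma^{-1}(x))}.$$ This does not depend on the choice of $\overline\gamma$. *)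

theory Defs
  imports "HOL-Analysis.Analysis"
begin

text \<open>
  Maps on \<open>[a, b]\<close> are rendered as total functions on \<open>real\<close>; every notion below
  only looks at their values on the interval in question.
\<close>

definition partitions :: "real \<Rightarrow> real \<Rightarrow> (nat \<times> (nat \<Rightarrow> real)) set" where
  "partitions c d = {(N, t). t 0 = c \<and> t N = d \<and> (\<forall>i<N. t i < t (Suc i))}"

text \<open>
  For \<open>c = d\<close> the only partition has \<open>N = 0\<close>, so that the variation is \<open>0\<close>.
\<close>

definition variation :: "(real \<Rightarrow> 'a::metric_space) \<Rightarrow> real \<Rightarrow> real \<Rightarrow> ennreal" where
  "variation g c d =
     (SUP (N, t) \<in> partitions c d. ennreal (\<Sum>i=1..N. dist (g (t (i - 1))) (g (t i))))"

definition BV :: "real \<Rightarrow> real \<Rightarrow> (real \<Rightarrow> 'a::metric_space) set" where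
  "BV a b = {g. variation g a b < \<infinity>}"

text \<open>
  The type of bounded continuous functions carries the supremum distance.
\<close>

definition BLIP1 :: "('a::metric_space \<Rightarrow>\<^sub>C real) set" where
  "BLIP1 = {h. 1-lipschitz_on UNIV (apply_bcontfun h)}"

definition residual_in :: "'a topology \<Rightarrow> 'a set \<Rightarrow> bool" where
  "residual_in T S \<longleftrightarrow> S \<subseteq> topspace T \<and>
     (\<exists>\<U>. countable \<U> \<and> (\<forall>U\<in>\<U>. openin T U \<and> T closure_of U = topspace T) \<and>
          topspace T \<inter> \<Inter>\<U> \<subseteq> S)"

text \<open>
  The library's real-valued \<^const>\<open>diameter\<close> is \<open>0\<close> on unbounded sets,
  hence the extended variant.
\<close>

definition ediameter :: "'a::metric_space set \<Rightarrow> ennreal" where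
  "ediameter U = (SUP x\<in>U. SUP y\<in>U. ennreal (dist x y))"

definition hausdorff1_pre :: "real \<Rightarrow> 'a::metric_space set \<Rightarrow> ennreal" where
  "hausdorff1_pre \<delta> E =
     (INF U \<in> {U :: nat \<Rightarrow> 'a set. E \<subseteq> (\<Union>k. U k) \<and> (\<forall>k. ediameter (U k) < ennreal \<delta>)}.
        \<Sum>k. ediameter (U k))"

definition hausdorff1 :: "'a::metric_space set \<Rightarrow> ennreal" where
  "hausdorff1 E = Lim (at_right 0) (\<lambda>\<delta>. hausdorff1_pre \<delta> E)"

lemma hausdorff1_pre_antimono:
  assumes "\<delta> \<le> \<epsilon>"
  shows "hausdorff1_pre \<epsilon> E \<le> hausdorff1_pre \<delta> E"
  unfolding hausdorff1_pre_def
  by (rule INF_superset_mono) (use ennreal_leI[OF assms] less_le_trans in \<open>fastforce+\<close>)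

lemma hausdorff1_pre_tendsto:
  "((\<lambda>\<delta>. hausdorff1_pre \<delta> E) \<longlongrightarrow> (SUP \<delta>\<in>{0<..}. hausdorff1_pre \<delta> E)) (at_right 0)"
proof (rule order_tendstoI)
  fix y
  assume "y < (SUP \<delta>\<in>{0<..}. hausdorff1_pre \<delta> E)"
  then obtain \<epsilon> where \<epsilon>: "0 < \<epsilon>" "y < hausdorff1_pre \<epsilon> E"
    by (auto simp: less_SUP_iff)
  have "\<forall>\<^sub>F \<delta> in at_right 0. 0 < \<delta> \<and> \<delta> < \<epsilon>"
    using \<epsilon>(1) by (auto simp: eventually_at_right_field)
  then show "\<forall>\<^sub>F \<delta> in at_right 0. y < hausdorff1_pre \<delta> E"
    by eventually_elim (rule less_le_trans[OF \<epsilon>(2) hausdorff1_pre_antimono], simp)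
next
  fix y
  assume y: "(SUP \<delta>\<in>{0<..}. hausdorff1_pre \<delta> E) < y"
  have "\<forall>\<^sub>F \<delta> in at_right 0. (0::real) < \<delta>"
    by (simp add: eventually_at_right_less)
  then show "\<forall>\<^sub>F \<delta> in at_right 0. hausdorff1_pre \<delta> E < y"
    by eventually_elim (rule le_less_trans[OF SUP_upper y], simp)
qed

lemma hausdorff1_eq_SUP: "hausdorff1 E = (SUP \<delta>\<in>{0<..}. hausdorff1_pre \<delta> E)"
  unfolding hausdorff1_def
  by (rule tendsto_Lim) (simp_all add: hausdorff1_pre_tendsto)

text \<open>
  Density with respect to the restriction of the (outer) measure \<^const>\<open>hausdorff1\<close> to
  \<open>\<Gamma>\<close>.  As \<open>0 / 0 = 0\<close> in \<^typ>\<open>ennreal\<close>, a ratio tending to \<open>1\<close> forces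
  \<open>E \<inter> ball x r\<close> to have positive measure for all small \<open>r\<close>.
\<close>

definition density_point :: "'a::metric_space set \<Rightarrow> 'a set \<Rightarrow> 'a \<Rightarrow> bool" where
  "density_point \<Gamma> E x \<longleftrightarrow>
     ((\<lambda>r. hausdorff1 (E \<inter> \<Gamma> \<inter> ball x r) / hausdorff1 (\<Gamma> \<inter> ball x r)) \<longlongrightarrow> 1) (at_right 0)"

definition bilipschitz_on :: "'a::metric_space set \<Rightarrow> ('a \<Rightarrow> 'b::metric_space) \<Rightarrow> bool" where
  "bilipschitz_on S f \<longleftrightarrow>
     (\<exists>L>0. \<forall>s\<in>S. \<forall>t\<in>S. dist s t / L \<le> dist (f s) (f t) \<and> dist (f s) (f t) \<le> L * dist s t)"

text \<open>
  The metric speed of \<open>f\<close>, defined on \<open>S\<close>, exists at \<open>t\<close> and equals \<open>v\<close>.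
\<close>

definition has_metric_speed ::
  "(real \<Rightarrow> 'a::metric_space) \<Rightarrow> real \<Rightarrow> real \<Rightarrow> real set \<Rightarrow> bool" where
  "has_metric_speed f v t S \<longleftrightarrow>
     ((\<lambda>s. dist (f s) (f t) / \<bar>s - t\<bar>) \<longlongrightarrow> v) (at t within S)"

text \<open>
  The Jacobian of \<open>h\<close> at \<open>x\<close> with respect to \<open>\<Gamma>\<close> exists and equals \<open>J\<close>.
  Here \<open>E = f ` S\<close>, and \<open>t\<close> is the preimage of \<open>x\<close> under the injective map
  \<open>f\<close>.  The density condition makes \<open>x\<close> an accumulation point of \<open>E\<close>, hence \<open>t\<close> one of
  \<open>S\<close>, so that the limits within \<open>S\<close> are unique.
\<close>

definition has_jacobian ::
  "'a::metric_space set \<Rightarrow> ('a \<Rightarrow> real) \<Rightarrow> 'a \<Rightarrow> real \<Rightarrow> bool" where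
  "has_jacobian \<Gamma> h x J \<longleftrightarrow>
     (\<exists>E S f t v D. E \<subseteq> \<Gamma> \<and> bilipschitz_on S f \<and> f ` S = E \<and> t \<in> S \<and> f t = x \<and>
        density_point \<Gamma> E x \<and>
        has_metric_speed f v t S \<and> v > 0 \<and>
        ((h \<circ> f) has_real_derivative D) (at t within S) \<and>
        J = \<bar>D\<bar> / v)"

end

theory Submission
  imports Defs
begin

text \<open>
Write \<open>\<Gamma> = \<gamma> ` {a..b}\<close>.  The idea is to show that \<open>\<Gamma>\<close> is a curve of finite length,
to prove everything along a unit speed parametrization \<open>\<sigma>\<close> of \<open>\<Gamma>\<close>, and to return to \<open>\<gamma>\<close>
only at the end.  This is possible because \<open>\<gamma>\<close> and \<open>\<sigma>\<close> have the same image: the Jacobian is a property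
of \<open>\<Gamma>\<close>, and so is the splitting of \<open>\<Gamma>\<close> into pieces on which \<open>h\<close> is almost isometric, which controls the
variation of any continuous curve in \<open>\<Gamma>\<close>.

\<^bold>\<open>Finite length.\<close>  The sets of \<open>h\<close> in the complete space \<^const>\<open>BLIP1\<close> for which the variation
of \<open>h \<circ> \<gamma>\<close> is at most \<open>n\<close> are closed and cover, so by Baire one of them has interior, and
the variation of \<open>h \<circ> \<gamma>\<close> is bounded uniformly over the 1-Lipschitz \<open>h\<close> with \<open>\<bar>h\<bar> \<le> 1\<close>
(\<open>uniform_variation_bound\<close>).  Test this with the function \<open>max 0 (\<rho> / 2 - infdist x Z)\<close> for a
\<open>\<rho>\<close>-separated set \<open>Z\<close> of points of \<open>\<Gamma>\<close>: it is \<open>\<rho> / 2\<close> on \<open>Z\<close> and, since \<open>\<gamma>\<close> is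
continuous, vanishes somewhere between two visits to different points of \<open>Z\<close>.  Hence \<open>Z\<close> has at most
\<open>1 + const / \<rho>\<close> elements (\<open>separated_card_bound\<close>).  A tour through a maximal \<open>\<rho>\<close>-separated
net along a spanning tree then takes boundedly much time at unit speed, and a limit \<open>\<rho> \<rightarrow> 0\<close> of
such tours is a Lipschitz map of an interval onto \<open>\<Gamma>\<close> (\<open>lipschitz_parametrization\<close>).
Reparametrized by arc length it becomes \<open>\<sigma>\<close>, defined on \<open>{0..L}\<close>, and its metric speed is \<open>1\<close>
almost everywhere (\<open>unit_speed_ae\<close>).

\<^bold>\<open>Generic functions.\<close>  Given \<open>h\<^sub>0\<close> with Lipschitz constant strictly below \<open>1\<close> and a fine finite
net \<open>Z\<close> of \<open>\<Gamma>\<close>, the function \<open>x \<mapsto> min {h\<^sub>0 z + dist x z | z \<in> Z}\<close> is close to \<open>h\<^sub>0\<close>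
on \<open>\<Gamma>\<close>, and from every point \<open>x \<in> \<Gamma> - Z\<close> it has slope exactly \<open>1\<close> towards a nearby net
point (\<open>sawtooth_perturbation\<close>).  Therefore a residual set of \<open>h\<close> is \<open>steep_at\<close> almost every
point of \<open>\<Gamma>\<close>: there are \<open>y \<rightarrow> x\<close> in \<open>\<Gamma>\<close> with \<open>\<bar>h x - h y\<bar> / dist x y \<rightarrow> 1\<close>
(\<open>generic_steep\<close>).

These \<open>y\<close> may lie on another strand of the curve.  However, for a compact \<open>K\<close> on which \<open>\<sigma>\<close> is
biLipschitz, the rest of the curve has density zero at almost every point of \<open>\<sigma> ` K\<close>
(\<open>thin_outside_ae\<close>, a Vitali covering argument), so that \<open>y\<close> can be moved to the strand \<open>\<sigma> ` K\<close>
(\<open>steep_along_curve\<close>).  Thus \<open>h \<circ> \<sigma>\<close> has upper slope \<open>1\<close> at almost every time; by Vitali its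
variation is \<open>L\<close>, so that it is parametrized by arc length itself and
\<open>\<bar>h (\<sigma> s) - h (\<sigma> t)\<bar> / \<bar>s - t\<bar> \<rightarrow> 1\<close> for almost all \<open>t\<close> (\<open>unit_speed_comp_of_steep\<close>).

\<^bold>\<open>Conclusions.\<close>  Up to a null set, \<open>\<Gamma>\<close> is a countable union of compact pieces on which \<open>h\<close> is
biLipschitz.  The inverse of \<open>h\<close> on such a piece is a parametrization in which \<open>h\<close> has derivative
\<open>1\<close> and the metric speed is \<open>1\<close> (\<open>has_jacobian_one\<close>).  On the pieces \<open>h\<close> shrinks distances by
a factor as close to \<open>1\<close> as desired, and by disjointness of their preimages under \<open>\<gamma>\<close> the
lengths of their images under \<open>h\<close> add up to at most the variation of \<open>h \<circ> \<gamma>\<close>; this gives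
\<open>dist (\<gamma> c) (\<gamma> d) \<le> variation (h \<circ> \<gamma>) c d\<close> (\<open>dist_le_variation_of_unit_speed\<close>), whence the
equality of the variations.  As a residual set is nonempty, \<open>\<gamma>\<close> inherits finite variation from
\<open>h \<circ> \<gamma>\<close> for any one such \<open>h\<close>.
\<close>

section \<open>Variation\<close>

lemma partition_mono:
  assumes "(N, t) \<in> partitions c d" "i \<le> j" "j \<le> N"
  shows "t i \<le> t j"
  using assms(2,3)
proof (induction j rule: dec_induct)
  case (step j)
  then have "t i \<le> t j" "t j < t (Suc j)"
    using assms(1) by (auto simp: partitions_def)
  then show ?case by linarith
qed simp

lemma partition_bounds:
  assumes "(N, t) \<in> partitions c d" "i \<le> N"
  shows "c \<le> t i" "t i \<le> d"
  using partition_mono[OF assms(1), of 0 i] partition_mono[OF assms(1), of i N] assms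
  by (auto simp: partitions_def)

lemma partitions_nonempty: "c \<le> d \<Longrightarrow> partitions c d \<noteq> {}"
proof (cases "c = d")
  case True
  then have "(0, \<lambda>_. c) \<in> partitions c d" by (auto simp: partitions_def)
  then show ?thesis by blast
next
  case False
  moreover assume "c \<le> d"
  ultimately have "(1, \<lambda>i. if i = 0 then c else d) \<in> partitions c d" by (auto simp: partitions_def)
  then show ?thesis by blast
qed

lemma partition_sum_le_variation:
  assumes "(N, t) \<in> partitions c d"
  shows "ennreal (\<Sum>i=1..N. dist (g (t (i - 1))) (g (t i))) \<le> variation g c d"
  unfolding variation_def by (rule SUP_upper2[OF assms]) simp

lemma variation_leI:
  assumes "\<And>N t. (N, t) \<in> partitions c d \<Longrightarrow>
    ennreal (\<Sum>i=1..N. dist (g (t (i - 1))) (g (t i))) \<le> B"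
  shows "variation g c d \<le> B"
  unfolding variation_def using assms by (auto intro!: SUP_least)

text \<open>
By telescoping, any function whose increments dominate the distances bounds the variation.  Most
estimates of a variation from above are obtained from this, with a suitable \<open>v\<close>.
\<close>

lemma variation_le_increment:
  fixes v :: "real \<Rightarrow> real"
  assumes "\<And>s t. c \<le> s \<Longrightarrow> s \<le> t \<Longrightarrow> t \<le> d \<Longrightarrow> dist (g s) (g t) \<le> v t - v s"
  shows "variation g c d \<le> ennreal (v d - v c)"
proof (rule variation_leI)
  fix N t assume P: "(N, t) \<in> partitions c d"
  have "(\<Sum>i=1..N. dist (g (t (i - 1))) (g (t i))) \<le> (\<Sum>i=1..N. v (t i) - v (t (i - 1)))"
    using P by (intro sum_mono assms) (auto intro: partition_bounds partition_mono)
  also have "\<dots> = v (t N) - v (t 0)"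
    using sum_telescope''[of 0 N "\<lambda>i. v (t i)"] by simp
  also have "\<dots> = v d - v c"
    using P by (simp add: partitions_def)
  finally show "ennreal (\<Sum>i=1..N. dist (g (t (i - 1))) (g (t i))) \<le> ennreal (v d - v c)"
    by (rule ennreal_leI)
qed

lemma variation_append:
  assumes "c \<le> s" "s \<le> t"
  shows "variation g c s + ennreal (dist (g s) (g t)) \<le> variation g c t"
proof (cases "s = t")
  case False
  with assms have "s < t" by simp
  have "variation g c s + ennreal (dist (g s) (g t)) =
     (SUP (N, p) \<in> partitions c s.
        ennreal (\<Sum>i=1..N. dist (g (p (i - 1))) (g (p i))) + ennreal (dist (g s) (g t)))"
    unfolding variation_def using partitions_nonempty[OF assms(1)]
    by (subst ennreal_SUP_add_left[symmetric]) (auto simp: case_prod_unfold)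
  also have "\<dots> \<le> variation g c t"
  proof (rule SUP_least, clarify)
    fix N p assume P: "(N, p) \<in> partitions c s"
    define q where "q = p(Suc N := t)"
    have q: "(Suc N, q) \<in> partitions c t"
      using P \<open>s < t\<close> by (auto simp: partitions_def q_def)
    have "(\<Sum>i=1..N. dist (g (p (i - 1))) (g (p i))) + dist (g s) (g t)
        = (\<Sum>i=1..N. dist (g (q (i - 1))) (g (q i))) + dist (g s) (g t)"
      by (auto intro!: sum.cong simp: q_def)
    also have "\<dots> = (\<Sum>i=1..Suc N. dist (g (q (i - 1))) (g (q i)))"
      using P by (simp add: q_def partitions_def)
    finally show "ennreal (\<Sum>i=1..N. dist (g (p (i - 1))) (g (p i))) + ennreal (dist (g s) (g t))
        \<le> variation g c t"
      using partition_sum_le_variation[OF q, of g]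
      by (simp add: sum_nonneg flip: ennreal_plus)
  qed
  finally show ?thesis .
qed simp

lemma dist_le_variation: "c \<le> d \<Longrightarrow> ennreal (dist (g c) (g d)) \<le> variation g c d"
  using variation_append[of c c d g] by (meson add_increasing order_refl order_trans zero_le)

lemma variation_mono_right: "c \<le> s \<Longrightarrow> s \<le> t \<Longrightarrow> variation g c s \<le> variation g c t"
  using variation_append[of c s t g] by (meson add_increasing2 order_refl order_trans zero_le)

lemma dist_le_variation_increment:
  assumes "variation g c d < top" "c \<le> s" "s \<le> t" "t \<le> d"
  shows "dist (g s) (g t) \<le> enn2real (variation g c t) - enn2real (variation g c s)"
proof -
  have t: "variation g c t < top"
    using variation_mono_right[of c t d g] assms by auto
  have s: "variation g c s < top"
    using variation_mono_right[of c s t g] assms t by (auto intro: le_less_trans)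
  have "enn2real (variation g c s + ennreal (dist (g s) (g t))) \<le> enn2real (variation g c t)"
    by (rule enn2real_mono[OF variation_append t]) (use assms in auto)
  then show ?thesis using s by (simp add: enn2real_plus)
qed

text \<open>
The function \<open>r \<mapsto> variation g c r\<close> dominates distances on \<open>{s..t}\<close>, so that no partitions need to be
concatenated.
\<close>

lemma variation_superadditive:
  assumes "c \<le> s" "s \<le> t"
  shows "variation g c s + variation g s t \<le> variation g c t"
proof (cases "variation g c t < top")
  case True
  let ?v = "\<lambda>r. enn2real (variation g c r)"
  have "variation g c s < top"
    using variation_mono_right[of c s t g] assms True by (auto intro: le_less_trans)
  then have s: "variation g c s = ennreal (?v s)" by simp
  have "variation g s t \<le> ennreal (?v t - ?v s)"
    using assms by (intro variation_le_increment dist_le_variation_increment[OF True]) auto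
  then have "variation g c s + variation g s t \<le> ennreal (?v s) + ennreal (?v t - ?v s)"
    using s by (metis add_left_mono)
  also have "\<dots> = ennreal (?v t)"
    using enn2real_mono[OF variation_mono_right[of c s t g] True] assms
    by (simp flip: ennreal_plus)
  finally show ?thesis using True by simp
qed (simp flip: less_top)

lemma variation_mono:
  assumes "a \<le> c" "c \<le> d" "d \<le> b"
  shows "variation g c d \<le> variation g a b"
proof -
  have "variation g c d \<le> variation g a d"
    using variation_superadditive[of a c d g] assms by (meson add_increasing order_refl order_trans zero_le)
  also have "\<dots> \<le> variation g a b"
    using variation_mono_right[of a d b g] assms by simp
  finally show ?thesis .
qed

text \<open>
The two variations glued at \<open>s\<close> form a function that dominates the distances on \<open>{c..t}\<close>.
\<close>

lemma variation_subadditive: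
  assumes "c \<le> s" "s \<le> t"
  shows "variation g c t \<le> variation g c s + variation g s t"
proof (cases "variation g c s < top \<and> variation g s t < top")
  case True
  let ?v = "\<lambda>r. if r \<le> s then enn2real (variation g c r)
                else enn2real (variation g c s) + enn2real (variation g s r)"
  have "variation g c t \<le> ennreal (?v t - ?v c)"
  proof (rule variation_le_increment)
    fix p q assume pq: "c \<le> p" "p \<le> q" "q \<le> t"
    consider "q \<le> s" | "p \<le> s" "s < q" | "s < p" by linarith
    then show "dist (g p) (g q) \<le> ?v q - ?v p"
    proof cases
      case 1
      then show ?thesis using dist_le_variation_increment[of g c s p q] True pq by auto
    next
      case 2
      have "dist (g p) (g s) \<le> enn2real (variation g c s) - enn2real (variation g c p)"
        using dist_le_variation_increment[of g c s p s] True pq 2 by auto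
      moreover have "dist (g s) (g q) \<le> enn2real (variation g s q)"
        using dist_le_variation_increment[of g s t s q] True pq 2
        by (smt (verit) enn2real_nonneg)
      ultimately show ?thesis using 2 dist_triangle[of "g p" "g q" "g s"] by auto
    next
      case 3
      then show ?thesis using dist_le_variation_increment[of g s t p q] True pq by auto
    qed
  qed
  also have "\<dots> \<le> ennreal (enn2real (variation g c s) + enn2real (variation g s t))"
  proof (rule ennreal_leI)
    show "?v t - ?v c \<le> enn2real (variation g c s) + enn2real (variation g s t)"
      using assms enn2real_nonneg[of "variation g c c"] enn2real_nonneg[of "variation g s s"]
      by (cases "t = s") (auto intro: add_increasing2 simp del: enn2real_nonneg)
  qed
  also have "\<dots> = variation g c s + variation g s t"
    using True by (simp add: ennreal_plus)
  finally show ?thesis .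
qed (auto simp flip: less_top)

lemma variation_additive:
  "c \<le> s \<Longrightarrow> s \<le> t \<Longrightarrow> variation g c t = variation g c s + variation g s t"
  by (simp add: antisym variation_subadditive variation_superadditive)

lemma variation_lipschitz_comp:
  assumes "1-lipschitz_on UNIV h"
  shows "variation (h \<circ> g) c d \<le> variation g c d"
proof (rule variation_leI)
  fix N t assume P: "(N, t) \<in> partitions c d"
  have "(\<Sum>i=1..N. dist ((h \<circ> g) (t (i - 1))) ((h \<circ> g) (t i))) \<le> (\<Sum>i=1..N. dist (g (t (i - 1))) (g (t i)))"
    using lipschitz_onD[OF assms] by (intro sum_mono) simp
  then show "ennreal (\<Sum>i=1..N. dist ((h \<circ> g) (t (i - 1))) ((h \<circ> g) (t i))) \<le> variation g c d"
    using partition_sum_le_variation[OF P, of g] by (meson ennreal_leI order_trans)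
qed

lemma variation_le_if_dist_le_variation:
  assumes "\<And>s t. c \<le> s \<Longrightarrow> s \<le> t \<Longrightarrow> t \<le> d \<Longrightarrow> ennreal (dist (g s) (g t)) \<le> variation f s t"
  shows "variation g c d \<le> variation f c d"
proof (cases "variation f c d < top")
  case True
  let ?v = "\<lambda>r. enn2real (variation f c r)"
  have "variation g c d \<le> ennreal (?v d - ?v c)"
  proof (rule variation_le_increment)
    fix s t assume st: "c \<le> s" "s \<le> t" "t \<le> d"
    have t: "variation f c t < top"
      using variation_mono_right[of c t d f] st True by (auto intro: le_less_trans)
    have "variation f c s + variation f s t \<le> variation f c t"
      using variation_superadditive st by auto
    then have "variation f c s + ennreal (dist (g s) (g t)) \<le> variation f c t"
      using assms[OF st] by (meson add_left_mono order_trans)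
    then have "enn2real (variation f c s + ennreal (dist (g s) (g t))) \<le> ?v t"
      by (rule enn2real_mono[OF _ t])
    moreover have "variation f c s < top"
      using variation_mono_right[of c s t f] st t by (auto intro: le_less_trans)
    ultimately show "dist (g s) (g t) \<le> ?v t - ?v s"
      by (simp add: enn2real_plus)
  qed
  also have "\<dots> \<le> ennreal (?v d)" by (rule ennreal_leI) simp
  also have "\<dots> = variation f c d" using True by simp
  finally show ?thesis .
qed (simp flip: less_top)

section \<open>Baire category in the space of bounded 1-Lipschitz functions\<close>

lemma continuous_on_apply_at: "continuous_on S (\<lambda>h::'a::metric_space \<Rightarrow>\<^sub>C real. apply_bcontfun h x)"
proof -
  have "1-lipschitz_on S (\<lambda>h::'a \<Rightarrow>\<^sub>C real. apply_bcontfun h x)"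
    by (rule lipschitz_onI) (auto intro: dist_bounded)
  then show ?thesis by (rule lipschitz_on_continuous_on)
qed

lemma closed_BLIP1: "closed (BLIP1 :: ('a::metric_space \<Rightarrow>\<^sub>C real) set)"
proof -
  have "BLIP1 = (\<Inter>x. \<Inter>y. {h :: 'a \<Rightarrow>\<^sub>C real. dist (apply_bcontfun h x) (apply_bcontfun h y) \<le> dist x y})"
    by (auto simp: BLIP1_def lipschitz_on_def)
  also have "closed \<dots>"
    by (intro closed_INT ballI closed_Collect_le continuous_intros continuous_on_apply_at)
  finally show ?thesis .
qed

text \<open>
A variation is a supremum of continuous functions of \<open>h\<close>, one for each partition.
\<close>

lemma closed_variation_le: 
  assumes "0 \<le> B"
  shows "closed {h :: 'a::metric_space \<Rightarrow>\<^sub>C real. variation (apply_bcontfun h \<circ> g) c d \<le> ennreal B}"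
proof -
  have "{h :: 'a \<Rightarrow>\<^sub>C real. variation (apply_bcontfun h \<circ> g) c d \<le> ennreal B}
     = (\<Inter>(N, t)\<in>partitions c d. {h. (\<Sum>i=1..N. dist (apply_bcontfun h (g (t (i - 1)))) (apply_bcontfun h (g (t i)))) \<le> B})"
    unfolding variation_def using assms by (auto simp: SUP_le_iff)
  also have "closed \<dots>"
    by (intro closed_INT ballI)
       (auto simp: case_prod_unfold intro!: closed_Collect_le continuous_intros continuous_on_apply_at)
  finally show ?thesis .
qed

lemma obtain_BLIP1:
  assumes "1-lipschitz_on UNIV g" "\<And>x. \<bar>g x\<bar> \<le> B"
  obtains h where "h \<in> BLIP1" "apply_bcontfun h = g"
proof -
  have "g \<in> bcontfun"
    using assms lipschitz_on_continuous_on[OF assms(1)]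
    by (auto simp: bcontfun_def bounded_iff)
  then have "apply_bcontfun (Bcontfun g) = g" by (rule Bcontfun_inverse)
  then show thesis using that[of "Bcontfun g"] assms by (simp add: BLIP1_def)
qed

lemma BLIP1_nonempty: "BLIP1 \<noteq> {}"
proof -
  have "1-lipschitz_on UNIV (\<lambda>x::'a::metric_space. 0::real)"
    by (auto simp: lipschitz_on_def)
  then obtain h where "h \<in> (BLIP1 :: ('a \<Rightarrow>\<^sub>C real) set)"
    using obtain_BLIP1[of "\<lambda>_. 0" 0] by auto
  then show ?thesis by blast
qed

lemma completely_metrizable_closed:
  "closed (C :: 'a::complete_space set) \<Longrightarrow> completely_metrizable_space (top_of_set C)"
  by (simp add: completely_metrizable_space_closedin completely_metrizable_space_euclidean)

lemma baire_closed_cover: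
  fixes C :: "'a::complete_space set"
  assumes "closed C" "C \<noteq> {}" "C \<subseteq> (\<Union>n::nat. F n)" "\<And>n. closed (F n)"
  obtains n h r where "h \<in> C" "0 < r" "C \<inter> ball h r \<subseteq> F n"
proof -
  let ?X = "top_of_set C"
  have "\<exists>n. ?X interior_of (C \<inter> F n) \<noteq> {}"
  proof (rule ccontr)
    assume *: "\<not> ?thesis"
    have "?X interior_of \<Union>(range (\<lambda>n. C \<inter> F n)) = {}"
    proof (rule Baire_category_alt)
      show "completely_metrizable_space ?X \<or> locally_compact_space ?X \<and> regular_space ?X"
        using completely_metrizable_closed[OF assms(1)] by blast
      fix T assume "T \<in> range (\<lambda>n. C \<inter> F n)"
      then show "closedin ?X T \<and> ?X interior_of T = {}"
        using * assms(4) by (auto intro: closedin_closed_Int)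
    qed auto
    moreover have "\<Union>(range (\<lambda>n. C \<inter> F n)) = C" using assms(3) by auto
    moreover have "?X interior_of C = C"
      by (metis interior_of_topspace topspace_euclidean_subtopology)
    ultimately show False using assms(2) by simp
  qed
  then obtain n h where h: "h \<in> ?X interior_of (C \<inter> F n)" by blast
  then obtain U where U: "openin ?X U" "h \<in> U" "U \<subseteq> C \<inter> F n"
    by (auto simp: interior_of_def)
  then obtain V where V: "open V" "U = C \<inter> V" by (auto simp: openin_open)
  then obtain r where "0 < r" "ball h r \<subseteq> V" using U by (meson IntE open_contains_ball)
  then show thesis using that[of h r n] U V by blast
qed

lemma residual_nonempty:
  fixes C :: "'a::complete_space set"
  assumes "closed C" "C \<noteq> {}" "residual_in (top_of_set C) S"
  shows "S \<noteq> {}"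
proof -
  obtain U where U: "countable U" "\<And>V. V \<in> U \<Longrightarrow> openin (top_of_set C) V \<and> top_of_set C closure_of V = C"
      "C \<inter> \<Inter>U \<subseteq> S"
    using assms(3) by (auto simp: residual_in_def)
  have "top_of_set C closure_of \<Inter>U = topspace (top_of_set C)"
    using completely_metrizable_closed[OF assms(1)] U by (intro Baire_category) auto
  then have "top_of_set C closure_of (C \<inter> \<Inter>U) = C"
    by (metis closure_of_restrict topspace_euclidean_subtopology)
  then show ?thesis using U(3) assms(2) by (metis closure_of_empty subset_empty)
qed

section \<open>Finite length of the image\<close>

lemma lipschitz_on_dist: "1-lipschitz_on UNIV (dist x)"
proof (rule lipschitz_onI)
  fix u v
  show "dist (dist x u) (dist x v) \<le> 1 * dist u v"
    using dist_triangle[of x u v] dist_triangle[of x v u]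
    by (simp add: dist_real_def abs_le_iff dist_commute)
qed simp

lemma continuous_of_lipschitz_compositions:
  fixes \<gamma> :: "real \<Rightarrow> 'a::metric_space"
  assumes "\<And>h :: 'a \<Rightarrow> real. 1-lipschitz_on UNIV h \<Longrightarrow> continuous_on S (h \<circ> \<gamma>)"
  shows "continuous_on S \<gamma>"
  unfolding continuous_on_iff
proof (intro ballI allI impI)
  fix t and e :: real assume t: "t \<in> S" "0 < e"
  have "continuous_on S (dist (\<gamma> t) \<circ> \<gamma>)" by (rule assms[OF lipschitz_on_dist])
  then obtain d where "0 < d" "\<forall>s\<in>S. dist s t < d \<longrightarrow> dist ((dist (\<gamma> t) \<circ> \<gamma>) s) ((dist (\<gamma> t) \<circ> \<gamma>) t) < e"
    using t unfolding continuous_on_iff by blast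
  then show "\<exists>d>0. \<forall>s\<in>S. dist s t < d \<longrightarrow> dist (\<gamma> s) (\<gamma> t) < e"
    by (auto simp: dist_real_def dist_commute)
qed

text \<open>
Baire's theorem yields a ball around some \<open>h0\<close> on which the variation is at most \<open>n\<close>.  Every
\<open>k\<close> with \<open>\<bar>k\<bar> \<le> 1\<close> enters that ball after mixing: the convex combination
\<open>(1 - l) * h0 + l * k\<close> remains 1-Lipschitz, and the weight \<open>l\<close> depends only on the ball and on the
bound of \<open>h0\<close>.  Subtracting the variation of \<open>(1 - l) * h0\<close> leaves a bound for \<open>l * k\<close>.
\<close>

lemma uniform_variation_bound:
  fixes g :: "real \<Rightarrow> 'a::metric_space"
  assumes "\<And>h :: 'a \<Rightarrow> real. 1-lipschitz_on UNIV h \<Longrightarrow> variation (h \<circ> g) a b < top"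
  obtains B where "0 \<le> B"
    "\<And>h :: 'a \<Rightarrow> real. 1-lipschitz_on UNIV h \<Longrightarrow> (\<And>x. \<bar>h x\<bar> \<le> 1) \<Longrightarrow> variation (h \<circ> g) a b \<le> ennreal B"
proof -
  let ?F = "\<lambda>n::nat. {h :: 'a \<Rightarrow>\<^sub>C real. variation (apply_bcontfun h \<circ> g) a b \<le> ennreal (real n)}"
  have "BLIP1 \<subseteq> (\<Union>n. ?F n)"
  proof
    fix h :: "'a \<Rightarrow>\<^sub>C real" assume "h \<in> BLIP1"
    then have "variation (apply_bcontfun h \<circ> g) a b < top" using assms by (simp add: BLIP1_def)
    then obtain r where "variation (apply_bcontfun h \<circ> g) a b = ennreal r" "r \<ge> 0"
      by (metis enn2real_nonneg ennreal_enn2real)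
    moreover obtain n :: nat where "r \<le> real n" using real_arch_simple by blast
    ultimately show "h \<in> (\<Union>n. ?F n)" by (auto intro!: exI[of _ n] simp: ennreal_leI)
  qed
  then obtain n h0 r where h0: "h0 \<in> BLIP1" "0 < r" "BLIP1 \<inter> ball h0 r \<subseteq> ?F n"
    by (rule baire_closed_cover[OF closed_BLIP1 BLIP1_nonempty]) (simp add: closed_variation_le)
  obtain B where B: "\<And>x. \<bar>apply_bcontfun h0 x\<bar> \<le> B"
    using bounded_apply_bcontfun[of h0] by (auto simp: bounded_iff)
  have B0: "0 \<le> B" using B[of undefined] by linarith
  define l where "l = min 1 (r / (2 * (B + 1)))"
  have l: "0 < l" "l \<le> 1" "l \<le> r / (2 * (B + 1))"
    using h0(2) B0 by (auto simp: l_def)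
  then have "l * (2 * (B + 1)) \<le> r"
    using B0 by (subst (asm) pos_le_divide_eq) auto
  then have l_small: "l * (B + 1) < r" using h0(2) by linarith
  have L0: "1-lipschitz_on UNIV (apply_bcontfun h0)" using h0(1) by (simp add: BLIP1_def)
  show thesis
  proof (rule that[of "2 * n / l"])
    fix k :: "'a \<Rightarrow> real" assume k: "1-lipschitz_on UNIV k" "\<And>x. \<bar>k x\<bar> \<le> 1"
    let ?h = "\<lambda>x. (1 - l) * apply_bcontfun h0 x + l * k x"
    have "1-lipschitz_on UNIV ?h"
    proof (rule lipschitz_onI)
      fix x y
      have "dist (?h x) (?h y) \<le> (1 - l) * dist (apply_bcontfun h0 x) (apply_bcontfun h0 y) + l * dist (k x) (k y)"
      proof -
        have "?h x - ?h y = (1 - l) * (apply_bcontfun h0 x - apply_bcontfun h0 y) + l * (k x - k y)"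
          by (simp add: algebra_simps)
        also have "\<bar>\<dots>\<bar> \<le> \<bar>(1 - l) * (apply_bcontfun h0 x - apply_bcontfun h0 y)\<bar> + \<bar>l * (k x - k y)\<bar>"
          by (rule abs_triangle_ineq)
        finally show ?thesis using l by (simp add: abs_mult dist_real_def)
      qed
      also have "\<dots> \<le> (1 - l) * dist x y + l * dist x y"
        using lipschitz_onD[OF L0, of x y] lipschitz_onD[OF k(1), of x y] l
        by (intro add_mono mult_left_mono) auto
      finally show "dist (?h x) (?h y) \<le> 1 * dist x y" by (simp add: algebra_simps)
    qed simp
    moreover have "\<bar>?h x\<bar> \<le> (1 - l) * B + l * 1" for x
    proof -
      have "\<bar>?h x\<bar> \<le> \<bar>(1 - l) * apply_bcontfun h0 x\<bar> + \<bar>l * k x\<bar>" by (rule abs_triangle_ineq)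
      also have "\<dots> \<le> (1 - l) * B + l * 1"
        using l B[of x] k(2)[of x] by (auto simp: abs_mult intro!: add_mono mult_left_mono)
      finally show ?thesis .
    qed
    ultimately obtain h where h: "h \<in> BLIP1" "apply_bcontfun h = ?h"
      by (rule obtain_BLIP1)
    have "dist h0 h \<le> l * (B + 1)"
    proof (rule dist_bound)
      fix x
      have "apply_bcontfun h0 x - apply_bcontfun h x = l * (apply_bcontfun h0 x - k x)"
        by (simp add: h algebra_simps)
      then have "dist (apply_bcontfun h0 x) (apply_bcontfun h x) = l * \<bar>apply_bcontfun h0 x - k x\<bar>"
        using l by (simp add: dist_real_def abs_mult)
      also have "\<bar>apply_bcontfun h0 x - k x\<bar> \<le> B + 1"
        using B[of x] k(2)[of x] by linarith
      finally show "dist (apply_bcontfun h0 x) (apply_bcontfun h x) \<le> l * (B + 1)"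
        using l by (simp add: mult_left_mono)
    qed
    then have h_in: "variation (apply_bcontfun h \<circ> g) a b \<le> ennreal n"
      using h h0(3) l_small by auto
    have h0_in: "variation (apply_bcontfun h0 \<circ> g) a b \<le> ennreal n"
      using h0 by auto
    show "variation (k \<circ> g) a b \<le> ennreal (2 * n / l)"
    proof (rule variation_leI)
      fix N t assume P: "(N, t) \<in> partitions a b"
      let ?S = "\<lambda>f. \<Sum>i=1..N. dist ((f \<circ> g) (t (i - 1))) ((f \<circ> g) (t i))"
      have "ennreal (?S (apply_bcontfun h)) \<le> ennreal n" "ennreal (?S (apply_bcontfun h0)) \<le> ennreal n"
        using partition_sum_le_variation[OF P] h_in h0_in by (blast intro: order_trans)+
      then have S: "?S (apply_bcontfun h) \<le> n" "?S (apply_bcontfun h0) \<le> n" by simp_all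
      have "l * ?S k \<le> ?S (apply_bcontfun h) + (1 - l) * ?S (apply_bcontfun h0)"
        unfolding sum_distrib_left sum.distrib[symmetric]
      proof (rule sum_mono)
        fix i
        let ?x = "g (t (i - 1))" and ?y = "g (t i)"
        have "l * dist (k ?x) (k ?y) = \<bar>l * (k ?x - k ?y)\<bar>"
          using l by (simp add: abs_mult dist_real_def)
        also have "l * (k ?x - k ?y) = (h ?x - h ?y) - (1 - l) * (h0 ?x - h0 ?y)"
          by (simp add: h algebra_simps)
        also have "\<bar>\<dots>\<bar> \<le> \<bar>h ?x - h ?y\<bar> + \<bar>(1 - l) * (h0 ?x - h0 ?y)\<bar>"
          by (rule abs_triangle_ineq4)
        finally show "l * dist ((k \<circ> g) (t (i - 1))) ((k \<circ> g) (t i))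
            \<le> dist ((h \<circ> g) (t (i - 1))) ((h \<circ> g) (t i)) + (1 - l) * dist ((h0 \<circ> g) (t (i - 1))) ((h0 \<circ> g) (t i))"
          using l by (simp add: abs_mult dist_real_def)
      qed
      also have "\<dots> \<le> real n + 1 * ?S (apply_bcontfun h0)"
        using S l by (intro add_mono mult_right_mono) (auto intro: sum_nonneg)
      also have "\<dots> \<le> 2 * n" using S by simp
      finally show "ennreal (?S k) \<le> ennreal (2 * n / l)"
        using l by (intro ennreal_leI) (simp add: field_simps)
    qed
  qed (use l in simp)
qed

text \<open>
The balls of radius \<open>\<rho> / 2\<close> around the points of \<open>Z\<close> are disjoint, so that a continuous curve cannot
pass from one point of \<open>Z\<close> to another without leaving all of them.  The function
\<open>max 0 (\<rho> / 2 - infdist x Z)\<close> thus drops from \<open>\<rho> / 2\<close> to \<open>0\<close> between any two visits.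
\<close>

lemma separated_card_bound:
  fixes g :: "real \<Rightarrow> 'a::metric_space"
  assumes g: "continuous_on {a..b} g" and "0 < \<rho>" "\<rho> \<le> 1"
    and B: "\<And>h :: 'a \<Rightarrow> real. 1-lipschitz_on UNIV h \<Longrightarrow> (\<And>x. \<bar>h x\<bar> \<le> 1) \<Longrightarrow> variation (h \<circ> g) a b \<le> ennreal B"
    and B0: "0 \<le> B"
    and Z: "finite Z" "Z \<subseteq> g ` {a..b}" and sep: "\<And>y z. y \<in> Z \<Longrightarrow> z \<in> Z \<Longrightarrow> y \<noteq> z \<Longrightarrow> \<rho> \<le> dist y z"
  shows "(real (card Z) - 1) * \<rho> \<le> 2 * B"
proof (cases "Z = {}")
  case False
  obtain T where T: "T \<subseteq> {a..b}" "inj_on g T" "Z = g ` T"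
    using Z(2) by (auto simp: subset_image_inj)
  define h where "h x = max 0 (\<rho> / 2 - infdist x Z)" for x
  have h_lip: "1-lipschitz_on UNIV h"
  proof (rule lipschitz_onI)
    fix x y
    have "\<bar>infdist x Z - infdist y Z\<bar> \<le> dist x y" by (rule infdist_triangle_abs)
    then show "dist (h x) (h y) \<le> 1 * dist x y"
      by (auto simp: h_def dist_real_def max_def abs_if split: if_splits)
  qed simp
  have h_bd: "\<bar>h x\<bar> \<le> 1" for x
    using infdist_nonneg[of x Z] \<open>\<rho> \<le> 1\<close> \<open>0 < \<rho>\<close> by (auto simp: h_def)
  have osc: "ennreal (\<rho> / 2) \<le> variation (h \<circ> g) s t" if st: "s \<in> T" "t \<in> T" "s < t" for s t
  proof -
    have ab: "{s..t} \<subseteq> {a..b}" using st T(1) by auto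
    have "\<exists>u\<in>{s..t}. h (g u) = 0"
    proof (rule ccontr)
      assume *: "\<not> ?thesis"
      have near: "\<exists>z\<in>Z. dist z (g u) < \<rho> / 2" if "u \<in> {s..t}" for u
      proof -
        have "infdist (g u) Z < \<rho> / 2" using * that by (force simp: h_def max_def split: if_splits)
        then obtain z where "z \<in> Z" "dist (g u) z < \<rho> / 2"
          using False cInf_lessD[of "dist (g u) ` Z" "\<rho> / 2"] by (auto simp: infdist_notempty)
        then show ?thesis by (auto simp: dist_commute)
      qed
      let ?U = "ball (g s) (\<rho> / 2)" and ?V = "\<Union>z\<in>Z - {g s}. ball z (\<rho> / 2)"
      have conn: "connected (g ` {s..t})"
        by (intro connected_continuous_image continuous_on_subset[OF g ab]) simp
      have "?U \<inter> ?V = {}"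
      proof (rule ccontr)
        assume "?U \<inter> ?V \<noteq> {}"
        then obtain z x where "z \<in> Z" "z \<noteq> g s" "dist (g s) x < \<rho> / 2" "dist z x < \<rho> / 2"
          unfolding disjoint_iff by (auto simp: mem_ball)
        moreover have "\<rho> \<le> dist (g s) z" using sep[of "g s" z] calculation st T(3) by auto
        ultimately show False using dist_triangle2[of "g s" z x] by linarith
      qed
      moreover have "g ` {s..t} \<subseteq> ?U \<union> ?V" using near by (force simp: image_subset_iff)
      moreover have "g s \<in> ?U \<inter> g ` {s..t}" using st \<open>0 < \<rho>\<close> by auto
      moreover have "g t \<noteq> g s" using T(2) st by (metis inj_onD less_irrefl)
      then have "g t \<in> ?V \<inter> g ` {s..t}" using st \<open>0 < \<rho>\<close> T(3) by (auto intro!: bexI[of _ "g t"])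
      ultimately show False
        using connectedD[OF conn, of ?U ?V] by (metis empty_iff inf_bot_left open_UN open_ball)
    qed
    then obtain u where u: "s \<le> u" "u \<le> t" "h (g u) = 0" by auto
    have "g s \<in> Z" using st T by auto
    then have "h (g s) = \<rho> / 2" using \<open>0 < \<rho>\<close> by (simp add: h_def)
    then have "ennreal (\<rho> / 2) = ennreal (dist ((h \<circ> g) s) ((h \<circ> g) u))" using u \<open>0 < \<rho>\<close> by simp
    also have "\<dots> \<le> variation (h \<circ> g) s u" by (rule dist_le_variation) (rule u)
    also have "\<dots> \<le> variation (h \<circ> g) s t" by (rule variation_mono_right) (use u in auto)
    finally show ?thesis .
  qed
  have fin: "finite T" using T Z by (simp add: finite_image_iff)
  have "A \<subseteq> T \<Longrightarrow> A \<noteq> {} \<Longrightarrow> ennreal ((real (card A) - 1) * (\<rho> / 2)) \<le> variation (h \<circ> g) a (Max A)" if "finite A" for A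
    using that
  proof (induction A rule: finite_linorder_max_induct)
    case (insert t A)
    show ?case
    proof (cases "A = {}")
      case False
      let ?s = "Max A"
      have s: "?s \<in> A" "?s < t" using insert False by auto
      have "ennreal ((real (card (insert t A)) - 1) * (\<rho> / 2)) = ennreal ((real (card A) - 1) * (\<rho> / 2) + \<rho> / 2)"
      proof -
        have "card (insert t A) = Suc (card A)" using insert by (subst card_insert_disjoint) auto
        then have "(real (card (insert t A)) - 1) * (\<rho> / 2) = (real (card A) - 1) * (\<rho> / 2) + \<rho> / 2"
          by (simp add: field_simps)
        then show ?thesis by (rule arg_cong)
      qed
      also have "\<dots> = ennreal ((real (card A) - 1) * (\<rho> / 2)) + ennreal (\<rho> / 2)"
        using False insert \<open>0 < \<rho>\<close> by (intro ennreal_plus mult_nonneg_nonneg) (auto simp: Suc_leI card_gt_0_iff)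
      also have "\<dots> \<le> variation (h \<circ> g) a ?s + variation (h \<circ> g) ?s t"
      proof (intro add_mono osc)
        show "ennreal ((real (card A) - 1) * (\<rho> / 2)) \<le> variation (h \<circ> g) a ?s"
          using insert.IH insert.prems False by blast
        show "?s \<in> T" "t \<in> T" "?s < t" using insert.prems s by blast+
      qed
      also have "\<dots> \<le> variation (h \<circ> g) a t"
        using s insert T(1) by (intro variation_superadditive) auto
      finally have "ennreal ((real (card (insert t A)) - 1) * (\<rho> / 2)) \<le> variation (h \<circ> g) a t" .
      moreover have mx: "Max (insert t A) = t" using insert.hyps(1) False s(2) by simp
      ultimately show ?thesis by (subst mx)
    qed simp
  qed simp
  from this[OF fin] False T(3)
  have "ennreal ((real (card T) - 1) * (\<rho> / 2)) \<le> variation (h \<circ> g) a (Max T)" by auto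
  also have "\<dots> \<le> variation (h \<circ> g) a b"
  proof (rule variation_mono_right)
    have "Max T \<in> T" using fin False T(3) by auto
    then show "a \<le> Max T" "Max T \<le> b" using T(1) by auto
  qed
  also have "\<dots> \<le> ennreal B" by (rule B[OF h_lip h_bd])
  finally have "(real (card T) - 1) * (\<rho> / 2) \<le> B" using B0 by (simp only: ennreal_le_iff)
  moreover have "card T = card Z" using T by (simp add: card_image)
  ultimately show ?thesis by simp
next
  case True
  have "(-1) * \<rho> \<le> 2 * B" using B0 assms(2) by linarith
  then show ?thesis using True by simp
qed

section \<open>Lipschitz parametrization of a continuum of finite length\<close>

lemma nat_floor_bounds:
  assumes "0 \<le> (x::real)"
  shows "real (nat \<lfloor>x\<rfloor>) \<le> x" "x \<le> real (nat \<lfloor>x\<rfloor>) + 1"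
proof -
  have "real (nat \<lfloor>x\<rfloor>) = real_of_int \<lfloor>x\<rfloor>" using assms by simp
  then show "real (nat \<lfloor>x\<rfloor>) \<le> x" "x \<le> real (nat \<lfloor>x\<rfloor>) + 1" by linarith+
qed

text \<open>
This is the depth-first tour of a spanning tree, grown one vertex at a time: connectedness provides a
new vertex \<open>v\<close> near a visited vertex \<open>w\<close>, and the detour \<open>w, v, w\<close> is spliced in.
\<close>

lemma net_tour:
  assumes conn: "connected \<Gamma>" and Z: "finite Z" "Z \<noteq> {}" "Z \<subseteq> \<Gamma>" and cov: "\<Gamma> \<subseteq> (\<Union>z\<in>Z. ball z \<rho>)"
    and "0 < \<rho>"
  obtains xs where "set xs = Z" "length xs < 2 * card Z" "successively (\<lambda>x y. dist x y < 2 * \<rho>) xs"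
proof -
  let ?P = "\<lambda>xs. set xs \<subseteq> Z \<and> xs \<noteq> [] \<and> length xs < 2 * card (set xs) \<and> successively (\<lambda>x y. dist x y < 2 * \<rho>) xs"
  have "\<exists>xs. ?P xs \<and> card (set xs) = k" if "1 \<le> k" "k \<le> card Z" for k
    using that
  proof (induction k rule: nat_induct_at_least)
    case base
    obtain z where "z \<in> Z" using Z by auto
    then have "?P [z] \<and> card (set [z]) = 1" by auto
    then show ?case by blast
  next
    case (Suc k)
    then obtain xs where xs: "?P xs" "card (set xs) = k" by auto
    let ?U = "\<Union>w\<in>set xs. ball w \<rho>" and ?V = "\<Union>v\<in>Z - set xs. ball v \<rho>"
    have "set xs \<noteq> Z" using xs Suc by auto
    then obtain v0 where v0: "v0 \<in> Z - set xs" using xs by auto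
    have "?U \<inter> ?V \<inter> \<Gamma> \<noteq> {}"
    proof
      assume "?U \<inter> ?V \<inter> \<Gamma> = {}"
      moreover have "\<Gamma> \<subseteq> ?U \<union> ?V" using cov by auto
      moreover have "hd xs \<in> set xs" using xs by simp
      then have "hd xs \<in> ?U \<inter> \<Gamma>" using xs Z \<open>0 < \<rho>\<close> by (blast intro: centre_in_ball[THEN iffD2])
      moreover have "v0 \<in> ?V \<inter> \<Gamma>" using v0 Z \<open>0 < \<rho>\<close> by (auto intro!: bexI[of _ v0])
      ultimately show False using connectedD[OF conn, of ?U ?V] by (metis empty_iff open_UN open_ball)
    qed
    then obtain w v x where wv: "w \<in> set xs" "v \<in> Z" "v \<notin> set xs" "dist w x < \<rho>" "dist v x < \<rho>" by auto
    then have d: "dist w v < 2 * \<rho>" "dist v w < 2 * \<rho>"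
      using dist_triangle2[of w v x] by (auto simp: dist_commute)
    obtain ys zs where split: "xs = ys @ w # zs" using wv(1) by (auto dest: split_list)
    let ?xs = "ys @ w # v # w # zs"
    have set: "set ?xs = insert v (set xs)" using split by auto
    then have card: "card (set ?xs) = Suc k" using wv xs by simp
    have "successively (\<lambda>x y. dist x y < 2 * \<rho>) ?xs"
      using xs d unfolding split by (auto simp: successively_append_iff successively_Cons)
    then have "?P ?xs" using set card xs wv split by auto
    then show ?case using card by blast
  qed
  moreover have "1 \<le> card Z" using Z by (simp add: Suc_leI card_gt_0_iff)
  ultimately obtain xs where "?P xs" "card (set xs) = card Z" by blast
  then show thesis using that[of xs] Z by (simp add: card_subset_eq)
qed

lemma compact_Pi_UNIV:
  fixes \<Gamma> :: "'b::topological_space set"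
  assumes "compact \<Gamma>"
  shows "compact {f :: 'a \<Rightarrow> 'b. \<forall>t. f t \<in> \<Gamma>}"
proof -
  have "compactin (product_topology (\<lambda>_::'a. euclidean) UNIV) (PiE UNIV (\<lambda>_. \<Gamma>))"
    using assms by (auto simp: compactin_PiE)
  then show ?thesis
    by (simp add: euclidean_product_topology PiE_UNIV_domain Pi_def)
qed

text \<open>
Tychonoff's theorem in the role of the Arzela-Ascoli theorem.  A cluster point in the product topology
is approximated, for arbitrarily large \<open>n\<close>, at finitely many times simultaneously, and that is enough
for the limit arguments below.
\<close>

lemma pointwise_cluster_point:
  fixes f :: "nat \<Rightarrow> 'a \<Rightarrow> 'b::metric_space"
  assumes "compact \<Gamma>" "\<And>n t. f n t \<in> \<Gamma>"
  obtains g where "\<And>t. g t \<in> \<Gamma>"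
    "\<And>J \<epsilon> m. finite J \<Longrightarrow> 0 < \<epsilon> \<Longrightarrow> \<exists>n\<ge>m. \<forall>t\<in>J. dist (f n t) (g t) < \<epsilon>"
proof -
  let ?K = "{f :: 'a \<Rightarrow> 'b. \<forall>t. f t \<in> \<Gamma>}"
  have "filtermap f sequentially \<noteq> bot" "eventually (\<lambda>x. x \<in> ?K) (filtermap f sequentially)"
    using assms(2) by (auto simp: filtermap_bot_iff eventually_filtermap)
  then obtain g where g: "g \<in> ?K" "inf (nhds g) (filtermap f sequentially) \<noteq> bot"
    using compact_Pi_UNIV[OF assms(1)] unfolding compact_filter by blast
  show thesis
  proof (rule that[of g])
    show "g t \<in> \<Gamma>" for t using g by auto
    fix J :: "'a set" and \<epsilon> :: real and m :: nat
    assume J: "finite J" "0 < \<epsilon>"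
    let ?O = "\<Inter>t\<in>J. {q. dist (q t) (g t) < \<epsilon>}"
    have "open ?O"
      using J by (intro open_INT ballI open_Collect_less continuous_intros continuous_on_product_coordinates) auto
    then have "eventually (\<lambda>q. q \<in> ?O) (nhds g)"
      using J by (intro eventually_nhds_in_open) auto
    show "\<exists>n\<ge>m. \<forall>t\<in>J. dist (f n t) (g t) < \<epsilon>"
    proof (rule ccontr)
      assume *: "\<not> ?thesis"
      then have "eventually (\<lambda>q. q \<notin> ?O) (filtermap f sequentially)"
        unfolding eventually_filtermap eventually_sequentially by force
      then have "eventually (\<lambda>q. False) (inf (nhds g) (filtermap f sequentially))"
        using \<open>eventually (\<lambda>q. q \<in> ?O) (nhds g)\<close> unfolding eventually_inf by blast
      then show False using g(2) by (simp add: trivial_limit_def)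
    qed
  qed
qed

text \<open>
The maps \<open>f n\<close> are Lipschitz and onto up to an error \<open>e n\<close>; they may be step functions.  The Lipschitz
bound for a cluster point involves two times only, and density of its image a finite grid of times.
\<close>

lemma lipschitz_surjection_limit:
  fixes f :: "nat \<Rightarrow> real \<Rightarrow> 'a::metric_space"
  assumes "compact \<Gamma>" "\<And>n t. f n t \<in> \<Gamma>" "0 \<le> T" "0 \<le> L"
    and e: "e \<longlonglongrightarrow> 0"
    and lip: "\<And>n s t. 0 \<le> s \<Longrightarrow> s \<le> t \<Longrightarrow> t \<le> T \<Longrightarrow> dist (f n s) (f n t) \<le> L * (t - s) + e n"
    and dense: "\<And>n x. x \<in> \<Gamma> \<Longrightarrow> \<exists>t\<in>{0..T}. dist (f n t) x \<le> e n"
  obtains g where "L-lipschitz_on {0..T} g" "g ` {0..T} = \<Gamma>"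
proof -
  obtain g where g: "\<And>t. g t \<in> \<Gamma>"
    and near: "\<And>J \<epsilon> m. finite J \<Longrightarrow> 0 < \<epsilon> \<Longrightarrow> \<exists>n\<ge>m. \<forall>t\<in>J. dist (f n t) (g t) < \<epsilon>"
    using pointwise_cluster_point[of \<Gamma> f] assms(1,2) by blast
  have near': "\<exists>n. e n < \<epsilon> \<and> (\<forall>t\<in>J. dist (f n t) (g t) < \<epsilon>)" if "finite J" "0 < \<epsilon>" for J \<epsilon>
  proof -
    have "eventually (\<lambda>n. e n < \<epsilon>) sequentially" using e that by (auto dest: order_tendstoD)
    then obtain m where "\<And>n. n \<ge> m \<Longrightarrow> e n < \<epsilon>" by (auto simp: eventually_sequentially)
    then show ?thesis using near[OF that, of m] by blast
  qed
  have le: "dist (g s) (g t) \<le> L * (t - s)" if st: "0 \<le> s" "s \<le> t" "t \<le> T" for s t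
  proof (rule field_le_epsilon)
    fix \<epsilon> :: real assume "0 < \<epsilon>"
    then obtain n where n: "e n < \<epsilon> / 3" "dist (f n s) (g s) < \<epsilon> / 3" "dist (f n t) (g t) < \<epsilon> / 3"
      using near'[of "{s, t}" "\<epsilon> / 3"] by auto
    have "dist (g s) (g t) \<le> dist (f n s) (g s) + dist (f n s) (f n t) + dist (f n t) (g t)"
      by (smt (verit) dist_commute dist_triangle)
    then show "dist (g s) (g t) \<le> L * (t - s) + \<epsilon>" using n lip[OF st, of n] by linarith
  qed
  have lip_g: "L-lipschitz_on {0..T} g"
  proof (rule lipschitz_onI)
    fix s t assume "s \<in> {0..T}" "t \<in> {0..T}"
    then show "dist (g s) (g t) \<le> L * dist s t"
      using le[of s t] le[of t s] by (cases "s \<le> t") (auto simp: dist_real_def dist_commute)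
  qed fact
  have "compact (g ` {0..T})"
    by (intro compact_continuous_image lipschitz_on_continuous_on[OF lip_g]) simp
  then have closed: "closed (g ` {0..T})" by (rule compact_imp_closed)
  have "\<Gamma> \<subseteq> g ` {0..T}"
  proof
    fix x assume x: "x \<in> \<Gamma>"
    have "\<exists>y\<in>g ` {0..T}. dist y x < \<epsilon>" if "0 < \<epsilon>" for \<epsilon>
    proof -
      define \<eta> where "\<eta> = \<epsilon> / (2 * (L + 4))"
      have \<eta>: "0 < \<eta>" "(L + 4) * \<eta> = \<epsilon> / 2"
        using that \<open>0 \<le> L\<close> by (simp_all add: \<eta>_def field_simps)
          define J where "J = (\<lambda>i. real i * \<eta>) ` {i. real i * \<eta> \<le> T}"
      have "{i. real i * \<eta> \<le> T} \<subseteq> {..nat \<lceil>T / \<eta>\<rceil>}"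
      proof
        fix i assume "i \<in> {i. real i * \<eta> \<le> T}"
        then have "real i \<le> T / \<eta>" using \<eta> by (simp add: field_simps)
        then show "i \<in> {..nat \<lceil>T / \<eta>\<rceil>}" by (simp add: le_nat_iff) linarith
      qed
      then have "finite J" unfolding J_def using finite_subset by blast
      then obtain n where n: "e n < \<eta>" "\<And>t. t \<in> J \<Longrightarrow> dist (f n t) (g t) < \<eta>"
        using near'[of J \<eta>] \<eta> by auto
      obtain t where t: "0 \<le> t" "t \<le> T" "dist (f n t) x \<le> e n" using dense[OF x, of n] by auto
      define s where "s = real (nat \<lfloor>t / \<eta>\<rfloor>) * \<eta>"
      have fl: "real (nat \<lfloor>t / \<eta>\<rfloor>) \<le> t / \<eta>" "t / \<eta> \<le> real (nat \<lfloor>t / \<eta>\<rfloor>) + 1"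
        using nat_floor_bounds[of "t / \<eta>"] t \<eta> by auto
      have s: "s \<le> t" "t \<le> s + \<eta>" "0 \<le> s"
        using fl \<eta> by (auto simp: s_def field_simps)
      have "s \<in> J"
        unfolding J_def
      proof (rule image_eqI)
        show "s = real (nat \<lfloor>t / \<eta>\<rfloor>) * \<eta>" by (rule s_def)
        show "nat \<lfloor>t / \<eta>\<rfloor> \<in> {i. real i * \<eta> \<le> T}"
          using s(1) t(2) unfolding s_def mem_Collect_eq by linarith
      qed
      then have 1: "dist (f n s) (g s) < \<eta>" by (rule n)
      have 2: "dist (f n s) (f n t) \<le> L * \<eta> + e n"
        using lip[of s t n] s t mult_left_mono[of "t - s" \<eta> L] \<open>0 \<le> L\<close> by auto
      have "dist (g s) x \<le> dist (f n s) (g s) + dist (f n s) (f n t) + dist (f n t) x"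
        by (smt (verit) dist_commute dist_triangle)
      also have "\<dots> < L * \<eta> + 4 * \<eta>" using 1 2 t n \<eta> by linarith
      also have "\<dots> < \<epsilon>" using \<eta> that by (simp add: algebra_simps)
      finally show ?thesis using s t by (intro bexI[of _ "g s"]) auto
    qed
    then have "x \<in> closure (g ` {0..T})" by (simp add: closure_approachable)
    then show "x \<in> g ` {0..T}" using closed by (simp add: closure_closed)
  qed
  then have "g ` {0..T} = \<Gamma>" using g by auto
  with lip_g show thesis by (rule that)
qed

lemma maximal_separated_net:
  fixes \<Gamma> :: "'a::metric_space set"
  assumes "\<Gamma> \<noteq> {}" "0 < \<rho>"
    and bound: "\<And>Z. finite Z \<Longrightarrow> Z \<subseteq> \<Gamma> \<Longrightarrow> (\<And>y z. y \<in> Z \<Longrightarrow> z \<in> Z \<Longrightarrow> y \<noteq> z \<Longrightarrow> \<rho> \<le> dist y z) \<Longrightarrow> card Z \<le> M"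
  obtains Z where "finite Z" "Z \<noteq> {}" "Z \<subseteq> \<Gamma>" "card Z \<le> M" "\<Gamma> \<subseteq> (\<Union>z\<in>Z. ball z \<rho>)"
proof -
  let ?P = "\<lambda>Z. finite Z \<and> Z \<subseteq> \<Gamma> \<and> (\<forall>y\<in>Z. \<forall>z\<in>Z. y \<noteq> z \<longrightarrow> \<rho> \<le> dist y z)"
  have bd: "card Z \<le> M" if "?P Z" for Z
    by (rule bound) (use that in auto)
  have "\<forall>Y. ?P Y \<longrightarrow> card Y < Suc M"
  proof (intro allI impI)
    fix Y assume "?P Y"
    then have "card Y \<le> M" by (rule bd)
    then show "card Y < Suc M" by simp
  qed
  then have "\<exists>Z. ?P Z \<and> (\<forall>Y. ?P Y \<longrightarrow> card Y \<le> card Z)"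
    by (rule ex_has_greatest_nat[rotated, where k = "{}"]) simp
  then obtain Z where Z: "?P Z" "\<And>Y. ?P Y \<Longrightarrow> card Y \<le> card Z" by (elim exE conjE) (rule that, auto)
  have cov: "\<Gamma> \<subseteq> (\<Union>z\<in>Z. ball z \<rho>)"
  proof (rule ccontr)
    assume "\<not> ?thesis"
    then obtain x where x: "x \<in> \<Gamma>" "\<And>z. z \<in> Z \<Longrightarrow> \<rho> \<le> dist z x" by (force simp: not_less)
    then have "x \<notin> Z" using \<open>0 < \<rho>\<close> by force
    moreover have "?P (insert x Z)" using Z x by (auto simp: dist_commute)
    ultimately show False using Z(2)[of "insert x Z"] Z(1) by simp
  qed
  moreover have "Z \<noteq> {}" using cov assms(1) by auto
  ultimately show thesis using that[of Z] Z(1) bd[OF Z(1)] by simp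
qed

lemma dist_nth_le:
  assumes "successively (\<lambda>x y. dist x y < (d::real)) xs" "i \<le> j" "j < length xs"
  shows "dist (xs ! i) (xs ! j) \<le> d * real (j - i)"
  using assms(2,3)
proof (induction j rule: dec_induct)
  case (step j)
  have "dist (xs ! j) (xs ! Suc j) < d"
    using assms(1) step by (simp add: successively_conv_nth)
  then have "dist (xs ! i) (xs ! Suc j) \<le> d * real (j - i) + d"
    using step dist_triangle[of "xs ! i" "xs ! Suc j" "xs ! j"] by auto
  also have "\<dots> = d * real (Suc j - i)" using step by (simp add: algebra_simps of_nat_diff)
  finally show ?case .
qed simp

text \<open>
A net at scale \<open>\<rho>\<close> has about \<open>B / \<rho>\<close> points and its tour takes steps of length less than \<open>2 * \<rho>\<close>.
Walked with one step per time \<open>\<rho>\<close>, the tour is 2-Lipschitz up to an error \<open>2 * \<rho>\<close> and ends within a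
time that does not depend on \<open>\<rho>\<close>.
\<close>

lemma lipschitz_parametrization:
  fixes \<Gamma> :: "'a::metric_space set"
  assumes \<Gamma>: "compact \<Gamma>" "connected \<Gamma>" "\<Gamma> \<noteq> {}"
    and bound: "\<And>Z \<rho>. 0 < \<rho> \<Longrightarrow> \<rho> \<le> 1 \<Longrightarrow> finite Z \<Longrightarrow> Z \<subseteq> \<Gamma> \<Longrightarrow>
       (\<And>y z. y \<in> Z \<Longrightarrow> z \<in> Z \<Longrightarrow> y \<noteq> z \<Longrightarrow> \<rho> \<le> dist y z) \<Longrightarrow> (real (card Z) - 1) * \<rho> \<le> B"
    and "0 \<le> B"
  obtains T and g :: "real \<Rightarrow> 'a" where "0 < T" "2-lipschitz_on {0..T} g" "g ` {0..T} = \<Gamma>"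
proof -
  \<comment> \<open>A tour visits at most \<open>2 * (B / \<rho> + 1)\<close> vertices, one per time \<open>\<rho>\<close>, and \<open>\<rho> \<le> 1\<close>.\<close>
  define T where "T = 2 + 2 * B"
  let ?r = "\<lambda>n. 1 / real (Suc n)"
  define P where "P n f \<longleftrightarrow> (\<forall>t. f t \<in> \<Gamma>) \<and>
     (\<forall>s t. 0 \<le> s \<longrightarrow> s \<le> t \<longrightarrow> dist (f s) (f t) \<le> 2 * (t - s) + 2 * ?r n) \<and>
     (\<forall>x\<in>\<Gamma>. \<exists>t\<in>{0..T}. dist (f t) x \<le> 2 * ?r n)" for n and f :: "real \<Rightarrow> 'a"
  have "\<exists>f. P n f" for n
  proof -
    define \<rho> where "\<rho> = ?r n"
    have \<rho>: "0 < \<rho>" "\<rho> \<le> 1" by (auto simp: \<rho>_def)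
    have "card Z \<le> nat \<lfloor>B / \<rho> + 1\<rfloor>" if "finite Z" "Z \<subseteq> \<Gamma>" "\<And>y z. y \<in> Z \<Longrightarrow> z \<in> Z \<Longrightarrow> y \<noteq> z \<Longrightarrow> \<rho> \<le> dist y z" for Z
    proof -
      have "(real (card Z) - 1) * \<rho> \<le> B" by (rule bound[OF \<rho>]) (use that in auto)
      then have "real (card Z) \<le> B / \<rho> + 1" using \<rho> by (simp add: field_simps)
      then show ?thesis by (rule le_nat_floor)
    qed
    then obtain Z where Z: "finite Z" "Z \<noteq> {}" "Z \<subseteq> \<Gamma>" "card Z \<le> nat \<lfloor>B / \<rho> + 1\<rfloor>" "\<Gamma> \<subseteq> (\<Union>z\<in>Z. ball z \<rho>)"
      by (rule maximal_separated_net[OF \<Gamma>(3) \<rho>(1)])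
    obtain xs where xs: "set xs = Z" "length xs < 2 * card Z" "successively (\<lambda>x y. dist x y < 2 * \<rho>) xs"
      by (rule net_tour[OF \<Gamma>(2) Z(1-3,5) \<rho>(1)])
    have "xs \<noteq> []" using xs Z by auto
    have len: "real (length xs) * \<rho> \<le> T"
    proof -
      have "0 \<le> B / \<rho> + 1" using \<rho> \<open>0 \<le> B\<close> by simp
      then have "real (card Z) \<le> B / \<rho> + 1" using Z(4) by linarith
      moreover have "real (length xs) \<le> 2 * real (card Z)" using xs(2) by simp
      ultimately have "real (length xs) \<le> 2 * (B / \<rho> + 1)" by argo
      then have "real (length xs) * \<rho> \<le> 2 * (B / \<rho> + 1) * \<rho>" using \<rho> by (intro mult_right_mono) auto
      also have "\<dots> = 2 * B + 2 * \<rho>" using \<rho> by (simp add: field_simps)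
      finally show ?thesis using \<rho> by (simp add: T_def)
    qed
    \<comment> \<open>After the end of the tour the walk waits at its last vertex.\<close>
    define k where "k t = min (nat \<lfloor>t / \<rho>\<rfloor>) (length xs - 1)" for t
    define f where "f t = xs ! k t" for t
    have k_lt: "k t < length xs" for t
    proof -
      have "k t \<le> length xs - 1" unfolding k_def by (rule min.cobounded2)
      moreover have "0 < length xs" using \<open>xs \<noteq> []\<close> by simp
      ultimately show ?thesis by linarith
    qed
    have "f t \<in> \<Gamma>" for t using k_lt[of t] xs(1) Z(3) nth_mem unfolding f_def by blast
    moreover have "dist (f s) (f t) \<le> 2 * (t - s) + 2 * \<rho>" if st: "0 \<le> s" "s \<le> t" for s t
    proof -
      have le: "k s \<le> k t"
        unfolding k_def using st \<rho> by (intro min.mono nat_mono floor_mono divide_right_mono) auto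
      have "real (k t - k s) \<le> real (nat \<lfloor>t / \<rho>\<rfloor> - nat \<lfloor>s / \<rho>\<rfloor>)"
        unfolding of_nat_le_iff k_def by linarith
      also have "\<dots> \<le> (t - s) / \<rho> + 1"
      proof -
        have "nat \<lfloor>s / \<rho>\<rfloor> \<le> nat \<lfloor>t / \<rho>\<rfloor>" using st \<rho> by (intro nat_mono floor_mono divide_right_mono) auto
        moreover have "real (nat \<lfloor>t / \<rho>\<rfloor>) \<le> t / \<rho>" "s / \<rho> \<le> real (nat \<lfloor>s / \<rho>\<rfloor>) + 1"
          using nat_floor_bounds[of "t / \<rho>"] nat_floor_bounds[of "s / \<rho>"] st \<rho> by auto
        ultimately show ?thesis by (simp add: of_nat_diff diff_divide_distrib)
      qed
      finally have "2 * \<rho> * real (k t - k s) \<le> 2 * \<rho> * ((t - s) / \<rho> + 1)"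
        using \<rho> by (intro mult_left_mono) auto
      also have "\<dots> = 2 * (t - s) + 2 * \<rho>" using \<rho> by (simp add: field_simps)
      finally show ?thesis using dist_nth_le[OF xs(3) le k_lt] unfolding f_def by linarith
    qed
    moreover have "\<exists>t\<in>{0..T}. dist (f t) x \<le> 2 * \<rho>" if x: "x \<in> \<Gamma>" for x
    proof -
      obtain z where z: "z \<in> Z" "dist z x < \<rho>" using Z(5) x by auto
      then obtain i where i: "i < length xs" "xs ! i = z" using xs(1) by (auto simp: in_set_conv_nth)
      have "k (real i * \<rho>) = i" using i(1) \<rho> by (simp add: k_def)
      then have "f (real i * \<rho>) = z" using i(2) by (simp add: f_def)
      moreover have "real i * \<rho> \<le> real (length xs) * \<rho>" using i \<rho> by (intro mult_right_mono) auto
      then have "real i * \<rho> \<le> T" using len by linarith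
      ultimately show ?thesis using z \<rho> by (intro bexI[of _ "real i * \<rho>"]) auto
    qed
    ultimately have "P n f" unfolding P_def \<rho>_def by blast
    then show ?thesis by (intro exI[of "P n" f])
  qed
  then obtain f where P: "\<And>n. P n (f n)" by metis
  have f: "f n t \<in> \<Gamma>" for n t using P[of n] by (simp add: P_def)
  have f_lip: "dist (f n s) (f n t) \<le> 2 * (t - s) + 2 * ?r n" if "0 \<le> s" "s \<le> t" for n s t
    using P[of n] that by (simp add: P_def)
  have f_dense: "\<exists>t\<in>{0..T}. dist (f n t) x \<le> 2 * ?r n" if "x \<in> \<Gamma>" for n x
    using P[of n] that by (simp add: P_def)
  have "(\<lambda>n. 2 * ?r n) \<longlonglongrightarrow> 2 * 0" by (intro tendsto_mult_left LIMSEQ_Suc lim_1_over_n)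
  then have lim: "(\<lambda>n. 2 * ?r n) \<longlonglongrightarrow> 0" by simp
  have "0 < T" using \<open>0 \<le> B\<close> by (simp add: T_def)
  obtain g where "2-lipschitz_on {0..T} g" "g ` {0..T} = \<Gamma>"
    by (rule lipschitz_surjection_limit[OF \<Gamma>(1) f less_imp_le[OF \<open>0 < T\<close>] zero_le_numeral lim f_lip f_dense])
  then show thesis using that[of T g] \<open>0 < T\<close> by blast
qed

section \<open>Arc length and metric speed\<close>

lemma variation_lipschitz_le:
  fixes g :: "real \<Rightarrow> 'a::metric_space"
  assumes "K-lipschitz_on {c..d} g" "c \<le> d"
  shows "variation g c d \<le> ennreal (K * (d - c))"
proof -
  have "variation g c d \<le> ennreal (K * d - K * c)"
  proof (rule variation_le_increment)
    fix s t assume "c \<le> s" "s \<le> t" "t \<le> d"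
    then show "dist (g s) (g t) \<le> K * t - K * s"
      using lipschitz_onD[OF assms(1), of s t] by (simp add: dist_real_def algebra_simps)
  qed
  then show ?thesis by (simp add: algebra_simps)
qed

text \<open>
With \<open>v t\<close> the variation on \<open>{0..t}\<close>, the curve \<open>\<sigma>\<close> is determined by \<open>\<sigma> (v t) = g t\<close>: where \<open>v\<close> is
constant, so is \<open>g\<close>.
\<close>

lemma arclength_reparametrization:
  fixes g :: "real \<Rightarrow> 'a::metric_space"
  assumes g: "K-lipschitz_on {0..T} g" and "0 \<le> T"
  obtains L \<sigma> where "0 \<le> L" "1-lipschitz_on {0..L} \<sigma>" "\<sigma> ` {0..L} = g ` {0..T}"
    "variation \<sigma> 0 L = ennreal L"
proof -
  have fin: "variation g c d < top" if "0 \<le> c" "c \<le> d" "d \<le> T" for c d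
  proof -
    have "variation g c d \<le> ennreal (K * (d - c))"
      using that by (intro variation_lipschitz_le lipschitz_on_subset[OF g]) auto
    then show ?thesis by (auto intro: le_less_trans)
  qed
  define v where "v r = enn2real (variation g 0 r)" for r
  define L where "L = v T"
  have v0: "v 0 = 0"
  proof -
    have "variation g 0 0 \<le> ennreal (0 - 0)"
    proof (rule variation_le_increment[where v = "\<lambda>_. 0"])
      fix s t :: real assume "0 \<le> s" "s \<le> t" "t \<le> 0"
      then have "s = t" by linarith
      then show "dist (g s) (g t) \<le> 0 - 0" by simp
    qed
    then show ?thesis by (simp add: v_def)
  qed
  have v_diff: "v t - v s = enn2real (variation g s t)" if "0 \<le> s" "s \<le> t" "t \<le> T" for s t
    using variation_additive[of 0 s t g] fin that by (simp add: v_def enn2real_plus)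
  have v_dist: "dist (g s) (g t) \<le> v t - v s" if "0 \<le> s" "s \<le> t" "t \<le> T" for s t
    using dist_le_variation_increment[OF fin, of 0 T s t] that by (simp add: v_def)
  have v_mono: "v s \<le> v t" if "0 \<le> s" "s \<le> t" "t \<le> T" for s t
    using v_dist[OF that] zero_le_dist[of "g s" "g t"] by linarith
  have v_lip: "K-lipschitz_on {0..T} v"
  proof (rule lipschitz_onI)
    have *: "\<bar>v t - v s\<bar> \<le> K * (t - s)" if "0 \<le> s" "s \<le> t" "t \<le> T" for s t
    proof -
      have "variation g s t \<le> ennreal (K * (t - s))"
        using that by (intro variation_lipschitz_le lipschitz_on_subset[OF g]) auto
      then have "enn2real (variation g s t) \<le> K * (t - s)"
        using that lipschitz_on_nonneg[OF g] by (intro enn2real_leI) auto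
      then show ?thesis using v_diff[OF that] v_mono[OF that] by simp
    qed
    show "dist (v s) (v t) \<le> K * dist s t" if "s \<in> {0..T}" "t \<in> {0..T}" for s t
      using *[of s t] *[of t s] that by (cases "s \<le> t") (auto simp: dist_real_def abs_minus_commute)
  qed (use lipschitz_on_nonneg[OF g] in simp)
  have "\<exists>t. 0 \<le> t \<and> t \<le> T \<and> v t = u" if "0 \<le> u" "u \<le> L" for u
    using that v0 \<open>0 \<le> T\<close> by (intro IVT' lipschitz_on_continuous_on[OF v_lip]) (auto simp: L_def)
  then obtain \<tau> where \<tau>: "\<And>u. 0 \<le> u \<Longrightarrow> u \<le> L \<Longrightarrow> 0 \<le> \<tau> u \<and> \<tau> u \<le> T \<and> v (\<tau> u) = u"
    by metis
  define \<sigma> where "\<sigma> = g \<circ> \<tau>"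
  have v_abs: "dist (g s) (g t) \<le> \<bar>v t - v s\<bar>" if "s \<in> {0..T}" "t \<in> {0..T}" for s t
    using v_dist[of s t] v_dist[of t s] that by (cases "s \<le> t") (auto simp: dist_commute)
  have lip: "1-lipschitz_on {0..L} \<sigma>"
  proof (rule lipschitz_onI)
    fix u w assume "u \<in> {0..L}" "w \<in> {0..L}"
    then show "dist (\<sigma> u) (\<sigma> w) \<le> 1 * dist u w"
      using v_abs[of "\<tau> u" "\<tau> w"] \<tau>[of u] \<tau>[of w] by (simp add: \<sigma>_def dist_real_def abs_minus_commute)
  qed simp
  have v_range: "0 \<le> v t \<and> v t \<le> L" if "0 \<le> t" "t \<le> T" for t
    using v_mono[of 0 t] v_mono[of t T] that v0 by (simp add: L_def)
  have \<sigma>_v: "\<sigma> (v t) = g t" if "0 \<le> t" "t \<le> T" for t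
    using v_abs[of "\<tau> (v t)" t] \<tau>[of "v t"] v_range[OF that] that by (simp add: \<sigma>_def)
  have "0 \<le> L" using v_range[of 0] \<open>0 \<le> T\<close> by auto
  have "\<sigma> ` {0..L} = g ` {0..T}"
  proof
    show "\<sigma> ` {0..L} \<subseteq> g ` {0..T}" using \<tau> by (auto simp: \<sigma>_def)
    show "g ` {0..T} \<subseteq> \<sigma> ` {0..L}"
      using v_range \<sigma>_v by (force simp: image_iff)
  qed
  moreover have "variation \<sigma> 0 L = ennreal L"
  proof (rule antisym)
    show le: "variation \<sigma> 0 L \<le> ennreal L"
      using variation_lipschitz_le[OF lip \<open>0 \<le> L\<close>] by simp
    then have fin': "variation \<sigma> 0 L < top" by (auto intro: le_less_trans)
    let ?w = "\<lambda>r. enn2real (variation \<sigma> 0 r)"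
    have "variation g 0 T \<le> ennreal (?w (v T) - ?w (v 0))"
    proof (rule variation_le_increment)
      fix s t assume "0 \<le> s" "s \<le> t" "t \<le> T"
      then show "dist (g s) (g t) \<le> ?w (v t) - ?w (v s)"
        using dist_le_variation_increment[OF fin', of "v s" "v t"] v_mono[of s t] v_range[of s] v_range[of t]
        by (simp add: \<sigma>_v)
    qed
    also have "\<dots> \<le> ennreal (?w L)" by (rule ennreal_leI) (simp add: L_def)
    also have "\<dots> = variation \<sigma> 0 L" using fin' by simp
    finally have "variation g 0 T \<le> variation \<sigma> 0 L" .
    moreover have "variation g 0 T = ennreal L"
      using fin[of 0 T] \<open>0 \<le> T\<close> by (simp add: L_def v_def)
    ultimately show "ennreal L \<le> variation \<sigma> 0 L" by simp
  qed
  ultimately show thesis using that \<open>0 \<le> L\<close> lip by blast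
qed

lemma sum_increments_disjoint:
  fixes v :: "real \<Rightarrow> real"
  assumes "mono_on {p..q} v" "finite F"
    and "\<And>s t. (s, t) \<in> F \<Longrightarrow> p \<le> s \<and> s \<le> t \<and> t \<le> q"
    and "pairwise (\<lambda>(s, t) (s', t'). disjnt {s..t} {s'..t'}) F" "p \<le> q"
  shows "(\<Sum>(s, t)\<in>F. v t - v s) \<le> v q - v p"
  using assms(2-5,1)
proof (induction F arbitrary: q rule: finite_ranking_induct[where f = fst])
  case empty
  then show ?case by (auto dest: mono_onD)
next
  case (insert i F)
  obtain s t where i: "i = (s, t)" by fastforce
  show ?case
  proof (cases "i \<in> F")
    case True
    then show ?thesis using insert by (simp add: insert_absorb)
  next
    case False
    have st: "p \<le> s" "s \<le> t" "t \<le> q" using insert.prems(1)[of s t] i by auto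
    have "s' \<le> s \<and> t' < s" if "(s', t') \<in> F" for s' t'
    proof -
      have "s' \<le> s" using insert.hyps(2)[OF that] i by simp
      moreover have "disjnt {s..t} {s'..t'}"
        using insert.prems(2) that i False by (fastforce simp: pairwise_insert)
      moreover have "s' \<le> t'" using insert.prems(1)[of s' t'] that by auto
      ultimately show ?thesis using st by (fastforce simp: disjnt_iff)
    qed
    then have "(\<Sum>(s, t)\<in>F. v t - v s) \<le> v s - v p"
      using insert.prems st by (intro insert.IH) (force simp: pairwise_insert intro: mono_on_subset)+
    moreover have "v t \<le> v q" using mono_onD[OF insert.prems(4), of t q] st by auto
    ultimately show ?thesis using insert.hyps False i by simp
  qed
qed

text \<open>
A weak-type inequality for monotone functions.  The intervals between \<open>t\<close> and the points \<open>s\<close> form a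
Vitali cover of \<open>S\<close>, and on disjoint intervals of total length \<open>m\<close> on which \<open>v\<close> has slope at least
\<open>\<eta>\<close>, it increases by at least \<open>\<eta> * m\<close>.
\<close>

lemma vitali_increment:
  fixes v :: "real \<Rightarrow> real"
  assumes v: "mono_on {p..q} v" and "p \<le> q" "0 < \<eta>" and S: "S \<subseteq> {p..q}"
    and steep: "\<And>t \<delta>. t \<in> S \<Longrightarrow> 0 < \<delta> \<Longrightarrow> \<exists>s\<in>{p..q}. s \<noteq> t \<and> \<bar>s - t\<bar> < \<delta> \<and> \<eta> * \<bar>s - t\<bar> \<le> \<bar>v s - v t\<bar>"
  obtains T where "S \<subseteq> T" "T \<in> lmeasurable" "\<eta> * measure lebesgue T \<le> v q - v p"
proof -
  define K where "K = {(s, t). p \<le> s \<and> s < t \<and> t \<le> q \<and> \<eta> * (t - s) \<le> v t - v s}"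
  define a where "a = (\<lambda>(s, t). (s + t) / 2 :: real)"
  define r where "r = (\<lambda>(s, t). (t - s) / 2 :: real)"
  have cball: "cball (a (s, t)) (r (s, t)) = {s..t}" for s t
    by (auto simp: a_def r_def cball_eq_atLeastAtMost field_simps)
  obtain C where C: "countable C" "C \<subseteq> K"
     "pairwise (\<lambda>i j. disjnt (cball (a i) (r i)) (cball (a j) (r j))) C"
     "negligible (S - (\<Union>i\<in>C. cball (a i) (r i)))"
  proof (rule Vitali_covering_theorem_cballs[of K r S a])
    show "0 < r i" if "i \<in> K" for i using that by (auto simp: K_def r_def)
    fix t d :: real assume t: "t \<in> S" "0 < d"
    then obtain s where s: "s \<in> {p..q}" "s \<noteq> t" "\<bar>s - t\<bar> < d" "\<eta> * \<bar>s - t\<bar> \<le> \<bar>v s - v t\<bar>"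
      using steep by blast
    have tq: "t \<in> {p..q}" using t S by auto
    have "(min s t, max s t) \<in> K"
    proof (cases "s < t")
      case True
      then have "v s \<le> v t" using mono_onD[OF v, of s t] s tq by auto
      then show ?thesis using True s tq by (auto simp: K_def)
    next
      case False
      then have "v t \<le> v s" using mono_onD[OF v, of t s] s tq by auto
      then show ?thesis using False s tq by (auto simp: K_def)
    qed
    moreover have "t \<in> cball (a (min s t, max s t)) (r (min s t, max s t))" by (auto simp: cball)
    moreover have "r (min s t, max s t) < d" using s by (auto simp: r_def min_def max_def)
    ultimately show "\<exists>i. i \<in> K \<and> t \<in> cball (a i) (r i) \<and> r i < d" by blast
  qed
  let ?I = "\<lambda>i. cball (a i) (r i)"
  have bound: "measure lebesgue (\<Union>i\<in>F. ?I i) \<le> (v q - v p) / \<eta>" if F: "F \<subseteq> C" "finite F" for F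
  proof -
    have "measure lebesgue (\<Union>i\<in>F. ?I i) \<le> (\<Sum>i\<in>F. measure lebesgue (?I i))"
      using F by (intro measure_UNION_le) auto
    also have "\<dots> = (\<Sum>(s, t)\<in>F. t - s)"
      using F C(2) by (intro sum.cong) (auto simp: cball K_def split: prod.splits)
    also have "\<dots> \<le> (\<Sum>(s, t)\<in>F. (v t - v s) / \<eta>)"
      using F C(2) \<open>0 < \<eta>\<close> by (intro sum_mono) (auto simp: K_def field_simps)
    also have "\<dots> = (\<Sum>(s, t)\<in>F. v t - v s) / \<eta>"
      by (simp add: sum_divide_distrib case_prod_unfold)
    also have "\<dots> \<le> (v q - v p) / \<eta>"
    proof (intro divide_right_mono sum_increments_disjoint[OF v])
      show "pairwise (\<lambda>(s, t) (s', t'). disjnt {s..t} {s'..t'}) F"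
      proof (rule pairwiseI)
        fix i j assume "i \<in> F" "j \<in> F" "i \<noteq> j"
        then have "disjnt (?I i) (?I j)" using C(3) F(1) by (auto simp: pairwise_def)
        then show "(case i of (s, t) \<Rightarrow> \<lambda>(s', t'). disjnt {s..t} {s'..t'}) j"
          by (cases i; cases j) (simp add: cball)
      qed
    qed (use F C(2) \<open>p \<le> q\<close> \<open>0 < \<eta>\<close> in \<open>auto simp: K_def\<close>)
    finally show ?thesis .
  qed
  have U: "(\<Union>i\<in>C. ?I i) \<in> lmeasurable" "measure lebesgue (\<Union>i\<in>C. ?I i) \<le> (v q - v p) / \<eta>"
    using fmeasurable_UN_bound[of C ?I lebesgue] measure_UN_bound[of C ?I lebesgue] bound C(1) by auto
  let ?N = "S - (\<Union>i\<in>C. ?I i)"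
  show thesis
  proof (rule that[of "(\<Union>i\<in>C. ?I i) \<union> ?N"])
    show "(\<Union>i\<in>C. ?I i) \<union> ?N \<in> lmeasurable"
      by (rule fmeasurable.Un[OF U(1) negligible_imp_measurable[OF C(4)]])
    have "measure lebesgue ((\<Union>i\<in>C. ?I i) \<union> ?N) \<le> measure lebesgue (\<Union>i\<in>C. ?I i) + measure lebesgue ?N"
      using U(1) C(4) by (intro measure_Un_le) (auto dest: negligible_imp_sets)
    then have "measure lebesgue ((\<Union>i\<in>C. ?I i) \<union> ?N) \<le> (v q - v p) / \<eta>"
      using U(2) negligible_imp_measure0[OF C(4)] by linarith
    then show "\<eta> * measure lebesgue ((\<Union>i\<in>C. ?I i) \<union> ?N) \<le> v q - v p"
      using \<open>0 < \<eta>\<close> by (simp add: field_simps)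
  qed blast
qed

lemma total_increment_ge:
  fixes v :: "real \<Rightarrow> real"
  assumes v: "mono_on {0..L} v" and "0 \<le> L" "0 < \<eta>" and N: "negligible ({0..L} - S)"
    and steep: "\<And>t \<delta>. t \<in> S \<Longrightarrow> t \<in> {0..L} \<Longrightarrow> 0 < \<delta> \<Longrightarrow>
       \<exists>s\<in>{0..L}. s \<noteq> t \<and> \<bar>s - t\<bar> < \<delta> \<and> \<eta> * \<bar>s - t\<bar> \<le> \<bar>v s - v t\<bar>"
  shows "\<eta> * L \<le> v L - v 0"
proof -
  obtain T where T: "S \<inter> {0..L} \<subseteq> T" "T \<in> lmeasurable" "\<eta> * measure lebesgue T \<le> v L - v 0"
    using vitali_increment[OF v \<open>0 \<le> L\<close> \<open>0 < \<eta>\<close>, of "S \<inter> {0..L}"] steep by auto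
  have "measure lebesgue {0..L} \<le> measure lebesgue (T \<union> ({0..L} - S))"
    using T fmeasurable.Un[OF T(2) negligible_imp_measurable[OF N]] by (intro measure_mono_fmeasurable) auto
  also have "\<dots> \<le> measure lebesgue T + measure lebesgue ({0..L} - S)"
    using T N by (intro measure_Un_le) (auto dest: negligible_imp_sets)
  finally have "L \<le> measure lebesgue T"
    using negligible_imp_measure0[OF N] \<open>0 \<le> L\<close> by simp
  then have "\<eta> * L \<le> \<eta> * measure lebesgue T" using \<open>0 < \<eta>\<close> by simp
  then show ?thesis using T by linarith
qed

text \<open>
For a 1-Lipschitz map this is the existence of the metric speed at \<open>t\<close> with value \<open>1\<close>; the inequality
in the other direction is automatic.
\<close>

definition unit_speed_at :: "(real \<Rightarrow> 'a::metric_space) \<Rightarrow> real \<Rightarrow> real \<Rightarrow> bool" where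
  "unit_speed_at \<sigma> L t \<longleftrightarrow>
     (\<forall>\<eta>>0. \<exists>\<delta>>0. \<forall>s\<in>{0..L}. \<bar>s - t\<bar> < \<delta> \<longrightarrow> (1 - \<eta>) * \<bar>s - t\<bar> \<le> dist (\<sigma> s) (\<sigma> t))"

lemma partition_cell:
  assumes "p 0 \<le> t" "t \<le> p (N::nat)" "t \<notin> p ` {..N}"
  shows "\<exists>i<N. p i < t \<and> t < (p (Suc i) :: real)"
  using assms
proof (induction N)
  case (Suc N)
  show ?case
  proof (cases "t \<le> p N")
    case True
    then show ?thesis using Suc by (auto simp: atMost_Suc less_Suc_eq)
  next
    case False
    moreover have "t \<noteq> p (Suc N)" using Suc by auto
    ultimately show ?thesis using Suc by (intro exI[of _ N]) auto
  qed
qed auto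

text \<open>
Choose a partition whose polygonal length is nearly \<open>L\<close>.  On each of its cells \<open>{p..q}\<close> the function
\<open>r - dist (\<sigma> p) (\<sigma> r)\<close> is nondecreasing because \<open>\<sigma>\<close> is 1-Lipschitz, and its total increase, summed
over the cells, is as small as desired.  At a time with small difference quotients of \<open>\<sigma>\<close> it has slopes of
size \<open>\<eta>\<close>, so that \<open>vitali_increment\<close> makes the set of such times small.
\<close>

lemma unit_speed_ae:
  fixes \<sigma> :: "real \<Rightarrow> 'a::metric_space"
  assumes \<sigma>: "1-lipschitz_on {0..L} \<sigma>" and "0 \<le> L" and len: "ennreal L \<le> variation \<sigma> 0 L"
  shows "negligible {t \<in> {0..L}. \<not> unit_speed_at \<sigma> L t}"
proof -
  define B where "B \<eta> = {t \<in> {0..L}. \<forall>\<delta>>0. \<exists>s\<in>{0..L}. \<bar>s - t\<bar> < \<delta> \<and> dist (\<sigma> s) (\<sigma> t) < (1 - \<eta>) * \<bar>s - t\<bar>}"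
    for \<eta> :: real
  have dist_le: "dist (\<sigma> s) (\<sigma> t) \<le> \<bar>s - t\<bar>" if "s \<in> {0..L}" "t \<in> {0..L}" for s t
    using lipschitz_onD[OF \<sigma> that] by (simp add: dist_real_def)
  have "negligible (B \<eta>)" if "0 < \<eta>" for \<eta>
    unfolding negligible_outer_le
  proof (intro allI impI)
    fix e :: real assume "0 < e"
    show "\<exists>T. B \<eta> \<subseteq> T \<and> T \<in> lmeasurable \<and> measure lebesgue T \<le> e"
    proof (cases "L = 0")
      case True
      then show ?thesis by (intro exI[of _ "{0}"]) (auto simp: B_def \<open>0 < e\<close> less_imp_le negligible_imp_measurable)
    next
      case False
      then have "0 < L" using \<open>0 \<le> L\<close> by simp
      then have "ennreal (L - e * \<eta>) < ennreal L"
        using \<open>0 < e\<close> \<open>0 < \<eta>\<close> by (intro ennreal_lessI) auto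
      then have "ennreal (L - e * \<eta>) < variation \<sigma> 0 L" using len by (rule less_le_trans)
      then obtain N p where P: "(N, p) \<in> partitions 0 L"
        and "ennreal (L - e * \<eta>) < ennreal (\<Sum>i=1..N. dist (\<sigma> (p (i - 1))) (\<sigma> (p i)))"
        unfolding variation_def by (auto simp: less_SUP_iff)
      then have "L - e * \<eta> < (\<Sum>i=1..N. dist (\<sigma> (p (i - 1))) (\<sigma> (p i)))"
        by (meson ennreal_leI not_le)
      also have "\<dots> = (\<Sum>i<N. dist (\<sigma> (p i)) (\<sigma> (p (Suc i))))"
        by (simp add: sum.atLeast1_atMost_eq)
      finally have big: "L - e * \<eta> < (\<Sum>i<N. dist (\<sigma> (p i)) (\<sigma> (p (Suc i))))" .
      have p_in: "p i \<in> {0..L}" if "i \<le> N" for i using partition_bounds[OF P that] by auto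
      have p_less: "p i < p (Suc i)" if "i < N" for i using P that by (auto simp: partitions_def)
      define z where "z i r = r - dist (\<sigma> (p i)) (\<sigma> r)" for i r
      have "\<exists>T. B \<eta> \<inter> {p i<..<p (Suc i)} \<subseteq> T \<and> T \<in> lmeasurable \<and>
               \<eta> * measure lebesgue T \<le> z i (p (Suc i)) - z i (p i)" if i: "i < N" for i
      proof -
        have sub: "{p i..p (Suc i)} \<subseteq> {0..L}" using p_in[of i] p_in[of "Suc i"] i by auto
        have mono: "mono_on {p i..p (Suc i)} (z i)"
        proof (rule mono_onI)
          fix s t assume "s \<in> {p i..p (Suc i)}" "t \<in> {p i..p (Suc i)}" "s \<le> t"
          then show "z i s \<le> z i t"
            using dist_le[of s t] sub dist_triangle[of "\<sigma> (p i)" "\<sigma> t" "\<sigma> s"] by (auto simp: z_def)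
        qed
        have steep: "\<exists>s\<in>{p i..p (Suc i)}. s \<noteq> t \<and> \<bar>s - t\<bar> < \<delta> \<and> \<eta> * \<bar>s - t\<bar> \<le> \<bar>z i s - z i t\<bar>"
          if t: "t \<in> B \<eta> \<inter> {p i<..<p (Suc i)}" and "0 < \<delta>" for t \<delta>
        proof -
          \<comment> \<open>The restriction keeps \<open>s\<close> in the cell of \<open>t\<close>.\<close>
          define \<delta>' where "\<delta>' = Min {\<delta>, t - p i, p (Suc i) - t}"
          have "0 < \<delta>'" using t \<open>0 < \<delta>\<close> by (auto simp: \<delta>'_def)
          then obtain s where s: "s \<in> {0..L}" "\<bar>s - t\<bar> < \<delta>'" "dist (\<sigma> s) (\<sigma> t) < (1 - \<eta>) * \<bar>s - t\<bar>"
            using t by (auto simp: B_def)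
          have "s \<noteq> t" using s by auto
          moreover have "\<bar>s - t\<bar> < \<delta>" "s \<in> {p i..p (Suc i)}" using s(2) by (auto simp: \<delta>'_def)
          moreover have "\<eta> * \<bar>s - t\<bar> \<le> \<bar>z i s - z i t\<bar>"
          proof -
            have "\<bar>dist (\<sigma> (p i)) (\<sigma> s) - dist (\<sigma> (p i)) (\<sigma> t)\<bar> \<le> dist (\<sigma> s) (\<sigma> t)"
              using dist_triangle[of "\<sigma> (p i)" "\<sigma> s" "\<sigma> t"] dist_triangle[of "\<sigma> (p i)" "\<sigma> t" "\<sigma> s"]
              by (auto simp: dist_commute)
            then have "\<bar>s - t\<bar> - dist (\<sigma> s) (\<sigma> t) \<le> \<bar>z i s - z i t\<bar>" by (auto simp: z_def)
            then show ?thesis using s(3) by (simp add: algebra_simps)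
          qed
          ultimately show ?thesis by blast
        qed
        obtain T where "B \<eta> \<inter> {p i<..<p (Suc i)} \<subseteq> T" "T \<in> lmeasurable"
            "\<eta> * measure lebesgue T \<le> z i (p (Suc i)) - z i (p i)"
          by (rule vitali_increment[where S = "B \<eta> \<inter> {p i<..<p (Suc i)}", OF mono less_imp_le[OF p_less[OF i]] \<open>0 < \<eta>\<close> _ steep]) auto
        then show ?thesis by blast
      qed
      then obtain T where T: "\<And>i. i < N \<Longrightarrow> B \<eta> \<inter> {p i<..<p (Suc i)} \<subseteq> T i"
         "\<And>i. i < N \<Longrightarrow> T i \<in> lmeasurable"
         "\<And>i. i < N \<Longrightarrow> \<eta> * measure lebesgue (T i) \<le> z i (p (Suc i)) - z i (p i)"
        by metis
      let ?T = "(\<Union>i<N. T i) \<union> p ` {..N}"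
      have fin: "negligible (p ` {..N})" by (intro negligible_finite) simp
      have "B \<eta> \<subseteq> ?T"
      proof
        fix t assume t: "t \<in> B \<eta>"
        then have "p 0 \<le> t" "t \<le> p N" using P by (auto simp: B_def partitions_def)
        then show "t \<in> ?T" using partition_cell[of p t N] T(1) t by fastforce
      qed
      moreover have "?T \<in> lmeasurable"
        using T(2) negligible_imp_measurable[OF fin] by (intro fmeasurable.Un fmeasurable.finite_UN) auto
      moreover have "measure lebesgue ?T \<le> e"
      proof -
        have "measure lebesgue ?T \<le> measure lebesgue (\<Union>i<N. T i) + measure lebesgue (p ` {..N})"
          using T(2) negligible_imp_measurable[OF fin] by (intro measure_Un_le sets.finite_UN) (auto dest: fmeasurableD)
        also have "\<dots> \<le> (\<Sum>i<N. measure lebesgue (T i))"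
          using T(2) negligible_imp_measure0[OF fin] by (auto intro!: measure_UNION_le dest: fmeasurableD)
        finally have "\<eta> * measure lebesgue ?T \<le> \<eta> * (\<Sum>i<N. measure lebesgue (T i))"
          using \<open>0 < \<eta>\<close> by (intro mult_left_mono) auto
        also have "\<dots> \<le> (\<Sum>i<N. z i (p (Suc i)) - z i (p i))"
          unfolding sum_distrib_left by (intro sum_mono T(3)) auto
        also have "\<dots> = (\<Sum>i<N. p (Suc i) - p i) - (\<Sum>i<N. dist (\<sigma> (p i)) (\<sigma> (p (Suc i))))"
          by (simp add: z_def sum_subtractf)
        also have "(\<Sum>i<N. p (Suc i) - p i) = L"
          using P by (simp add: sum_lessThan_telescope partitions_def)
        finally have "\<eta> * measure lebesgue ?T \<le> \<eta> * e" using big by (simp add: algebra_simps)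
        then show ?thesis using \<open>0 < \<eta>\<close> by simp
      qed
      ultimately show ?thesis by blast
    qed
  qed
  then have "negligible (\<Union>n. B (1 / real (Suc n)))" by (intro negligible_countable_Union) auto
  moreover have "{t \<in> {0..L}. \<not> unit_speed_at \<sigma> L t} \<subseteq> (\<Union>n. B (1 / real (Suc n)))"
  proof
    fix t assume t: "t \<in> {t \<in> {0..L}. \<not> unit_speed_at \<sigma> L t}"
    then obtain \<eta> where \<eta>: "0 < \<eta>" "\<And>\<delta>. 0 < \<delta> \<Longrightarrow> \<exists>s\<in>{0..L}. \<bar>s - t\<bar> < \<delta> \<and> dist (\<sigma> s) (\<sigma> t) < (1 - \<eta>) * \<bar>s - t\<bar>"
      by (auto simp: unit_speed_at_def not_le)
    obtain n where n: "1 / real (Suc n) < \<eta>" using \<eta>(1) nat_approx_posE by blast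
    have "t \<in> B (1 / real (Suc n))"
      unfolding B_def
    proof (intro CollectI conjI allI impI)
      fix \<delta> :: real assume "0 < \<delta>"
      then obtain s where s: "s\<in>{0..L}" "\<bar>s - t\<bar> < \<delta>" "dist (\<sigma> s) (\<sigma> t) < (1 - \<eta>) * \<bar>s - t\<bar>"
        using \<eta>(2) by blast
      moreover have "(1 - \<eta>) * \<bar>s - t\<bar> \<le> (1 - 1 / real (Suc n)) * \<bar>s - t\<bar>"
        using n by (intro mult_right_mono) auto
      ultimately show "\<exists>s\<in>{0..L}. \<bar>s - t\<bar> < \<delta> \<and> dist (\<sigma> s) (\<sigma> t) < (1 - 1 / real (Suc n)) * \<bar>s - t\<bar>"
        by (intro bexI[of _ s]) linarith+
    qed (use t in auto)
    then show "t \<in> (\<Union>n. B (1 / real (Suc n)))" by blast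
  qed
  ultimately show ?thesis by (rule negligible_subset)
qed

text \<open>
The set of times at which the difference quotients are at least \<open>1 - \<eta>\<close> up to distance
\<open>1 / real (Suc n)\<close> is closed.  Cut it into parts shorter than that distance.
\<close>

lemma expanding_pieces:
  fixes g :: "real \<Rightarrow> 'a::metric_space"
  assumes g: "continuous_on {0..L} g" and "0 < \<eta>" and speed: "negligible {t \<in> {0..L}. \<not> unit_speed_at g L t}"
  obtains K :: "nat \<Rightarrow> real set" where "\<forall>i. compact (K i) \<and> K i \<subseteq> {0..L}"
    "\<forall>i. \<forall>s\<in>K i. \<forall>t\<in>K i. (1 - \<eta>) * \<bar>s - t\<bar> \<le> dist (g s) (g t)"
    "negligible ({0..L} - (\<Union>i. K i))"
proof -
  define G where "G n = {t \<in> {0..L}. \<forall>s\<in>{0..L}. \<bar>s - t\<bar> < 1 / real (Suc n) \<longrightarrow> (1 - \<eta>) * \<bar>s - t\<bar> \<le> dist (g s) (g t)}" for n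
  \<comment> \<open>The width \<open>1 / real (n + 2)\<close> is strictly below the scale \<open>1 / real (Suc n)\<close> of \<open>G n\<close>.\<close>
  define P where "P n k = G n \<inter> {real k / real (n + 2)..real (Suc k) / real (n + 2)}" for n k
  define K where "K i = (case prod_decode i of (n, k) \<Rightarrow> P n k)" for i
  have G_closed: "closed (G n)" for n
    unfolding closed_sequential_limits
  proof (intro allI impI, elim conjE)
    fix t l assume t: "\<forall>m. t m \<in> G n" and lim: "t \<longlonglongrightarrow> l"
    have "closed {0..L}" by simp
    then have l: "l \<in> {0..L}"
      using closed_sequentially[OF _ _ lim] t by (auto simp: G_def)
    have glim: "(\<lambda>m. g (t m)) \<longlonglongrightarrow> g l"
      using continuous_on_tendsto_compose[OF g lim l] t by (auto simp: G_def)
    have "(1 - \<eta>) * \<bar>s - l\<bar> \<le> dist (g s) (g l)" if s: "s \<in> {0..L}" "\<bar>s - l\<bar> < 1 / real (Suc n)" for s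
    proof (rule tendsto_le)
      have "(\<lambda>m. \<bar>s - t m\<bar>) \<longlonglongrightarrow> \<bar>s - l\<bar>" by (intro tendsto_intros lim)
      then have "eventually (\<lambda>m. \<bar>s - t m\<bar> < 1 / real (Suc n)) sequentially"
        by (rule order_tendstoD) (rule s)
      then show "eventually (\<lambda>m. (1 - \<eta>) * \<bar>s - t m\<bar> \<le> dist (g s) (g (t m))) sequentially"
        by eventually_elim (use t s(1) in \<open>auto simp: G_def\<close>)
    qed (intro tendsto_intros lim glim trivial_limit_sequentially)+
    then show "l \<in> G n" using l by (simp add: G_def)
  qed
  show thesis
  proof (rule that)
    have "compact (K i)" for i
      unfolding K_def P_def by (auto split: prod.split intro!: closed_Int_compact G_closed)
    moreover have "K i \<subseteq> {0..L}" for i by (auto simp: K_def P_def G_def split: prod.splits)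
    ultimately show "\<forall>i. compact (K i) \<and> K i \<subseteq> {0..L}" by blast
    have "(1 - \<eta>) * \<bar>s - t\<bar> \<le> dist (g s) (g t)" if st: "s \<in> K i" "t \<in> K i" for i s t
    proof -
      obtain n k where nk: "prod_decode i = (n, k)" by fastforce
      have "s \<in> P n k" "t \<in> P n k" using st nk by (auto simp: K_def)
      moreover have "real (Suc k) / real (n + 2) - real k / real (n + 2) = 1 / real (n + 2)"
        by (simp add: diff_divide_distrib[symmetric])
      ultimately have "\<bar>s - t\<bar> \<le> 1 / real (n + 2)" by (auto simp: P_def abs_le_iff)
      also have "\<dots> < 1 / real (Suc n)" by (intro divide_strict_left_mono) auto
      finally show ?thesis using \<open>s \<in> P n k\<close> \<open>t \<in> P n k\<close> by (simp add: P_def G_def)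
    qed
    then show "\<forall>i. \<forall>s\<in>K i. \<forall>t\<in>K i. (1 - \<eta>) * \<bar>s - t\<bar> \<le> dist (g s) (g t)" by blast
    have "{0..L} - (\<Union>i. K i) \<subseteq> {t \<in> {0..L}. \<not> unit_speed_at g L t}"
    proof
      fix t assume t: "t \<in> {0..L} - (\<Union>i. K i)"
      have "\<not> unit_speed_at g L t"
      proof
        assume "unit_speed_at g L t"
        then obtain \<delta> where \<delta>: "0 < \<delta>" "\<And>s. s \<in> {0..L} \<Longrightarrow> \<bar>s - t\<bar> < \<delta> \<Longrightarrow> (1 - \<eta>) * \<bar>s - t\<bar> \<le> dist (g s) (g t)"
          using \<open>0 < \<eta>\<close> unfolding unit_speed_at_def by metis
        obtain n where n: "1 / real (Suc n) < \<delta>" using \<delta>(1) nat_approx_posE by blast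
        have "t \<in> G n" using t \<delta>(2) n by (auto simp: G_def)
        define k where "k = nat \<lfloor>t * real (n + 2)\<rfloor>"
        have "0 \<le> t * real (n + 2)" using t by auto
        then have "real k = real_of_int \<lfloor>t * real (n + 2)\<rfloor>" by (simp add: k_def)
        then have k: "real k \<le> t * real (n + 2)" "t * real (n + 2) \<le> real (Suc k)"
          by linarith+
        have "0 < real (n + 2)" by simp
        then have "t \<in> {real k / real (n + 2)..real (Suc k) / real (n + 2)}"
          using k by (simp only: atLeastAtMost_iff pos_divide_le_eq pos_le_divide_eq)
        then have "t \<in> P n k" using \<open>t \<in> G n\<close> by (simp add: P_def)
        then have "t \<in> K (prod_encode (n, k))" by (simp add: K_def)
        then show False using t by blast
      qed
      then show "t \<in> {t \<in> {0..L}. \<not> unit_speed_at g L t}" using t by auto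
    qed
    then show "negligible ({0..L} - (\<Union>i. K i))" by (rule negligible_subset[OF speed])
  qed
qed

section \<open>One-dimensional Hausdorff measure\<close>

lemma dist_le_ediameter: "x \<in> U \<Longrightarrow> y \<in> U \<Longrightarrow> ennreal (dist x y) \<le> ediameter U"
  unfolding ediameter_def by (meson SUP_upper order_trans)

lemma ediameter_leI: "(\<And>x y. x \<in> U \<Longrightarrow> y \<in> U \<Longrightarrow> ennreal (dist x y) \<le> B) \<Longrightarrow> ediameter U \<le> B"
  unfolding ediameter_def by (intro SUP_least) auto

lemma ediameter_empty [simp]: "ediameter {} = 0"
  by (simp add: ediameter_def bot_ennreal)

lemma hausdorff1_pre_le_suminf:
  assumes "E \<subseteq> (\<Union>k. U k)" "\<And>k::nat. ediameter (U k) < ennreal \<delta>"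
  shows "hausdorff1_pre \<delta> E \<le> (\<Sum>k. ediameter (U k))"
  unfolding hausdorff1_pre_def using assms by (intro INF_lower) auto

lemma hausdorff1_pre_mono: "E \<subseteq> F \<Longrightarrow> hausdorff1_pre \<delta> E \<le> hausdorff1_pre \<delta> F"
  unfolding hausdorff1_pre_def by (intro INF_superset_mono) auto

lemma hausdorff1_mono: "E \<subseteq> F \<Longrightarrow> hausdorff1 E \<le> hausdorff1 F"
  unfolding hausdorff1_eq_SUP by (intro SUP_mono' hausdorff1_pre_mono)

text \<open>
Covers indexed by an arbitrary countable set are as good as sequences, with the empty set as padding.
\<close>

lemma hausdorff1_pre_le_countable_cover:
  assumes "countable C" "0 < \<delta>" and cov: "E \<subseteq> (\<Union>x\<in>C. V x)"
    and small: "\<And>x. x \<in> C \<Longrightarrow> ediameter (V x) < ennreal \<delta>"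
    and sum: "\<And>F. finite F \<Longrightarrow> F \<subseteq> C \<Longrightarrow> (\<Sum>x\<in>F. ediameter (V x)) \<le> B"
  shows "hausdorff1_pre \<delta> E \<le> B"
proof -
  define U where "U k = (if k \<in> to_nat_on C ` C then V (from_nat_into C k) else {})" for k
  have inj: "inj_on (to_nat_on C) C" using assms(1) by (rule inj_on_to_nat_on)
  have from_to: "from_nat_into C (to_nat_on C x) = x" if "x \<in> C" for x
    using that assms(1) by simp
  have "E \<subseteq> (\<Union>k. U k)"
  proof
    fix y assume "y \<in> E"
    then obtain x where "x \<in> C" "y \<in> V x" using cov by auto
    then have "y \<in> U (to_nat_on C x)" using from_to by (simp add: U_def)
    then show "y \<in> (\<Union>k. U k)" by blast
  qed
  moreover have "ediameter (U k) < ennreal \<delta>" for k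
    using small from_to \<open>0 < \<delta>\<close> by (auto simp: U_def)
  ultimately have "hausdorff1_pre \<delta> E \<le> (\<Sum>k. ediameter (U k))"
    by (rule hausdorff1_pre_le_suminf)
  also have "\<dots> \<le> B"
    unfolding suminf_eq_SUP
  proof (rule SUP_least)
    fix n
    let ?F = "{x \<in> C. to_nat_on C x < n}"
    have "inj_on (to_nat_on C) ?F" using inj by (rule inj_on_subset) auto
    moreover have "finite (to_nat_on C ` ?F)" by (rule finite_subset[of _ "{..<n}"]) auto
    ultimately have fin: "finite ?F" by (simp add: finite_image_iff)
    have "(\<Sum>k<n. ediameter (U k)) = (\<Sum>k\<in>to_nat_on C ` ?F. ediameter (U k))"
      by (rule sum.mono_neutral_right) (auto simp: U_def)
    also have "\<dots> = (\<Sum>x\<in>?F. ediameter (V x))"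
      using from_to by (subst sum.reindex[OF \<open>inj_on (to_nat_on C) ?F\<close>]) (auto simp: U_def intro!: sum.cong)
    also have "\<dots> \<le> B" using fin by (intro sum) auto
    finally show "(\<Sum>k<n. ediameter (U k)) \<le> B" .
  qed
  finally show ?thesis .
qed

lemma hausdorff1_pre_UNION_le:
  fixes A :: "nat \<Rightarrow> 'a::metric_space set"
  shows "hausdorff1_pre \<delta> (\<Union>i::nat. A i) \<le> (\<Sum>i. hausdorff1_pre \<delta> (A i))"
proof (rule ennreal_le_epsilon)
  fix e :: real assume "0 < e" and fin: "(\<Sum>i. hausdorff1_pre \<delta> (A i)) < top"
  have pre_fin: "hausdorff1_pre \<delta> (A i) < top" for i
    using fin by (meson ennreal_suminf_lessD le_less_trans)
  have "\<exists>U. A i \<subseteq> (\<Union>k::nat. U k) \<and> (\<forall>k. ediameter (U k) < ennreal \<delta>) \<and>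
      (\<Sum>k. ediameter (U k)) \<le> hausdorff1_pre \<delta> (A i) + ennreal (e * (1/2) ^ Suc i)" for i
  proof -
    define q where "q = e * (1/2) ^ Suc i"
    have "0 < q" using \<open>0 < e\<close> by (simp add: q_def)
    define r where "r = enn2real (hausdorff1_pre \<delta> (A i))"
    have r: "hausdorff1_pre \<delta> (A i) = ennreal r" "0 \<le> r" using pre_fin[of i] by (auto simp: r_def)
    have "ennreal r < ennreal (r + q)" using r \<open>0 < q\<close> by (intro ennreal_lessI) auto
    also have "\<dots> = ennreal r + ennreal q" using r \<open>0 < q\<close> by (intro ennreal_plus) auto
    finally have "hausdorff1_pre \<delta> (A i) < hausdorff1_pre \<delta> (A i) + ennreal (e * (1/2) ^ Suc i)"
      by (simp only: r(1) q_def)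
    then obtain U :: "nat \<Rightarrow> 'a set" where "A i \<subseteq> (\<Union>k. U k)" "\<forall>k. ediameter (U k) < ennreal \<delta>"
        "(\<Sum>k. ediameter (U k)) < hausdorff1_pre \<delta> (A i) + ennreal (e * (1/2) ^ Suc i)"
      unfolding hausdorff1_pre_def INF_less_iff by blast
    then show ?thesis using less_imp_le by blast
  qed
  then obtain U where U: "\<And>i. A i \<subseteq> (\<Union>k::nat. U i k)" "\<And>i k. ediameter (U i k) < ennreal \<delta>"
      "\<And>i. (\<Sum>k. ediameter (U i k)) \<le> hausdorff1_pre \<delta> (A i) + ennreal (e * (1/2) ^ Suc i)"
    by metis
  define W where "W n = (case prod_decode n of (i, k) \<Rightarrow> U i k)" for n
  have "hausdorff1_pre \<delta> (\<Union>i. A i) \<le> (\<Sum>n. ediameter (W n))"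
  proof (rule hausdorff1_pre_le_suminf)
    show "(\<Union>i. A i) \<subseteq> (\<Union>n. W n)"
    proof
      fix x assume "x \<in> (\<Union>i. A i)"
      then obtain i k where "x \<in> U i k" using U(1) by blast
      then have "x \<in> W (prod_encode (i, k))" by (simp add: W_def)
      then show "x \<in> (\<Union>n. W n)" by blast
    qed
    show "ediameter (W n) < ennreal \<delta>" for n using U(2) by (simp add: W_def split: prod.split)
  qed
  also have "(\<Sum>n. ediameter (W n)) = (\<Sum>n. (\<lambda>(i, k). ediameter (U i k)) (prod_decode n))"
    by (simp add: W_def case_prod_unfold)
  also have "\<dots> = (\<Sum>i. \<Sum>k. ediameter (U i k))"
    by (rule suminf_ennreal_2dimen) simp
  also have "\<dots> \<le> (\<Sum>i. hausdorff1_pre \<delta> (A i) + ennreal (e * (1/2) ^ Suc i))"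
    by (intro suminf_le U(3)) auto
  also have "\<dots> = (\<Sum>i. hausdorff1_pre \<delta> (A i)) + (\<Sum>i. ennreal (e * (1/2) ^ Suc i))"
    by (rule suminf_add[symmetric]) auto
  also have "(\<Sum>i. ennreal (e * (1/2) ^ Suc i)) = ennreal (e * 1)"
    using \<open>0 < e\<close> by (intro suminf_ennreal_eq sums_mult power_half_series) auto
  finally show "hausdorff1_pre \<delta> (\<Union>i. A i) \<le> (\<Sum>i. hausdorff1_pre \<delta> (A i)) + ennreal e" by simp
qed

lemma hausdorff1_pre_le: "0 < \<delta> \<Longrightarrow> hausdorff1_pre \<delta> E \<le> hausdorff1 E"
  unfolding hausdorff1_eq_SUP by (intro SUP_upper) auto

lemma hausdorff1_leI: "(\<And>\<delta>. 0 < \<delta> \<Longrightarrow> hausdorff1_pre \<delta> E \<le> B) \<Longrightarrow> hausdorff1 E \<le> B"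
  unfolding hausdorff1_eq_SUP by (intro SUP_least) auto

lemma hausdorff1_UNION_le: "hausdorff1 (\<Union>i::nat. A i) \<le> (\<Sum>i. hausdorff1 (A i))"
proof (rule hausdorff1_leI)
  fix \<delta> :: real assume "0 < \<delta>"
  have "hausdorff1_pre \<delta> (\<Union>i. A i) \<le> (\<Sum>i. hausdorff1_pre \<delta> (A i))"
    by (rule hausdorff1_pre_UNION_le)
  also have "\<dots> \<le> (\<Sum>i. hausdorff1 (A i))"
    using \<open>0 < \<delta>\<close> by (intro suminf_le hausdorff1_pre_le) auto
  finally show "hausdorff1_pre \<delta> (\<Union>i. A i) \<le> (\<Sum>i. hausdorff1 (A i))" .
qed

lemma hausdorff1_empty [simp]: "hausdorff1 {} = 0"
proof -
  have "hausdorff1 {} \<le> 0"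
    by (intro hausdorff1_leI hausdorff1_pre_le_countable_cover[of "{}" _ "{}" "\<lambda>_. {}" 0]) auto
  then show ?thesis by simp
qed

lemma hausdorff1_null_UNION: "(\<And>i::nat. hausdorff1 (A i) = 0) \<Longrightarrow> hausdorff1 (\<Union>i. A i) = 0"
  using hausdorff1_UNION_le[of A] by simp

lemma hausdorff1_Un_le: "hausdorff1 (A \<union> B) \<le> hausdorff1 A + hausdorff1 B"
proof -
  let ?F = "\<lambda>i::nat. if i = 0 then A else if i = 1 then B else {}"
  have "A \<union> B \<subseteq> (\<Union>i. ?F i)"
    by (auto intro: exI[of _ 0] exI[of _ 1])
  then have "hausdorff1 (A \<union> B) \<le> hausdorff1 (\<Union>i. ?F i)" by (rule hausdorff1_mono)
  also have "\<dots> \<le> (\<Sum>i. hausdorff1 (?F i))" by (rule hausdorff1_UNION_le)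
  also have "\<dots> = (\<Sum>i\<in>{0, 1}. hausdorff1 (?F i))" by (rule suminf_finite) auto
  finally show ?thesis by simp
qed

lemma hausdorff1_null_subset: "hausdorff1 B = 0 \<Longrightarrow> A \<subseteq> B \<Longrightarrow> hausdorff1 A = 0"
  using hausdorff1_mono[of A B] by simp

lemma enclosing_interval:
  fixes V :: "real set"
  assumes "ediameter V < top"
  obtains I where "V \<subseteq> I" "compact I" "emeasure lborel I \<le> ediameter V"
proof (cases "V = {}")
  case True
  then show thesis using that[of "{}"] by simp
next
  case False
  define d where "d = enn2real (ediameter V)"
  have d: "ediameter V = ennreal d" "0 \<le> d" using assms by (auto simp: d_def)
  have le: "\<bar>x - y\<bar> \<le> d" if "x \<in> V" "y \<in> V" for x y
    using dist_le_ediameter[OF that] d by (simp add: dist_real_def)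
  obtain v where v: "v \<in> V" using False by blast
  have bdd: "bdd_above V" "bdd_below V"
    using le[OF _ v] by (auto intro!: bdd_aboveI[of _ "v + d"] bdd_belowI[of _ "v - d"] simp: abs_le_iff) fastforce+
  have "Sup V \<le> Inf V + d"
  proof (rule cSup_least[OF False])
    fix x assume x: "x \<in> V"
    have "x - d \<le> Inf V" using le[OF x] by (intro cInf_greatest[OF False]) (auto simp: abs_le_iff algebra_simps)
    then show "x \<le> Inf V + d" by simp
  qed
  then have "emeasure lborel {Inf V..Sup V} \<le> ennreal d"
    using cInf_le_cSup[OF False bdd] by (simp add: ennreal_leI)
  moreover have "V \<subseteq> {Inf V..Sup V}" using bdd by (auto intro: cInf_lower cSup_upper)
  ultimately show thesis using that[of "{Inf V..Sup V}"] d by simp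
qed

text \<open>
The images under \<open>f\<close> of the covering sets lie in intervals no longer than their diameters, and these
cover \<open>{p..<q}\<close>.
\<close>

lemma hausdorff1_ge_of_lipschitz_image:
  fixes f :: "'a::metric_space \<Rightarrow> real"
  assumes f: "1-lipschitz_on UNIV f" and im: "{p..<q} \<subseteq> f ` E"
  shows "ennreal (q - p) \<le> hausdorff1 E"
proof (cases "p \<le> q")
  case True
  have "ennreal (q - p) \<le> hausdorff1_pre 1 E"
    unfolding hausdorff1_pre_def
  proof (rule INF_greatest)
    fix U :: "nat \<Rightarrow> 'a set"
    assume "U \<in> {U. E \<subseteq> (\<Union>k. U k) \<and> (\<forall>k. ediameter (U k) < ennreal 1)}"
    then have U: "E \<subseteq> (\<Union>k. U k)" "\<And>k. ediameter (U k) < 1" by auto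
    have dm: "ediameter (f ` U k) \<le> ediameter (U k)" for k
    proof (rule ediameter_leI)
      fix x y assume "x \<in> f ` U k" "y \<in> f ` U k"
      then obtain u v where uv: "u \<in> U k" "v \<in> U k" "x = f u" "y = f v" by auto
      then have "ennreal (dist x y) \<le> ennreal (dist u v)"
        using lipschitz_onD[OF f, of u v] by (intro ennreal_leI) simp
      also have "\<dots> \<le> ediameter (U k)" using uv by (intro dist_le_ediameter)
      finally show "ennreal (dist x y) \<le> ediameter (U k)" .
    qed
    have "\<exists>I. f ` U k \<subseteq> I \<and> compact I \<and> emeasure lborel I \<le> ediameter (U k)" for k
    proof -
      have "ediameter (f ` U k) < top"
        using le_less_trans[OF dm U(2)] by (rule less_trans) simp
      then obtain I where "f ` U k \<subseteq> I" "compact I" "emeasure lborel I \<le> ediameter (f ` U k)"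
      by (rule enclosing_interval)
    then show ?thesis using dm[of k] order_trans by blast
    qed
    then obtain I where I: "\<And>k. f ` U k \<subseteq> I k" "\<And>k. compact (I k)" "\<And>k. emeasure lborel (I k) \<le> ediameter (U k)"
      by metis
    have sub: "{p..<q} \<subseteq> (\<Union>k. I k)"
    proof
      fix y assume "y \<in> {p..<q}"
      then obtain x where x: "x \<in> E" "y = f x" using im by auto
      then obtain k where "x \<in> U k" using U(1) by auto
      then show "y \<in> (\<Union>k. I k)" using x I(1)[of k] by auto
    qed
    have "ennreal (q - p) = emeasure lborel {p..<q}" using True by simp
    also have "\<dots> \<le> emeasure lborel (\<Union>k. I k)"
      using sub I(2) by (intro emeasure_mono sets.countable_UN) (auto intro: borel_compact)
    also have "\<dots> \<le> (\<Sum>k. emeasure lborel (I k))"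
      using I(2) by (intro emeasure_subadditive_countably) (auto intro: borel_compact)
    also have "\<dots> \<le> (\<Sum>k. ediameter (U k))" by (intro suminf_le I(3)) auto
    finally show "ennreal (q - p) \<le> (\<Sum>k. ediameter (U k))" .
  qed
  also have "\<dots> \<le> hausdorff1 E" by (rule hausdorff1_pre_le) simp
  finally show ?thesis .
qed (simp add: ennreal_neg)

text \<open>
An expanding map pulls a cover of a null set back to sets of comparable diameter.
\<close>

lemma negligible_vimage_of_null:
  fixes \<sigma> :: "real \<Rightarrow> 'a::metric_space"
  assumes null: "hausdorff1 A = 0" and "0 < m"
    and expand: "\<And>s t. s \<in> K \<Longrightarrow> t \<in> K \<Longrightarrow> \<bar>s - t\<bar> \<le> m * dist (\<sigma> s) (\<sigma> t)"
  shows "negligible {t \<in> K. \<sigma> t \<in> A}"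
  unfolding negligible_outer_le
proof (intro allI impI)
  fix e :: real assume "0 < e"
  have "hausdorff1_pre 1 A \<le> 0" using hausdorff1_pre_le[of 1 A] null by simp
  moreover have "0 < ennreal (e / m)" using \<open>0 < e\<close> \<open>0 < m\<close> by simp
  ultimately have "hausdorff1_pre 1 A < ennreal (e / m)" by (rule le_less_trans)
  then obtain U :: "nat \<Rightarrow> 'a set" where U: "A \<subseteq> (\<Union>k. U k)" "\<And>k. ediameter (U k) < 1"
      "(\<Sum>k. ediameter (U k)) < ennreal (e / m)"
    unfolding hausdorff1_pre_def INF_less_iff by auto
  define W where "W k = {t \<in> K. \<sigma> t \<in> U k}" for k
  have dm: "ediameter (W k) \<le> ennreal m * ediameter (U k)" for k
  proof (rule ediameter_leI)
    fix s t assume st: "s \<in> W k" "t \<in> W k"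
    then have "ennreal (dist s t) \<le> ennreal (m * dist (\<sigma> s) (\<sigma> t))"
      using expand by (intro ennreal_leI) (auto simp: W_def dist_real_def)
    also have "\<dots> = ennreal m * ennreal (dist (\<sigma> s) (\<sigma> t))" using \<open>0 < m\<close> by (simp add: ennreal_mult)
    also have "\<dots> \<le> ennreal m * ediameter (U k)"
      using st by (intro mult_left_mono dist_le_ediameter) (auto simp: W_def)
    finally show "ennreal (dist s t) \<le> ennreal m * ediameter (U k)" .
  qed
  have "\<exists>I. W k \<subseteq> I \<and> compact I \<and> emeasure lborel I \<le> ennreal m * ediameter (U k)" for k
  proof -
    have "ennreal m * ediameter (U k) < top"
      using U(2)[of k] by (auto simp: ennreal_mult_less_top intro: less_trans)
    then have "ediameter (W k) < top" using dm[of k] by (rule le_less_trans[rotated])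
    then obtain I where "W k \<subseteq> I" "compact I" "emeasure lborel I \<le> ediameter (W k)"
      by (rule enclosing_interval)
    then show ?thesis using dm[of k] order_trans by blast
  qed
  then obtain I where I: "\<And>k. W k \<subseteq> I k" "\<And>k. compact (I k)"
      "\<And>k. emeasure lborel (I k) \<le> ennreal m * ediameter (U k)"
    by metis
  let ?T = "\<Union>k. I k"
  have sets: "?T \<in> sets borel" using I(2) by (intro sets.countable_UN) (auto intro: borel_compact)
  have "emeasure lebesgue ?T = emeasure lborel ?T" using sets by simp
  also have "\<dots> \<le> (\<Sum>k. emeasure lborel (I k))"
    using I(2) by (intro emeasure_subadditive_countably) (auto intro: borel_compact)
  also have "\<dots> \<le> (\<Sum>k. ennreal m * ediameter (U k))" by (intro suminf_le I(3)) auto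
  also have "\<dots> = ennreal m * (\<Sum>k. ediameter (U k))" by simp
  also have "\<dots> \<le> ennreal m * ennreal (e / m)" using U(3) by (intro mult_left_mono) auto
  also have "\<dots> = ennreal e" using \<open>0 < m\<close> \<open>0 < e\<close> by (simp flip: ennreal_mult)
  finally have le: "emeasure lebesgue ?T \<le> ennreal e" .
  then have "?T \<in> lmeasurable" using sets by (intro fmeasurableI) (auto intro: le_less_trans)
  moreover from this have "measure lebesgue ?T \<le> e"
    using le \<open>0 < e\<close> by (simp add: emeasure_eq_measure2)
  moreover have "{t \<in> K. \<sigma> t \<in> A} \<subseteq> ?T"
  proof
    fix t assume "t \<in> {t \<in> K. \<sigma> t \<in> A}"
    then obtain k where "t \<in> W k" using U(1) by (auto simp: W_def)
    then show "t \<in> ?T" using I(1) by blast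
  qed
  ultimately show "\<exists>T. {t \<in> K. \<sigma> t \<in> A} \<subseteq> T \<and> T \<in> lmeasurable \<and> measure lebesgue T \<le> e" by blast
qed

text \<open>
The basic covering theorem in an arbitrary metric space.  Zorn's lemma is applied to the disjoint
subfamilies \<open>C\<close> such that every ball that meets a member of \<open>C\<close> meets one with at least half its own radius.
A maximal such family meets every ball: otherwise add, among the balls that it misses, one whose radius
exceeds half the supremum.
\<close>

lemma vitali_covering_metric:
  fixes r :: "'a::metric_space \<Rightarrow> real"
  assumes r: "\<And>x. x \<in> A \<Longrightarrow> 0 < r x" "\<And>x. x \<in> A \<Longrightarrow> r x \<le> R"
  obtains C where "C \<subseteq> A" "disjoint_family_on (\<lambda>x. ball x (r x)) C"
    "A \<subseteq> (\<Union>x\<in>C. ball x (3 * r x))"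
proof -
  define meets where "meets x y \<longleftrightarrow> ball x (r x) \<inter> ball y (r y) \<noteq> {}" for x y
  define good where "good = {C. C \<subseteq> A \<and> (\<forall>x\<in>C. \<forall>y\<in>C. x \<noteq> y \<longrightarrow> \<not> meets x y) \<and>
     (\<forall>y\<in>A. (\<exists>x\<in>C. meets x y) \<longrightarrow> (\<exists>x\<in>C. meets x y \<and> r y \<le> 2 * r x))}"
  have "\<exists>M\<in>good. \<forall>X\<in>good. M \<subseteq> X \<longrightarrow> X = M"
  proof (rule subset_Zorn_nonempty)
    have "{} \<in> good" by (simp add: good_def)
    then show "good \<noteq> {}" by blast
    fix \<C> assume "\<C> \<noteq> {}" and ch: "subset.chain good \<C>"
    have sub: "\<C> \<subseteq> good" using ch by (auto simp: subset.chain_def)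
    have lin: "X \<subseteq> Y \<or> Y \<subseteq> X" if "X \<in> \<C>" "Y \<in> \<C>" for X Y
      using ch that by (auto simp: subset.chain_def)
    have "\<not> meets x y" if "x \<in> \<Union>\<C>" "y \<in> \<Union>\<C>" "x \<noteq> y" for x y
    proof -
      obtain X Y where "X \<in> \<C>" "Y \<in> \<C>" "x \<in> X" "y \<in> Y" using \<open>x \<in> \<Union>\<C>\<close> \<open>y \<in> \<Union>\<C>\<close> by blast
      then obtain Z where "Z \<in> \<C>" "x \<in> Z" "y \<in> Z" using lin[of X Y] by blast
      then show ?thesis using sub \<open>x \<noteq> y\<close> by (auto simp: good_def)
    qed
    moreover have "\<exists>x\<in>\<Union>\<C>. meets x y \<and> r y \<le> 2 * r x" if y: "y \<in> A" "\<exists>x\<in>\<Union>\<C>. meets x y" for y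
    proof -
      obtain X x where X: "X \<in> \<C>" "x \<in> X" "meets x y" using y(2) by blast
      then have "X \<in> good" using sub by blast
      then have "\<exists>x\<in>X. meets x y \<and> r y \<le> 2 * r x" using y(1) X(2,3) unfolding good_def by blast
      then show ?thesis using X(1) by blast
    qed
    moreover have "\<Union>\<C> \<subseteq> A" using sub by (auto simp: good_def)
    ultimately show "\<Union>\<C> \<in> good" unfolding good_def by blast
  qed
  then obtain C where C: "C \<in> good" and max: "\<And>X. X \<in> good \<Longrightarrow> C \<subseteq> X \<Longrightarrow> X = C" by blast
  have "C \<subseteq> A" and disj: "\<And>x y. x \<in> C \<Longrightarrow> y \<in> C \<Longrightarrow> x \<noteq> y \<Longrightarrow> \<not> meets x y"
    and big: "\<And>y. y \<in> A \<Longrightarrow> (\<exists>x\<in>C. meets x y) \<Longrightarrow> (\<exists>x\<in>C. meets x y \<and> r y \<le> 2 * r x)"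
    using C by (auto simp: good_def)
  have all: "\<exists>x\<in>C. meets x y" if "y \<in> A" for y
  proof (rule ccontr)
    define D where "D = {y \<in> A. \<not> (\<exists>x\<in>C. meets x y)}"
    assume "\<not> ?thesis"
    then have D: "D \<noteq> {}" using that by (auto simp: D_def)
    have bdd: "bdd_above (r ` D)" using r(2) by (auto simp: D_def intro!: bdd_aboveI[of _ R])
    let ?s = "Sup (r ` D)"
    obtain y1 where y1: "y1 \<in> D" using D by blast
    have "0 < r y1" using y1 r(1) by (auto simp: D_def)
    also have "r y1 \<le> ?s" using y1 bdd by (intro cSup_upper) auto
    finally have "?s / 2 < ?s" by simp
    then have "\<exists>x\<in>r ` D. ?s / 2 < x" using D by (intro less_cSupD) auto
    then obtain y0 where y0: "y0 \<in> D" "?s / 2 < r y0" by auto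
    have self: "meets y0 y0" using y0 r(1)[of y0] by (auto simp: meets_def D_def)
    have sym: "meets x y = meets y x" for x y by (auto simp: meets_def)
    have "insert y0 C \<in> good"
    proof -
      have "insert y0 C \<subseteq> A" using y0 \<open>C \<subseteq> A\<close> by (auto simp: D_def)
      moreover have "\<not> meets x y" if "x \<in> insert y0 C" "y \<in> insert y0 C" "x \<noteq> y" for x y
        using that y0 disj sym by (auto simp: D_def)
      moreover have "\<exists>x\<in>insert y0 C. meets x y \<and> r y \<le> 2 * r x" if y: "y \<in> A" "\<exists>x\<in>insert y0 C. meets x y" for y
      proof (cases "\<exists>x\<in>C. meets x y")
        case True
        then show ?thesis using big[OF y(1)] by blast
      next
        case False
        then have "y \<in> D" "meets y0 y" using y by (auto simp: D_def)
        moreover have "r y \<le> ?s" using \<open>y \<in> D\<close> bdd by (intro cSup_upper) auto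
        ultimately show ?thesis using y0 by (intro bexI[of _ y0]) auto
      qed
      ultimately show ?thesis unfolding good_def by blast
    qed
    then have "y0 \<in> C" using max[of "insert y0 C"] by blast
    then show False using y0 self by (auto simp: D_def)
  qed
  show thesis
  proof (rule that[OF \<open>C \<subseteq> A\<close>])
    show "disjoint_family_on (\<lambda>x. ball x (r x)) C"
      using disj unfolding disjoint_family_on_def meets_def by blast
    show "A \<subseteq> (\<Union>x\<in>C. ball x (3 * r x))"
    proof
      fix y assume "y \<in> A"
      then obtain x where x: "x \<in> C" "meets x y" "r y \<le> 2 * r x" using all big by blast
      then obtain z where "dist x z < r x" "dist y z < r y" by (auto simp: meets_def)
      then have "dist x y < 3 * r x" using dist_triangle2[of x y z] x(3) by linarith
      then show "y \<in> (\<Union>x\<in>C. ball x (3 * r x))" using x(1) by auto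
    qed
  qed
qed

text \<open>
This compares \<open>hausdorff1\<close> with the image under \<open>\<sigma>\<close> of Lebesgue measure on \<open>M\<close>, a finite measure.
If that measure gives arbitrarily small balls around the points of \<open>A\<close> mass at least \<open>c * r\<close>, then a
disjoint family of such balls has radii of total at most \<open>measure lebesgue M / c\<close>, and the balls with
threefold radii, of diameter at most \<open>6 * r\<close>, cover \<open>A\<close>.
\<close>

lemma hausdorff1_le_of_upper_density:
  fixes \<sigma> :: "real \<Rightarrow> 'a::metric_space"
  assumes M: "M \<in> lmeasurable" "M \<subseteq> {0..L}" and \<sigma>: "continuous_on {0..L} \<sigma>" and "0 < c"
    and dens: "\<And>x \<delta>. x \<in> A \<Longrightarrow> 0 < \<delta> \<Longrightarrow> \<exists>r. 0 < r \<and> r < \<delta> \<and> c * r \<le> measure lebesgue {t \<in> M. \<sigma> t \<in> ball x r}"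
  shows "hausdorff1 A \<le> ennreal (6 / c * measure lebesgue M)"
proof (rule hausdorff1_leI)
  fix \<delta> :: real assume "0 < \<delta>"
  \<comment> \<open>Radii below \<open>\<delta> / 7\<close> make the diameters \<open>6 * r\<close> of the covering balls smaller than \<open>\<delta>\<close>.\<close>
  have "\<forall>x\<in>A. \<exists>r. 0 < r \<and> r < \<delta> / 7 \<and> c * r \<le> measure lebesgue {t \<in> M. \<sigma> t \<in> ball x r}"
    using dens[of _ "\<delta> / 7"] \<open>0 < \<delta>\<close> by auto
  then obtain r where r: "\<And>x. x \<in> A \<Longrightarrow> 0 < r x" "\<And>x. x \<in> A \<Longrightarrow> r x < \<delta> / 7"
      "\<And>x. x \<in> A \<Longrightarrow> c * r x \<le> measure lebesgue {t \<in> M. \<sigma> t \<in> ball x (r x)}"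
    by metis
  obtain C where C: "C \<subseteq> A" "disjoint_family_on (\<lambda>x. ball x (r x)) C"
      "A \<subseteq> (\<Union>x\<in>C. ball x (3 * r x))"
    by (rule vitali_covering_metric[OF r(1) less_imp_le[OF r(2)]])
  define P where "P x = {t \<in> M. \<sigma> t \<in> ball x (r x)}" for x
  have P_meas: "P x \<in> lmeasurable" for x
  proof -
    have "openin (top_of_set {0..L}) ({0..L} \<inter> \<sigma> -` ball x (r x))"
      by (rule continuous_openin_preimage_gen[OF \<sigma>]) simp
    then have "{0..L} \<inter> \<sigma> -` ball x (r x) \<in> sets lebesgue" by (rule lebesgue_openin) simp
    then have "M \<inter> ({0..L} \<inter> \<sigma> -` ball x (r x)) \<in> lmeasurable" using M(1) by (rule fmeasurable_Int_fmeasurable[rotated])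
    moreover have "M \<inter> ({0..L} \<inter> \<sigma> -` ball x (r x)) = P x" using M(2) by (auto simp: P_def)
    ultimately show ?thesis by simp
  qed
  have sum_r: "c * (\<Sum>x\<in>F. r x) \<le> measure lebesgue M" if F: "finite F" "F \<subseteq> C" for F
  proof -
    have "c * (\<Sum>x\<in>F. r x) \<le> (\<Sum>x\<in>F. measure lebesgue (P x))"
      unfolding sum_distrib_left using F C(1) r(3) by (intro sum_mono) (auto simp: P_def)
    also have "\<dots> = measure lebesgue (\<Union>x\<in>F. P x)"
    proof (rule measure_UNION'[symmetric])
      show "pairwise (\<lambda>x y. disjnt (P x) (P y)) F"
        using C(2) F(2) unfolding pairwise_def disjnt_iff P_def disjoint_family_on_def by blast
    qed (use F P_meas in auto)
    also have "\<dots> \<le> measure lebesgue M"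
      using M(1) P_meas F by (intro measure_mono_fmeasurable) (auto simp: P_def dest: fmeasurableD)
    finally show ?thesis .
  qed
  have "countable C"
  proof -
    have fin: "finite {x \<in> C. 1 / real (Suc n) < r x}" for n
    proof (rule ccontr)
      let ?S = "{x \<in> C. 1 / real (Suc n) < r x}"
      assume inf: "infinite ?S"
      define k where "k = nat \<lceil>real (Suc n) * measure lebesgue M / c\<rceil> + 1"
      obtain F where F: "F \<subseteq> ?S" "finite F" "card F = k" using infinite_arbitrarily_large[OF inf] by blast
      have "c * (real k * (1 / real (Suc n))) \<le> c * (\<Sum>x\<in>F. r x)"
        using F \<open>0 < c\<close> sum_mono[of F "\<lambda>_. 1 / real (Suc n)" r] by (intro mult_left_mono) (auto simp: less_imp_le subset_iff)
      also have "\<dots> \<le> measure lebesgue M" using F by (intro sum_r) auto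
      finally have "real k \<le> real (Suc n) * measure lebesgue M / c" using \<open>0 < c\<close> by (simp add: field_simps)
      then show False unfolding k_def by linarith
    qed
    have "countable (\<Union>n. {x \<in> C. 1 / real (Suc n) < r x})"
      by (rule countable_UN[OF countableI_type countable_finite[OF fin]])
    moreover have "C \<subseteq> (\<Union>n. {x \<in> C. 1 / real (Suc n) < r x})"
    proof
      fix x assume "x \<in> C"
      then have "0 < r x" using C(1) r(1) by auto
      then obtain n where "1 / real (Suc n) < r x" using nat_approx_posE by blast
      then show "x \<in> (\<Union>n. {x \<in> C. 1 / real (Suc n) < r x})" using \<open>x \<in> C\<close> by auto
    qed
    ultimately show ?thesis by (rule countable_subset[rotated])
  qed
  show "hausdorff1_pre \<delta> A \<le> ennreal (6 / c * measure lebesgue M)"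
  proof (rule hausdorff1_pre_le_countable_cover[OF \<open>countable C\<close> \<open>0 < \<delta>\<close> C(3)])
    have dm: "ediameter (ball x (3 * r x)) \<le> ennreal (6 * r x)" for x
    proof (rule ediameter_leI, rule ennreal_leI)
      fix y z assume "y \<in> ball x (3 * r x)" "z \<in> ball x (3 * r x)"
      then show "dist y z \<le> 6 * r x" using dist_triangle3[of y z x] by simp
    qed
    show "ediameter (ball x (3 * r x)) < ennreal \<delta>" if "x \<in> C" for x
    proof -
      have "6 * r x < \<delta>" using r(1,2)[of x] that C(1) by (auto simp: subset_iff)
      then have "ennreal (6 * r x) < ennreal \<delta>" using \<open>0 < \<delta>\<close> by (intro ennreal_lessI)
      then show ?thesis using dm le_less_trans by blast
    qed
    fix F assume F: "finite F" "F \<subseteq> C"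
    have pos: "0 \<le> r x" if "x \<in> F" for x using r(1) that F(2) C(1) by (auto intro: less_imp_le)
    have "(\<Sum>x\<in>F. ediameter (ball x (3 * r x))) \<le> (\<Sum>x\<in>F. ennreal (6 * r x))"
      by (intro sum_mono dm)
    also have "\<dots> = ennreal (6 * (\<Sum>x\<in>F. r x))"
      using pos by (simp add: sum_ennreal sum_distrib_left)
    also have "\<dots> \<le> ennreal (6 / c * measure lebesgue M)"
      using sum_r[OF F] \<open>0 < c\<close> by (intro ennreal_leI) (simp add: field_simps)
    finally show "(\<Sum>x\<in>F. ediameter (ball x (3 * r x))) \<le> ennreal (6 / c * measure lebesgue M)" .
  qed
qed

lemma hausdorff1_singleton [simp]: "hausdorff1 {x} = 0"
proof -
  have "hausdorff1 {x} \<le> 0"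
  proof (rule hausdorff1_leI, rule hausdorff1_pre_le_countable_cover)
    have e: "ediameter {x} = 0"
      using ediameter_leI[of "{x}" 0] by auto
    show "ediameter {x} < ennreal \<delta>" if "0 < \<delta>" for \<delta> :: real using that e by simp
    show "(\<Sum>y\<in>F. ediameter {x}) \<le> 0" for F :: "'a set" using e by simp
    show "countable {x}" "{x} \<subseteq> (\<Union>y\<in>{x}. {x})" by auto
  qed
  then show ?thesis by simp
qed

lemma measure_ball_Int_interval_ge:
  fixes t r L :: real
  assumes "t \<in> {0..L}" "0 < r" "r \<le> L"
  shows "r \<le> measure lebesgue ({0..L} \<inter> ball t r)"
proof -
  let ?I = "{max 0 (t - r)<..<min L (t + r)}"
  have "r \<le> min L (t + r) - max 0 (t - r)" using assms by (auto simp: min_def max_def)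
  also have "\<dots> = measure lebesgue ?I"
  proof -
    have "max 0 (t - r) \<le> min L (t + r)" using calculation \<open>0 < r\<close> by linarith
    then show ?thesis by simp
  qed
  also have "\<dots> \<le> measure lebesgue ({0..L} \<inter> ball t r)"
  proof (rule measure_mono_fmeasurable)
    show "?I \<subseteq> {0..L} \<inter> ball t r" by (auto simp: dist_real_def)
    have "{0..L} \<inter> ball t r \<in> sets lebesgue" by (intro sets.Int) auto
    then show "{0..L} \<inter> ball t r \<in> lmeasurable"
      by (rule bounded_set_imp_lmeasurable[rotated]) (auto intro: bounded_Int)
  qed auto
  finally show ?thesis .
qed

lemma lmeasurable_continuous_vimage_open:
  fixes \<sigma> :: "real \<Rightarrow> 'a::topological_space"
  assumes "continuous_on {0..L} \<sigma>" "open U"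
  shows "{t \<in> {0..L}. \<sigma> t \<in> U} \<in> lmeasurable"
proof -
  have "openin (top_of_set {0..L}) ({0..L} \<inter> \<sigma> -` U)"
    using assms by (rule continuous_openin_preimage_gen)
  then have "{0..L} \<inter> \<sigma> -` U \<in> sets lebesgue" by (rule lebesgue_openin) simp
  moreover have "{0..L} \<inter> \<sigma> -` U = {t \<in> {0..L}. \<sigma> t \<in> U}" by auto
  ultimately have "{t \<in> {0..L}. \<sigma> t \<in> U} \<in> sets lebesgue" by simp
  then show ?thesis
    by (rule bounded_set_imp_lmeasurable[rotated]) (auto intro: bounded_subset[of "{0..L}"])
qed

text \<open>
The factor \<open>6\<close> comes from the covering lemma.  It is harmless, because the estimate only serves to see
that a measure is finite or small.
\<close>

lemma hausdorff1_image_le: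
  fixes \<sigma> :: "real \<Rightarrow> 'a::metric_space"
  assumes \<sigma>: "1-lipschitz_on {0..L} \<sigma>" and "0 < L" and T: "T \<in> lmeasurable" "T \<subseteq> {0..L}"
  shows "hausdorff1 (\<sigma> ` T) \<le> ennreal (6 * measure lebesgue T)"
proof (rule ennreal_le_epsilon)
  fix e :: real assume "0 < e"
  then obtain U where U: "open U" "T \<subseteq> U" "U - T \<in> lmeasurable" "emeasure lebesgue (U - T) < ennreal (e / 6)"
    using sets_lebesgue_outer_open[OF fmeasurableD[OF T(1)], of "e / 6"] by auto
  let ?M = "U \<inter> {0..L}"
  have "{0..L} \<inter> U \<in> sets lebesgue" using U(1) by (intro sets.Int) auto
  then have M: "?M \<in> lmeasurable"
    by (intro bounded_set_imp_lmeasurable) (auto intro: bounded_Int simp: Int_commute)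
  have "hausdorff1 (\<sigma> ` T) \<le> ennreal (6 / 1 * measure lebesgue ?M)"
  proof (rule hausdorff1_le_of_upper_density[OF M])
    show "continuous_on {0..L} \<sigma>" using \<sigma> by (rule lipschitz_on_continuous_on)
    fix x \<delta> assume "x \<in> \<sigma> ` T" "0 < (\<delta>::real)"
    then obtain t where t: "t \<in> T" "x = \<sigma> t" by auto
    then obtain \<rho> where \<rho>: "0 < \<rho>" "ball t \<rho> \<subseteq> U" using U(1,2) open_contains_ball by blast
    define r where "r = min (min (\<delta> / 2) \<rho>) L"
    have r: "0 < r" "r < \<delta>" "r \<le> \<rho>" "r \<le> L" using \<open>0 < \<delta>\<close> \<rho>(1) \<open>0 < L\<close> by (auto simp: r_def)
    have "1 * r \<le> measure lebesgue ({0..L} \<inter> ball t r)"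
      using measure_ball_Int_interval_ge[of t L r] r t T(2) by auto
    also have "\<dots> \<le> measure lebesgue {s \<in> ?M. \<sigma> s \<in> ball x r}"
    proof (rule measure_mono_fmeasurable)
      show "{0..L} \<inter> ball t r \<subseteq> {s \<in> ?M. \<sigma> s \<in> ball x r}"
      proof
        fix s assume s: "s \<in> {0..L} \<inter> ball t r"
        then have "dist (\<sigma> t) (\<sigma> s) < r"
          using lipschitz_onD[OF \<sigma>, of t s] t T(2) by auto
        then show "s \<in> {s \<in> ?M. \<sigma> s \<in> ball x r}" using s \<rho>(2) r(3) t by auto
      qed
      have "{s \<in> ?M. \<sigma> s \<in> ball x r} = ?M \<inter> {s \<in> {0..L}. \<sigma> s \<in> ball x r}" by auto
      then show "{s \<in> ?M. \<sigma> s \<in> ball x r} \<in> lmeasurable"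
        using lmeasurable_continuous_vimage_open[OF lipschitz_on_continuous_on[OF \<sigma>], of "ball x r"] M
        by (auto intro!: fmeasurable.Int)
    qed (auto intro: sets.Int)
    finally show "\<exists>r>0. r < \<delta> \<and> 1 * r \<le> measure lebesgue {s \<in> ?M. \<sigma> s \<in> ball x r}" using r by blast
  qed auto
  also have "measure lebesgue ?M \<le> measure lebesgue T + e / 6"
  proof -
    have "measure lebesgue ?M \<le> measure lebesgue (T \<union> (U - T))"
      using T(2) U(3) M fmeasurable.Un[OF T(1) U(3)] by (intro measure_mono_fmeasurable) (blast, auto dest: fmeasurableD)
    also have "\<dots> \<le> measure lebesgue T + measure lebesgue (U - T)"
      using T U(3) by (intro measure_Un_le) (auto dest: fmeasurableD)
    also have "measure lebesgue (U - T) \<le> e / 6"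
      using U(3,4) \<open>0 < e\<close> by (simp add: emeasure_eq_measure2 ennreal_less_iff)
    finally show ?thesis by simp
  qed
  then have "ennreal (6 / 1 * measure lebesgue ?M) \<le> ennreal (6 * measure lebesgue T + e)"
    by (intro ennreal_leI) simp
  also have "\<dots> = ennreal (6 * measure lebesgue T) + ennreal e"
    using \<open>0 < e\<close> by (intro ennreal_plus) auto
  finally show "hausdorff1 (\<sigma> ` T) \<le> ennreal (6 * measure lebesgue T) + ennreal e" .
qed

lemma hausdorff1_negligible_image:
  fixes \<sigma> :: "real \<Rightarrow> 'a::metric_space"
  assumes "1-lipschitz_on {0..L} \<sigma>" "0 < L" "negligible N" "N \<subseteq> {0..L}"
  shows "hausdorff1 (\<sigma> ` N) = 0"
  using hausdorff1_image_le[OF assms(1,2) negligible_imp_measurable[OF assms(3)] assms(4)]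
    negligible_imp_measure0[OF assms(3)] by simp

text \<open>
The part of the curve outside \<open>E\<close> has density zero at \<open>x\<close>, measured by the time that it spends near \<open>x\<close>.
Time is a genuine finite measure, so that questions of measurability for \<open>hausdorff1\<close> do not arise, and it
bounds the length of that part up to a factor.
\<close>

definition thin_outside :: "(real \<Rightarrow> 'a::metric_space) \<Rightarrow> real \<Rightarrow> 'a set \<Rightarrow> 'a \<Rightarrow> bool" where
  "thin_outside \<sigma> L E x \<longleftrightarrow>
     (\<forall>c>0. \<exists>\<delta>>0. \<forall>r. 0 < r \<and> r < \<delta> \<longrightarrow> measure lebesgue {t \<in> {0..L}. \<sigma> t \<notin> E \<and> \<sigma> t \<in> ball x r} < c * r)"

lemma thin_outsideD:
  assumes "thin_outside \<sigma> L E x" "0 < c"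
  shows "\<exists>\<delta>>0. \<forall>r>0. r < \<delta> \<longrightarrow> measure lebesgue {t \<in> {0..L}. \<sigma> t \<notin> E \<and> \<sigma> t \<in> ball x r} < c * r"
  using assms unfolding thin_outside_def by blast

text \<open>
Where the outer part has positive upper density \<open>c\<close>, apply \<open>hausdorff1_le_of_upper_density\<close> to the times
\<open>M m\<close> that \<open>\<sigma>\<close> spends outside \<open>E\<close> but close to it.  As \<open>E\<close> is closed, these sets decrease to the
empty set.
\<close>

lemma thin_outside_ae:
  fixes \<sigma> :: "real \<Rightarrow> 'a::metric_space"
  assumes \<sigma>: "continuous_on {0..L} \<sigma>" and E: "compact E"
  shows "hausdorff1 {x \<in> E. \<not> thin_outside \<sigma> L E x} = 0"
proof (cases "E = {}")
  case False
  let ?out = "\<lambda>x r. measure lebesgue {t \<in> {0..L}. \<sigma> t \<notin> E \<and> \<sigma> t \<in> ball x r}"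
  define A where "A c = {x \<in> E. \<forall>\<delta>>0. \<exists>r. 0 < r \<and> r < \<delta> \<and> c * r \<le> ?out x r}" for c
  define M where "M m = {t \<in> {0..L}. \<sigma> t \<in> - E \<inter> {y. infdist y E < 1 / real (Suc m)}}" for m :: nat
  have closed: "closed E" using E by (rule compact_imp_closed)
  have M_meas: "M m \<in> lmeasurable" for m
    unfolding M_def using closed
    by (intro lmeasurable_continuous_vimage_open[OF \<sigma>] open_Int open_Collect_less continuous_intros) auto
  have "(\<Inter>m. M m) = {}"
  proof (rule ccontr)
    assume "(\<Inter>m. M m) \<noteq> {}"
    then obtain t where t: "\<And>m. t \<in> M m" by blast
    have "\<sigma> t \<notin> E" using t[of 0] by (simp add: M_def)
    then have "0 < infdist (\<sigma> t) E" using False closed by (simp add: infdist_pos_not_in_closed)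
    then obtain m where "1 / real (Suc m) < infdist (\<sigma> t) E" using nat_approx_posE by blast
    then show False using t[of m] by (auto simp: M_def)
  qed
  have "decseq M"
    unfolding decseq_def
  proof (intro allI impI subsetI)
    fix m n :: nat and t assume mn: "m \<le> n" "t \<in> M n"
    have "1 / real (Suc n) \<le> 1 / real (Suc m)" using mn(1) by (intro divide_left_mono) auto
    then show "t \<in> M m" using mn(2) by (auto simp: M_def)
  qed
  have lim: "(\<lambda>m. measure lebesgue (M m)) \<longlonglongrightarrow> 0"
  proof -
    have "emeasure lebesgue (M m) \<noteq> \<infinity>" for m using fmeasurableD2[OF M_meas] by simp
    moreover have "range M \<subseteq> sets lebesgue" using fmeasurableD[OF M_meas] by blast
    ultimately have "(\<lambda>m. measure lebesgue (M m)) \<longlonglongrightarrow> measure lebesgue (\<Inter>m. M m)"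
      using \<open>decseq M\<close> by (intro Lim_measure_decseq)
    then show ?thesis using \<open>(\<Inter>m. M m) = {}\<close> by simp
  qed
  have A0: "hausdorff1 (A c) = 0" if "0 < c" for c
  proof -
    have bound: "hausdorff1 (A c) \<le> ennreal (6 / c * measure lebesgue (M m))" for m
    proof (rule hausdorff1_le_of_upper_density[OF M_meas _ \<sigma> that])
      show "M m \<subseteq> {0..L}" by (auto simp: M_def)
      fix x and \<delta> :: real assume x: "x \<in> A c" "0 < \<delta>"
      then have "0 < min \<delta> (1 / real (Suc m))" by simp
      then obtain r where r: "0 < r" "r < min \<delta> (1 / real (Suc m))" "c * r \<le> ?out x r"
        using x(1) unfolding A_def by blast
      have "{t \<in> {0..L}. \<sigma> t \<notin> E \<and> \<sigma> t \<in> ball x r} = {t \<in> M m. \<sigma> t \<in> ball x r}"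
      proof -
        have "infdist (\<sigma> t) E < 1 / real (Suc m)" if "\<sigma> t \<in> ball x r" for t
        proof -
          have "infdist (\<sigma> t) E \<le> dist (\<sigma> t) x" using x(1) by (intro infdist_le) (simp add: A_def)
          then show ?thesis using that r(2) by (simp add: dist_commute)
        qed
        then show ?thesis by (auto simp: M_def)
      qed
      then show "\<exists>r>0. r < \<delta> \<and> c * r \<le> measure lebesgue {t \<in> M m. \<sigma> t \<in> ball x r}" using r by auto
    qed
    have "(\<lambda>m. ennreal (6 / c * measure lebesgue (M m))) \<longlonglongrightarrow> ennreal (6 / c * 0)"
      by (intro tendsto_ennrealI tendsto_mult_left lim)
    then have "hausdorff1 (A c) \<le> ennreal (6 / c * 0)"
      by (rule tendsto_lowerbound) (use bound in auto)
    then show ?thesis by simp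
  qed
  have "hausdorff1 (\<Union>n. A (1 / real (Suc n))) = 0" by (rule hausdorff1_null_UNION, rule A0) simp
  moreover have "{x \<in> E. \<not> thin_outside \<sigma> L E x} \<subseteq> (\<Union>n. A (1 / real (Suc n)))"
  proof
    fix x assume x: "x \<in> {x \<in> E. \<not> thin_outside \<sigma> L E x}"
    then obtain c where c: "0 < c" and *: "\<not> (\<exists>\<delta>>0. \<forall>r. 0 < r \<and> r < \<delta> \<longrightarrow> ?out x r < c * r)"
      unfolding thin_outside_def by blast
    have c2: "\<exists>r. 0 < r \<and> r < \<delta> \<and> c * r \<le> ?out x r" if "0 < \<delta>" for \<delta>
      using * that by (meson not_le)
    obtain n where n: "1 / real (Suc n) < c" using c nat_approx_posE by blast
    have "x \<in> A (1 / real (Suc n))"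
      unfolding A_def
    proof (intro CollectI conjI allI impI)
      fix \<delta> :: real assume "0 < \<delta>"
      then obtain r where r: "0 < r" "r < \<delta>" "c * r \<le> ?out x r" using c2 by blast
      moreover have "1 / real (Suc n) * r \<le> c * r" using n r(1) by (intro mult_right_mono) auto
      ultimately show "\<exists>r. 0 < r \<and> r < \<delta> \<and> 1 / real (Suc n) * r \<le> ?out x r"
        by (intro exI[of _ r]) linarith
    qed (use x in auto)
    then show "x \<in> (\<Union>n. A (1 / real (Suc n)))" by blast
  qed
  ultimately show ?thesis by (rule hausdorff1_null_subset)
qed simp

text \<open>
Each fibre meets a piece on which \<open>\<sigma>\<close> expands in at most one point.
\<close>

lemma negligible_fibre:
  fixes \<sigma> :: "real \<Rightarrow> 'a::metric_space"
  assumes K: "\<forall>i. \<forall>s\<in>K i. \<forall>t\<in>K i. \<bar>s - t\<bar> \<le> 2 * dist (\<sigma> s) (\<sigma> t)"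
    and rest: "negligible ({0..L} - (\<Union>i::nat. K i))"
  shows "negligible {t \<in> {0..L}. \<sigma> t = z}"
proof -
  have "negligible {t \<in> K i. \<sigma> t \<in> {z}}" for i
    using K by (intro negligible_vimage_of_null[of "{z}" 2]) auto
  then have "negligible (({0..L} - (\<Union>i. K i)) \<union> (\<Union>i. {t \<in> K i. \<sigma> t \<in> {z}}))"
    using rest by (intro negligible_Un negligible_countable_Union) auto
  then show ?thesis by (rule negligible_subset) auto
qed

section \<open>Generic functions are steep along the curve\<close>

text \<open>
Among the points of \<open>\<Gamma>\<close> there are \<open>y \<rightarrow> x\<close> along which the slope of \<open>h\<close> tends to at least \<open>1\<close>.  This
does not refer to a parametrization, so that strands of a curve that overlap or almost touch need no
special care when \<open>h\<close> is constructed.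
\<close>

definition steep_at :: "('a::metric_space \<Rightarrow> real) \<Rightarrow> 'a set \<Rightarrow> 'a \<Rightarrow> bool" where
  "steep_at h \<Gamma> x \<longleftrightarrow>
     (\<forall>\<epsilon>>0. \<exists>y\<in>\<Gamma>. y \<noteq> x \<and> dist x y < \<epsilon> \<and> (1 - \<epsilon>) * dist x y \<le> \<bar>h x - h y\<bar>)"

text \<open>
Shrink \<open>h0\<close> to \<open>h1 = (1 - l) * h0\<close>, and let \<open>k\<close> be the inf-convolution \<open>Min {h1 z + dist x z | z \<in> Z}\<close> over a
finite \<open>\<mu>\<close>-net \<open>Z\<close> of \<open>\<Gamma>\<close>.  The function \<open>k\<close> is 1-Lipschitz, at least \<open>h1\<close>, and equal to \<open>h1\<close>
on \<open>Z\<close>.  The deficit \<open>l\<close> in the Lipschitz constant forces the minimizing \<open>z\<close> to be within \<open>2 * \<mu> / l\<close>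
of \<open>x \<in> \<Gamma>\<close>, and towards that \<open>z\<close> the slope is \<open>1\<close>.  Truncation by \<open>h1 + \<epsilon> / 2\<close> keeps the function close to
\<open>h0\<close> far from \<open>\<Gamma>\<close> and changes nothing on \<open>\<Gamma>\<close>.
\<close>

lemma sawtooth_perturbation:
  fixes h0 :: "'a::metric_space \<Rightarrow> real"
  assumes h0: "1-lipschitz_on UNIV h0" "\<And>x. \<bar>h0 x\<bar> \<le> B" and \<Gamma>: "compact \<Gamma>" and "0 < \<epsilon>" "0 < \<kappa>"
  obtains h Z where "1-lipschitz_on UNIV h" "\<And>x. \<bar>h x - h0 x\<bar> \<le> \<epsilon>" "finite Z" "Z \<subseteq> \<Gamma>"
    "\<And>x. x \<in> \<Gamma> \<Longrightarrow> \<exists>z\<in>Z. dist x z < \<kappa> \<and> \<bar>h x - h z\<bar> = dist x z"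
proof (cases "\<Gamma> = {}")
  case True
  then show thesis using that[of h0 "{}"] h0 \<open>0 < \<epsilon>\<close> by simp
next
  case False
  have B0: "0 \<le> B" using h0(2)[of undefined] by linarith
  define l where "l = min 1 (\<epsilon> / (2 * (B + 1)))"
  have l: "0 < l" "l \<le> 1" "l \<le> \<epsilon> / (2 * (B + 1))" using \<open>0 < \<epsilon>\<close> B0 by (auto simp: l_def)
  then have "l * (2 * (B + 1)) \<le> \<epsilon>" using B0 by (subst (asm) pos_le_divide_eq) auto
  then have lB: "l * B \<le> \<epsilon> / 2" using l(1) by (simp add: algebra_simps)
  define h1 where "h1 x = (1 - l) * h0 x" for x
  have h1_lip: "\<bar>h1 x - h1 y\<bar> \<le> (1 - l) * dist x y" for x y
  proof -
    have "\<bar>h1 x - h1 y\<bar> = (1 - l) * \<bar>h0 x - h0 y\<bar>"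
      using l by (simp add: h1_def abs_mult flip: right_diff_distrib)
    also have "\<dots> \<le> (1 - l) * dist x y"
      using l lipschitz_onD[OF h0(1), of x y] by (intro mult_left_mono) (auto simp: dist_real_def)
    finally show ?thesis .
  qed
  have h1_lip': "\<bar>h1 x - h1 y\<bar> \<le> dist x y" for x y
    using h1_lip[of x y] mult_right_mono[of "1 - l" 1 "dist x y"] l by simp
  have h1_near: "\<bar>h1 x - h0 x\<bar> \<le> \<epsilon> / 2" for x
  proof -
    have "h1 x - h0 x = - (l * h0 x)" by (simp add: h1_def algebra_simps)
    then have "\<bar>h1 x - h0 x\<bar> = l * \<bar>h0 x\<bar>" using l by (simp add: abs_mult)
    also have "\<dots> \<le> l * B" using l h0(2) by (intro mult_left_mono) auto
    finally show ?thesis using lB by linarith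
  qed
  \<comment> \<open>The first bound keeps the minimizing net point within \<open>\<kappa>\<close>; the second keeps \<open>k\<close> below the truncation on \<open>\<Gamma>\<close>.\<close>
  define \<mu> where "\<mu> = min (l * \<kappa> / 2) (\<epsilon> / 4)"
  have \<mu>: "0 < \<mu>" "2 * \<mu> \<le> l * \<kappa>" "2 * \<mu> \<le> \<epsilon> / 2" using l \<open>0 < \<kappa>\<close> \<open>0 < \<epsilon>\<close> by (auto simp: \<mu>_def)
  obtain Z where Z: "finite Z" "Z \<subseteq> \<Gamma>" "\<Gamma> \<subseteq> (\<Union>z\<in>Z. ball z \<mu>)"
    using compactE_image[OF \<Gamma>, of \<Gamma> "\<lambda>z. ball z \<mu>"] \<mu>(1) by (metis UN_I centre_in_ball open_ball subsetI)
  have "Z \<noteq> {}" using False Z by auto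
  define k where "k x = Min ((\<lambda>z. h1 z + dist x z) ` Z)" for x
  have k_le: "k x \<le> h1 z + dist x z" if "z \<in> Z" for x z
    unfolding k_def using Z(1) that by (intro Min_le) auto
  have k_attained: "\<exists>z\<in>Z. k x = h1 z + dist x z" for x
  proof -
    have "k x \<in> (\<lambda>z. h1 z + dist x z) ` Z"
      unfolding k_def using Z(1) \<open>Z \<noteq> {}\<close> by (intro Min_in) auto
    then show ?thesis by auto
  qed
  have k_ge: "h1 x \<le> k x" for x
  proof -
    obtain z where "z \<in> Z" "k x = h1 z + dist x z" using k_attained by blast
    then show ?thesis using h1_lip'[of x z] by linarith
  qed
  have k_lip: "k x \<le> k y + dist x y" for x y
  proof -
    obtain z where "z \<in> Z" "k y = h1 z + dist y z" using k_attained by blast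
    then show ?thesis using k_le[of z x] dist_triangle[of x z y] by linarith
  qed
  define h where "h x = min (h1 x + \<epsilon> / 2) (k x)" for x
  have h_le: "h x \<le> h y + dist x y" for x y
  proof -
    have "h1 x \<le> h1 y + dist x y" using h1_lip'[of x y] by linarith
    then show ?thesis using k_lip[of x y] by (auto simp: h_def min_def)
  qed
  have h_bounds: "h1 x \<le> h x" "h x \<le> h1 x + \<epsilon> / 2" for x
    using k_ge[of x] \<open>0 < \<epsilon>\<close> by (auto simp: h_def)
  have h_at: "h z = h1 z" if "z \<in> Z" for z
    using k_le[OF that, of z] h_bounds(1)[of z] by (simp add: h_def)
  show thesis
  proof (rule that[of h Z])
    show "1-lipschitz_on UNIV h"
    proof (rule lipschitz_onI)
      fix x y
      show "dist (h x) (h y) \<le> 1 * dist x y"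
        using h_le[of x y] h_le[of y x] by (simp add: dist_real_def abs_le_iff dist_commute)
    qed simp
    show "\<bar>h x - h0 x\<bar> \<le> \<epsilon>" for x
      using h_bounds[of x] h1_near[of x] by linarith
    fix x assume x: "x \<in> \<Gamma>"
    then obtain w where w: "w \<in> Z" "dist x w < \<mu>" using Z(3) by (auto simp: dist_commute)
    obtain z where z: "z \<in> Z" "k x = h1 z + dist x z" using k_attained by blast
    have le: "h1 z + dist x z \<le> h1 w + dist x w" using k_le[OF w(1), of x] z by simp
    have hw: "\<bar>h1 x - h1 w\<bar> \<le> dist x w" by (rule h1_lip')
    have "\<bar>h1 x - h1 z\<bar> \<le> dist x z - l * dist x z" using h1_lip[of x z] by (simp add: algebra_simps)
    then have "l * dist x z < 2 * \<mu>" using le hw w(2) by linarith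
    then have "l * dist x z < l * \<kappa>" using \<mu>(2) by linarith
    then have "dist x z < \<kappa>" using l(1) by simp
    moreover have "k x \<le> h1 x + \<epsilon> / 2" using le z hw w(2) \<mu>(3) by linarith
    then have "h x = h1 z + dist x z" using z(2) by (simp add: h_def)
    then have "\<bar>h x - h z\<bar> = dist x z" using h_at[OF z(1)] by simp
    ultimately show "\<exists>z\<in>Z. dist x z < \<kappa> \<and> \<bar>h x - h z\<bar> = dist x z" using z(1) by blast
  qed (use Z in auto)
qed

text \<open>
Close to the net points a sawtooth function has slope \<open>1\<close> without a uniform margin, so that a
neighbourhood of them is discarded; it is short in time because the fibres of \<open>\<sigma>\<close> are negligible.
\<close>

lemma small_neighbourhood_of_finite_set:
  fixes \<sigma> :: "real \<Rightarrow> 'a::metric_space"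
  assumes \<sigma>: "continuous_on {0..L} \<sigma>" and fibre: "\<And>z. negligible {t \<in> {0..L}. \<sigma> t = z}"
    and Z: "finite Z" and "0 < e"
  obtains d M where "0 < d" "M \<in> lmeasurable" "measure lebesgue M < e"
    "\<And>t z. t \<in> {0..L} - M \<Longrightarrow> z \<in> Z \<Longrightarrow> d \<le> dist (\<sigma> t) z"
proof (cases "Z = {}")
  case True
  then show thesis using that[of 1 "{}"] \<open>0 < e\<close> by simp
next
  case False
  define M where "M m = {t \<in> {0..L}. \<sigma> t \<in> {y. infdist y Z < 1 / real (Suc m)}}" for m
  have M_meas: "M m \<in> lmeasurable" for m
    unfolding M_def by (intro lmeasurable_continuous_vimage_open[OF \<sigma>] open_Collect_less continuous_intros)
  have "decseq M"
    unfolding decseq_def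
  proof (intro allI impI subsetI)
    fix m n :: nat and t assume mn: "m \<le> n" "t \<in> M n"
    have "1 / real (Suc n) \<le> 1 / real (Suc m)" using mn(1) by (intro divide_left_mono) auto
    then show "t \<in> M m" using mn(2) by (auto simp: M_def)
  qed
  moreover have "emeasure lebesgue (M m) \<noteq> \<infinity>" for m using fmeasurableD2[OF M_meas] by simp
  moreover have "range M \<subseteq> sets lebesgue" using fmeasurableD[OF M_meas] by blast
  ultimately have "(\<lambda>m. measure lebesgue (M m)) \<longlonglongrightarrow> measure lebesgue (\<Inter>m. M m)"
    by (intro Lim_measure_decseq)
  moreover have "measure lebesgue (\<Inter>m. M m) = 0"
  proof (rule negligible_imp_measure0, rule negligible_subset)
    show "negligible (\<Union>z\<in>Z. {t \<in> {0..L}. \<sigma> t = z})"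
      using Z fibre by (intro negligible_Union) auto
    show "(\<Inter>m. M m) \<subseteq> (\<Union>z\<in>Z. {t \<in> {0..L}. \<sigma> t = z})"
    proof
      fix t assume t: "t \<in> (\<Inter>m. M m)"
      have "\<sigma> t \<in> Z"
      proof (rule ccontr)
        assume "\<sigma> t \<notin> Z"
        then have "0 < infdist (\<sigma> t) Z"
          using False Z by (simp add: infdist_pos_not_in_closed finite_imp_closed)
        then obtain m where "1 / real (Suc m) < infdist (\<sigma> t) Z" using nat_approx_posE by blast
        moreover have "t \<in> M m" using t by blast
        ultimately show False by (simp add: M_def)
      qed
      moreover have "t \<in> M 0" using t by blast
      ultimately show "t \<in> (\<Union>z\<in>Z. {t \<in> {0..L}. \<sigma> t = z})" by (auto simp: M_def)
    qed
  qed
  ultimately have "eventually (\<lambda>m. measure lebesgue (M m) < e) sequentially"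
    using \<open>0 < e\<close> by (auto intro: order_tendstoD)
  then obtain m where m: "measure lebesgue (M m) < e" by (auto simp: eventually_sequentially)
  show thesis
  proof (rule that[OF _ M_meas m])
    show "0 < 1 / real (Suc m)" by simp
    fix t z assume "t \<in> {0..L} - M m" "z \<in> Z"
    then have "1 / real (Suc m) \<le> infdist (\<sigma> t) Z" by (auto simp: M_def)
    also have "\<dots> \<le> dist (\<sigma> t) z" using \<open>z \<in> Z\<close> by (rule infdist_le)
    finally show "1 / real (Suc m) \<le> dist (\<sigma> t) z" .
  qed
qed

text \<open>
The \<open>n\<close>-th dense open set asks for slope at least \<open>1 - 1 / Suc n\<close> at scale \<open>1 / Suc n\<close>, with a
margin \<open>\<rho>\<close> that is uniform over all times outside a set of measure less than \<open>1 / Suc n\<close>.  The margin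
makes the condition open; sawtooth functions make it dense.  A function in all these sets is steep at
\<open>\<sigma> t\<close> as soon as \<open>t\<close> avoids infinitely many of the exceptional sets.
\<close>

lemma generic_steep:
  fixes \<sigma> :: "real \<Rightarrow> 'a::metric_space"
  assumes \<sigma>: "continuous_on {0..L} \<sigma>" and fibre: "\<And>z. negligible {t \<in> {0..L}. \<sigma> t = z}"
  shows "\<exists>S :: ('a \<Rightarrow>\<^sub>C real) set. residual_in (top_of_set BLIP1) S \<and>
    (\<forall>h\<in>S. negligible {t \<in> {0..L}. \<not> steep_at (apply_bcontfun h) (\<sigma> ` {0..L}) (\<sigma> t)})"
proof -
  let ?\<Gamma> = "\<sigma> ` {0..L}"
  let ?e = "\<lambda>n. 1 / real (Suc n)"
  define G where "G n h M \<rho> \<longleftrightarrow> M \<in> lmeasurable \<and> measure lebesgue M < ?e n \<and> 0 < \<rho> \<and>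
     (\<forall>t\<in>{0..L} - M. \<exists>y\<in>?\<Gamma>. dist (\<sigma> t) y < ?e n \<and>
        (1 - ?e n) * dist (\<sigma> t) y + \<rho> < \<bar>apply_bcontfun h (\<sigma> t) - apply_bcontfun h y\<bar>)"
    for n and h :: "'a \<Rightarrow>\<^sub>C real" and M \<rho>
  define U where "U n = {h \<in> BLIP1. \<exists>M \<rho>. G n h M \<rho>}" for n
  have U_open: "openin (top_of_set BLIP1) (U n)" for n
    unfolding openin_euclidean_subtopology_iff
  proof (intro conjI ballI)
    show "U n \<subseteq> BLIP1" by (auto simp: U_def)
    fix h assume "h \<in> U n"
    then obtain M \<rho> where G: "G n h M \<rho>" by (auto simp: U_def)
    have "k \<in> U n" if k: "k \<in> BLIP1" "dist k h < \<rho> / 4" for k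
    proof -
      have "G n k M (\<rho> / 2)"
        unfolding G_def
      proof (intro conjI ballI)
        fix t assume "t \<in> {0..L} - M"
        then obtain y where y: "y \<in> ?\<Gamma>" "dist (\<sigma> t) y < ?e n"
          "(1 - ?e n) * dist (\<sigma> t) y + \<rho> < \<bar>apply_bcontfun h (\<sigma> t) - apply_bcontfun h y\<bar>"
          using G unfolding G_def by blast
        have near: "\<bar>apply_bcontfun k z - apply_bcontfun h z\<bar> < \<rho> / 4" for z
          using dist_bounded[of k z h] k(2) by (simp add: dist_real_def)
        have "(1 - ?e n) * dist (\<sigma> t) y + \<rho> / 2 < \<bar>apply_bcontfun k (\<sigma> t) - apply_bcontfun k y\<bar>"
          using y(3) near[of y] near[of "\<sigma> t"] by linarith
        then show "\<exists>y\<in>?\<Gamma>. dist (\<sigma> t) y < ?e n \<and>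
            (1 - ?e n) * dist (\<sigma> t) y + \<rho> / 2 < \<bar>apply_bcontfun k (\<sigma> t) - apply_bcontfun k y\<bar>"
          using y(1,2) by blast
      qed (use G in \<open>auto simp: G_def\<close>)
      then show ?thesis using k(1) by (auto simp: U_def)
    qed
    moreover have "0 < \<rho> / 4" using G by (simp add: G_def)
    ultimately show "\<exists>e>0. \<forall>k\<in>BLIP1. dist k h < e \<longrightarrow> k \<in> U n" by blast
  qed
  have approx: "\<exists>h\<in>U n. dist h h0 < \<epsilon>" if h0: "h0 \<in> BLIP1" and "0 < \<epsilon>" for n h0 \<epsilon>
  proof -
    obtain B where B: "\<And>x. \<bar>apply_bcontfun h0 x\<bar> \<le> B"
      using bounded_apply_bcontfun[of h0] by (auto simp: bounded_iff)
    have lip0: "1-lipschitz_on UNIV (apply_bcontfun h0)" using h0 by (simp add: BLIP1_def)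
    have comp: "compact ?\<Gamma>" by (intro compact_continuous_image \<sigma>) simp
    have e2: "0 < \<epsilon> / 2" using \<open>0 < \<epsilon>\<close> by simp
    have en: "0 < ?e n" by simp
    obtain k Z where k: "1-lipschitz_on UNIV k" "\<And>x. \<bar>k x - apply_bcontfun h0 x\<bar> \<le> \<epsilon> / 2"
      and Z: "finite Z" "Z \<subseteq> ?\<Gamma>" and kZ: "\<And>x. x \<in> ?\<Gamma> \<Longrightarrow> \<exists>z\<in>Z. dist x z < ?e n \<and> \<bar>k x - k z\<bar> = dist x z"
      using sawtooth_perturbation[OF lip0 B comp e2 en] by metis
    have "\<bar>k x\<bar> \<le> B + \<epsilon> / 2" for x using k(2)[of x] B[of x] by linarith
    then obtain h where h: "h \<in> BLIP1" "apply_bcontfun h = k"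
      using obtain_BLIP1[OF k(1)] by metis
    obtain d M where dM: "0 < d" "M \<in> lmeasurable" "measure lebesgue M < ?e n"
      "\<And>t z. t \<in> {0..L} - M \<Longrightarrow> z \<in> Z \<Longrightarrow> d \<le> dist (\<sigma> t) z"
      using small_neighbourhood_of_finite_set[OF \<sigma> fibre Z(1) en] by metis
    have "G n h M (d * ?e n / 2)"
      unfolding G_def
    proof (intro conjI ballI)
      fix t assume t: "t \<in> {0..L} - M"
      then obtain z where z: "z \<in> Z" "dist (\<sigma> t) z < ?e n" "\<bar>k (\<sigma> t) - k z\<bar> = dist (\<sigma> t) z"
        using kZ[of "\<sigma> t"] by auto
      have "d * ?e n \<le> dist (\<sigma> t) z * ?e n" using dM(4)[OF t z(1)] by (intro mult_right_mono) auto
      moreover have "0 < d * ?e n" using dM(1) en by (rule mult_pos_pos)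
      ultimately have "(1 - ?e n) * dist (\<sigma> t) z + d * ?e n / 2 < dist (\<sigma> t) z"
      proof -
        have "(1 - e) * D + d * e / 2 < D" if "d * e \<le> D * e" "0 < d * e" for d e D :: real
        proof -
          have "(1 - e) * D = D - D * e" by (simp add: algebra_simps)
          then show ?thesis using that by linarith
        qed
        then show ?thesis using \<open>d * ?e n \<le> dist (\<sigma> t) z * ?e n\<close> \<open>0 < d * ?e n\<close> by blast
      qed
      then show "\<exists>y\<in>?\<Gamma>. dist (\<sigma> t) y < ?e n \<and>
          (1 - ?e n) * dist (\<sigma> t) y + d * ?e n / 2 < \<bar>apply_bcontfun h (\<sigma> t) - apply_bcontfun h y\<bar>"
        using z Z(2) h(2) by (intro bexI[of _ z]) auto
    qed (use dM en in auto)
    then have "h \<in> U n" using h(1) by (auto simp: U_def)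
    moreover have "dist h h0 \<le> \<epsilon> / 2"
      by (rule dist_bound) (use k(2) h(2) in \<open>simp add: dist_real_def\<close>)
    ultimately show ?thesis using \<open>0 < \<epsilon>\<close> by (intro bexI[of _ h]) auto
  qed
  have U_dense: "top_of_set BLIP1 closure_of U n = BLIP1" for n
  proof -
    have "BLIP1 \<subseteq> closure (U n)" using approx by (auto simp: closure_approachable)
    moreover have "BLIP1 \<inter> U n = U n" by (auto simp: U_def)
    ultimately show ?thesis by (simp add: closure_of_subtopology) blast
  qed
  have ae: "negligible {t \<in> {0..L}. \<not> steep_at (apply_bcontfun h) ?\<Gamma> (\<sigma> t)}" if h: "\<And>n. h \<in> U n" for h
  proof -
    have "\<forall>n. \<exists>M \<rho>. G n h M \<rho>" using h by (simp add: U_def)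
    then obtain M \<rho> where G: "\<And>n. G n h (M n) (\<rho> n)" by metis
    have "negligible (\<Inter>n\<in>{N..}. M n)" for N
      unfolding negligible_outer
    proof (intro allI impI)
      fix e :: real assume "0 < e"
      then obtain m where m: "?e m < e" using nat_approx_posE by blast
      have "?e (max N m) \<le> ?e m" by (intro divide_left_mono) auto
      then have "measure lebesgue (M (max N m)) < e"
        using G[of "max N m"] m unfolding G_def by linarith
      moreover have "M (max N m) \<in> lmeasurable" using G by (simp add: G_def)
      moreover have "(\<Inter>n\<in>{N..}. M n) \<subseteq> M (max N m)" by (rule INF_lower) simp
      ultimately show "\<exists>T. (\<Inter>n\<in>{N..}. M n) \<subseteq> T \<and> T \<in> lmeasurable \<and> measure lebesgue T < e" by blast
    qed
    then have "negligible (\<Union>N. \<Inter>n\<in>{N..}. M n)" by (intro negligible_countable_Union) auto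
    moreover have "{t \<in> {0..L}. \<not> steep_at (apply_bcontfun h) ?\<Gamma> (\<sigma> t)} \<subseteq> (\<Union>N. \<Inter>n\<in>{N..}. M n)"
    proof
      fix t assume t: "t \<in> {t \<in> {0..L}. \<not> steep_at (apply_bcontfun h) ?\<Gamma> (\<sigma> t)}"
      show "t \<in> (\<Union>N. \<Inter>n\<in>{N..}. M n)"
      proof (rule ccontr)
        assume "t \<notin> (\<Union>N. \<Inter>n\<in>{N..}. M n)"
        then have inf: "\<exists>n\<ge>N. t \<notin> M n" for N by auto
        have "steep_at (apply_bcontfun h) ?\<Gamma> (\<sigma> t)"
          unfolding steep_at_def
        proof (intro allI impI)
          fix \<epsilon> :: real assume "0 < \<epsilon>"
          then obtain N where N: "?e N < \<epsilon>" using nat_approx_posE by blast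
          obtain n where n: "N \<le> n" "t \<notin> M n" using inf by blast
          have "?e n \<le> ?e N" using n(1) by (intro divide_left_mono) auto
          then have en: "?e n < \<epsilon>" using N by linarith
          have "t \<in> {0..L} - M n" using t n(2) by auto
          then obtain y where y: "y \<in> ?\<Gamma>" "dist (\<sigma> t) y < ?e n"
            "(1 - ?e n) * dist (\<sigma> t) y + \<rho> n < \<bar>apply_bcontfun h (\<sigma> t) - apply_bcontfun h y\<bar>"
            using G[of n] unfolding G_def by blast
          have "0 < \<rho> n" using G by (simp add: G_def)
          have "y \<noteq> \<sigma> t" using y(3) \<open>0 < \<rho> n\<close> by auto
          moreover have "(1 - \<epsilon>) * dist (\<sigma> t) y \<le> (1 - ?e n) * dist (\<sigma> t) y"
            using en by (intro mult_right_mono) auto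
          then have "(1 - \<epsilon>) * dist (\<sigma> t) y \<le> \<bar>apply_bcontfun h (\<sigma> t) - apply_bcontfun h y\<bar>"
            using y(3) \<open>0 < \<rho> n\<close> by linarith
          moreover have "dist (\<sigma> t) y < \<epsilon>" using y(2) en by linarith
          ultimately show "\<exists>y\<in>?\<Gamma>. y \<noteq> \<sigma> t \<and> dist (\<sigma> t) y < \<epsilon> \<and>
              (1 - \<epsilon>) * dist (\<sigma> t) y \<le> \<bar>apply_bcontfun h (\<sigma> t) - apply_bcontfun h y\<bar>"
            using y(1) by blast
        qed
        then show False using t by blast
      qed
    qed
    ultimately show ?thesis by (rule negligible_subset)
  qed
  show ?thesis
  proof (intro exI conjI ballI)
    show "residual_in (top_of_set BLIP1) (BLIP1 \<inter> \<Inter>(range U))"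
      unfolding residual_in_def using U_open U_dense by (intro conjI exI[of _ "range U"]) auto
    show "negligible {t \<in> {0..L}. \<not> steep_at (apply_bcontfun h) ?\<Gamma> (\<sigma> t)}" if "h \<in> BLIP1 \<inter> \<Inter>(range U)" for h
      using that by (intro ae) auto
  qed
qed

text \<open>
Let \<open>y\<close> be a point at distance \<open>r\<close> from \<open>\<sigma> t\<close> towards which \<open>h\<close> is steep.  If \<open>\<sigma> ` K\<close> stayed away from
\<open>ball y (c * r)\<close>, then the curve would spend time at least \<open>c * r\<close> in that ball and hence outside
\<open>\<sigma> ` K\<close>, contradicting thinness at scale \<open>2 * r\<close>.  So some \<open>\<sigma> s\<close> with \<open>s \<in> K\<close> is within \<open>c * r\<close> of
\<open>y\<close>; moving from \<open>y\<close> to \<open>\<sigma> s\<close> costs only a small relative error, and \<open>s\<close> is close to \<open>t\<close> because \<open>\<sigma>\<close>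
expands on \<open>K\<close>.
\<close>

lemma steep_along_curve:
  fixes \<sigma> :: "real \<Rightarrow> 'a::metric_space" and h :: "'a \<Rightarrow> real"
  assumes \<sigma>: "1-lipschitz_on {0..L} \<sigma>" and h: "1-lipschitz_on UNIV h"
    and K: "K \<subseteq> {0..L}" "\<And>s t. s \<in> K \<Longrightarrow> t \<in> K \<Longrightarrow> \<bar>s - t\<bar> \<le> 2 * dist (\<sigma> s) (\<sigma> t)" "compact K"
    and t: "t \<in> K" "unit_speed_at \<sigma> L t" "thin_outside \<sigma> L (\<sigma> ` K) (\<sigma> t)"
    and steep: "steep_at h (\<sigma> ` {0..L}) (\<sigma> t)"
    and "0 < \<eta>" "0 < \<delta>"
  shows "\<exists>s\<in>{0..L}. s \<noteq> t \<and> \<bar>s - t\<bar> < \<delta> \<and> (1 - \<eta>) * \<bar>s - t\<bar> \<le> \<bar>h (\<sigma> s) - h (\<sigma> t)\<bar>"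
proof -
  let ?x = "\<sigma> t"
  have cont: "continuous_on {0..L} \<sigma>" using \<sigma> by (rule lipschitz_on_continuous_on)
  \<comment> \<open>The three relative errors \<open>c\<close> below combine to \<open>(1 - 2 * c) * (1 - c) / (1 + c) \<ge> 1 - 4 * c\<close>.\<close>
  define c where "c = min (\<eta> / 4) (1 / 4)"
  have c: "0 < c" "c \<le> 1 / 4" "4 * c \<le> \<eta>" using \<open>0 < \<eta>\<close> by (auto simp: c_def)
  obtain \<delta>1 where \<delta>1: "0 < \<delta>1" "\<And>s. s \<in> {0..L} \<Longrightarrow> \<bar>s - t\<bar> < \<delta>1 \<Longrightarrow> (1 - c) * \<bar>s - t\<bar> \<le> dist (\<sigma> s) ?x"
    using t(2) c(1) unfolding unit_speed_at_def by metis
  have "0 < c / 4" using c(1) by simp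
  from thin_outsideD[OF t(3) this] obtain \<delta>2 where \<delta>2: "0 < \<delta>2"
    "\<And>r. 0 < r \<Longrightarrow> r < \<delta>2 \<Longrightarrow> measure lebesgue {s \<in> {0..L}. \<sigma> s \<notin> \<sigma> ` K \<and> \<sigma> s \<in> ball ?x r} < c / 4 * r"
    by blast
  define \<epsilon> where "\<epsilon> = Min {c, \<delta> / 4, \<delta>1 / 4, \<delta>2 / 2}"
  have \<epsilon>: "0 < \<epsilon>" "\<epsilon> \<le> c" "4 * \<epsilon> \<le> \<delta>" "4 * \<epsilon> \<le> \<delta>1" "2 * \<epsilon> \<le> \<delta>2"
    using c(1) \<open>0 < \<delta>\<close> \<delta>1(1) \<delta>2(1) by (auto simp: \<epsilon>_def)
  obtain y where y: "y \<in> \<sigma> ` {0..L}" "y \<noteq> ?x" "dist ?x y < \<epsilon>" "(1 - \<epsilon>) * dist ?x y \<le> \<bar>h ?x - h y\<bar>"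
    using steep \<epsilon>(1) unfolding steep_at_def by blast
  define r where "r = dist ?x y"
  have r: "0 < r" "r < \<epsilon>" using y by (auto simp: r_def)
  obtain u where u: "u \<in> {0..L}" "y = \<sigma> u" using y(1) by auto
  have tL: "t \<in> {0..L}" using t(1) K(1) by auto
  have "r \<le> L"
    using lipschitz_onD[OF \<sigma> tL u(1)] u tL by (auto simp: r_def dist_real_def)
  have "\<exists>s\<in>K. dist y (\<sigma> s) < c * r"
  proof (rule ccontr)
    assume far: "\<not> ?thesis"
    let ?N = "{s \<in> {0..L}. \<sigma> s \<notin> \<sigma> ` K \<and> \<sigma> s \<in> ball ?x (2 * r)}"
    have small: "c * r \<le> 1 / 4 * r" using c r by (intro mult_right_mono) auto
    have near_far: "\<sigma> s \<notin> \<sigma> ` K" "\<sigma> s \<in> ball ?x (2 * r)" if "s \<in> {0..L} \<inter> ball u (c * r)" for s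
    proof -
      have d: "dist y (\<sigma> s) < c * r"
        using lipschitz_onD[OF \<sigma> u(1), of s] that u by auto
      then show "\<sigma> s \<notin> \<sigma> ` K" using far by auto
      show "\<sigma> s \<in> ball ?x (2 * r)"
      proof -
        have "dist ?x (\<sigma> s) \<le> r + dist y (\<sigma> s)"
          using dist_triangle[of ?x "\<sigma> s" y] by (simp add: r_def)
        then have "dist ?x (\<sigma> s) < 2 * r" using d small r(1) by linarith
        then show ?thesis by simp
      qed
    qed
    have "0 < c * r" "c * r \<le> L" using c(1) r(1) \<open>r \<le> L\<close> small by (simp, linarith)
    then have "c * r \<le> measure lebesgue ({0..L} \<inter> ball u (c * r))"
      by (rule measure_ball_Int_interval_ge[OF u(1)])
    also have "\<dots> \<le> measure lebesgue ?N"
    proof (rule measure_mono_fmeasurable)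
      show "{0..L} \<inter> ball u (c * r) \<subseteq> ?N"
      proof
        fix s assume s: "s \<in> {0..L} \<inter> ball u (c * r)"
        then show "s \<in> ?N" using near_far[OF s] by blast
      qed
      show "{0..L} \<inter> ball u (c * r) \<in> sets lebesgue" by (intro sets.Int) auto
      show "?N \<in> lmeasurable"
      proof -
        have "compact (\<sigma> ` K)"
          by (intro compact_continuous_image K(3) continuous_on_subset[OF cont K(1)])
        then have "open (- (\<sigma> ` K) \<inter> ball ?x (2 * r))"
          by (intro open_Int open_Compl compact_imp_closed) auto
        then show ?thesis
          using lmeasurable_continuous_vimage_open[OF cont, of "- (\<sigma> ` K) \<inter> ball ?x (2 * r)"] by simp
      qed
    qed
    also have "\<dots> < c / 4 * (2 * r)" using \<epsilon>(5) r by (intro \<delta>2(2)) auto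
    finally show False using c(1) r(1) by simp
  qed
  then obtain s where s: "s \<in> K" "dist y (\<sigma> s) < c * r" by blast
  have sL: "s \<in> {0..L}" using s(1) K(1) by auto
  define d where "d = dist (\<sigma> s) ?x"
  have d: "r - c * r < d" "d < r + c * r"
    using s(2) dist_triangle[of ?x y "\<sigma> s"] dist_triangle[of ?x "\<sigma> s" y]
    by (auto simp: d_def r_def dist_commute)
  have "c * r \<le> 1 / 4 * r" using c r by (intro mult_right_mono) auto
  then have "0 < d" "d < 2 * r" using d r by linarith+
  then have "s \<noteq> t" by (auto simp: d_def)
  moreover have st: "\<bar>s - t\<bar> < 4 * \<epsilon>"
    using K(2)[OF s(1) t(1)] \<open>d < 2 * r\<close> r(2) by (simp add: d_def)
  moreover have "(1 - \<eta>) * \<bar>s - t\<bar> \<le> \<bar>h (\<sigma> s) - h ?x\<bar>"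
  proof -
    have sp: "(1 - c) * \<bar>s - t\<bar> \<le> d" using \<delta>1(2)[OF sL] st \<epsilon>(4) by (simp add: d_def)
    have hy: "\<bar>h y - h (\<sigma> s)\<bar> \<le> c * r"
      using lipschitz_onD[OF h, of y "\<sigma> s"] s(2) by (simp add: dist_real_def)
    have "(1 - c) * r \<le> (1 - \<epsilon>) * r" using \<epsilon>(2) r by (intro mult_right_mono) auto
    then have "(1 - c) * r \<le> \<bar>h ?x - h y\<bar>" using y(4) by (simp add: r_def)
    then have low: "(1 - 2 * c) * r \<le> \<bar>h (\<sigma> s) - h ?x\<bar>" using hy by (simp add: algebra_simps)
    have "(1 - \<eta>) * \<bar>s - t\<bar> \<le> (1 - 4 * c) * \<bar>s - t\<bar>" using c(3) by (intro mult_right_mono) auto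
    moreover have "(1 - 4 * c) * \<bar>s - t\<bar> \<le> (1 - 2 * c) * r"
    proof -
      have "(1 + c) * ((1 - 4 * c) * \<bar>s - t\<bar>) \<le> (1 - 2 * c) * ((1 - c) * \<bar>s - t\<bar>)"
      proof -
        have "(1 + c) * (1 - 4 * c) \<le> (1 - 2 * c) * (1 - c)" by (simp add: algebra_simps)
        then have "(1 + c) * (1 - 4 * c) * \<bar>s - t\<bar> \<le> (1 - 2 * c) * (1 - c) * \<bar>s - t\<bar>"
          by (intro mult_right_mono) auto
        then show ?thesis by (simp only: mult.assoc)
      qed
      also have "\<dots> \<le> (1 - 2 * c) * ((1 + c) * r)"
        using sp d(2) c by (intro mult_left_mono) (auto simp: algebra_simps)
      also have "\<dots> = (1 + c) * ((1 - 2 * c) * r)" by (simp add: algebra_simps)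
      finally show ?thesis using c(1) by (simp add: mult_le_cancel_left)
    qed
    ultimately show ?thesis using low by linarith
  qed
  ultimately show ?thesis using sL \<epsilon>(3) by (intro bexI[of _ s]) auto
qed

text \<open>
Almost every \<open>t\<close> satisfies the hypotheses of \<open>steep_along_curve\<close>, so that \<open>h \<circ> \<sigma>\<close>, and with it its
variation function, has upper slope at least \<open>1 - \<eta>\<close> there.  By \<open>total_increment_ge\<close> the variation of \<open>h \<circ> \<sigma>\<close>
is at least \<open>L\<close>, and \<open>unit_speed_ae\<close> applies to the real-valued curve \<open>h \<circ> \<sigma>\<close>: upper slopes have
turned into limits.
\<close>

lemma unit_speed_comp_of_steep:
  fixes \<sigma> :: "real \<Rightarrow> 'a::metric_space" and h :: "'a \<Rightarrow> real"
  assumes \<sigma>: "1-lipschitz_on {0..L} \<sigma>" and "0 \<le> L" and h: "1-lipschitz_on UNIV h"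
    and speed: "negligible {t \<in> {0..L}. \<not> unit_speed_at \<sigma> L t}"
    and steep: "negligible {t \<in> {0..L}. \<not> steep_at h (\<sigma> ` {0..L}) (\<sigma> t)}"
    and K: "\<forall>i. compact (K i) \<and> K i \<subseteq> {0..L}"
      "\<forall>i. \<forall>s\<in>K i. \<forall>t\<in>K i. \<bar>s - t\<bar> \<le> 2 * dist (\<sigma> s) (\<sigma> t)"
      "negligible ({0..L} - (\<Union>i::nat. K i))"
  shows "negligible {t \<in> {0..L}. \<not> unit_speed_at (h \<circ> \<sigma>) L t}"
proof -
  define f where "f = h \<circ> \<sigma>"
  have \<sigma>c: "continuous_on {0..L} \<sigma>" using \<sigma> by (rule lipschitz_on_continuous_on)
  have f_lip: "1-lipschitz_on {0..L} f"
  proof (rule lipschitz_onI)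
    fix s t assume "s \<in> {0..L}" "t \<in> {0..L}"
    then show "dist (f s) (f t) \<le> 1 * dist s t"
      using lipschitz_onD[OF \<sigma>, of s t] lipschitz_onD[OF h, of "\<sigma> s" "\<sigma> t"] by (simp add: f_def)
  qed simp
  let ?thin = "\<lambda>i t. thin_outside \<sigma> L (\<sigma> ` K i) (\<sigma> t)"
  define Bad where "Bad = {t \<in> {0..L}. \<not> unit_speed_at \<sigma> L t} \<union>
     {t \<in> {0..L}. \<not> steep_at h (\<sigma> ` {0..L}) (\<sigma> t)} \<union> ({0..L} - (\<Union>i. K i)) \<union>
     (\<Union>i. {t \<in> K i. \<sigma> t \<in> {x \<in> \<sigma> ` K i. \<not> thin_outside \<sigma> L (\<sigma> ` K i) x}})"
  have "negligible {t \<in> K i. \<sigma> t \<in> {x \<in> \<sigma> ` K i. \<not> thin_outside \<sigma> L (\<sigma> ` K i) x}}" for i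
  proof (rule negligible_vimage_of_null[where m = 2])
    have "compact (\<sigma> ` K i)"
      using K(1) by (intro compact_continuous_image continuous_on_subset[OF \<sigma>c]) auto
    then show "hausdorff1 {x \<in> \<sigma> ` K i. \<not> thin_outside \<sigma> L (\<sigma> ` K i) x} = 0"
      by (rule thin_outside_ae[OF \<sigma>c])
  qed (use K(2) in auto)
  then have Bad: "negligible Bad"
    unfolding Bad_def using speed steep K(3) by (intro negligible_Un negligible_countable_Union) auto
  have good: "\<exists>s\<in>{0..L}. s \<noteq> t \<and> \<bar>s - t\<bar> < \<delta> \<and> (1 - \<eta>) * \<bar>s - t\<bar> \<le> \<bar>f s - f t\<bar>"
    if t: "t \<in> {0..L}" "t \<notin> Bad" and "0 < \<eta>" "0 < \<delta>" for t \<eta> \<delta>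
  proof -
    obtain i where i: "t \<in> K i" using t by (auto simp: Bad_def)
    have "?thin i t" "unit_speed_at \<sigma> L t" "steep_at h (\<sigma> ` {0..L}) (\<sigma> t)"
      using t i by (auto simp: Bad_def)
    then show ?thesis
      unfolding f_def o_def using K(1,2) i \<open>0 < \<eta>\<close> \<open>0 < \<delta>\<close>
      by (intro steep_along_curve[OF \<sigma> h, of "K i"]) auto
  qed
  have fin: "variation f 0 L < top"
    using variation_lipschitz_le[OF f_lip \<open>0 \<le> L\<close>] by (auto intro: le_less_trans)
  define v where "v r = enn2real (variation f 0 r)" for r
  have v_ge: "\<bar>f s - f t\<bar> \<le> v t - v s" if "0 \<le> s" "s \<le> t" "t \<le> L" for s t
    using dist_le_variation_increment[OF fin that] by (simp add: v_def dist_real_def)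
  have v_mono: "mono_on {0..L} v"
  proof (rule mono_onI)
    fix s t assume "s \<in> {0..L}" "t \<in> {0..L}" "s \<le> t"
    then show "v s \<le> v t" using v_ge[of s t] by auto
  qed
  have v_abs: "\<bar>f s - f t\<bar> \<le> \<bar>v s - v t\<bar>" if "s \<in> {0..L}" "t \<in> {0..L}" for s t
    using v_ge[of s t] v_ge[of t s] that by (cases "s \<le> t") auto
  have le: "(1 - \<eta>) * L \<le> v L" if \<eta>: "0 < \<eta>" "\<eta> < 1" for \<eta>
  proof -
    have "(1 - \<eta>) * L \<le> v L - v 0"
    proof (rule total_increment_ge[OF v_mono \<open>0 \<le> L\<close>])
      show "negligible ({0..L} - ({0..L} - Bad))" by (rule negligible_subset[OF Bad]) auto
      fix t \<delta> :: real assume t: "t \<in> {0..L} - Bad" "t \<in> {0..L}" "0 < \<delta>"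
      then obtain s where s: "s \<in> {0..L}" "s \<noteq> t" "\<bar>s - t\<bar> < \<delta>" "(1 - \<eta>) * \<bar>s - t\<bar> \<le> \<bar>f s - f t\<bar>"
        using good[of t \<eta> \<delta>] \<eta>(1) by blast
      then show "\<exists>s\<in>{0..L}. s \<noteq> t \<and> \<bar>s - t\<bar> < \<delta> \<and> (1 - \<eta>) * \<bar>s - t\<bar> \<le> \<bar>v s - v t\<bar>"
        using v_abs[OF s(1) t(2)] by (intro bexI[of _ s]) auto
    qed (use \<eta> in simp)
    moreover have "0 \<le> v 0" by (simp add: v_def)
    ultimately show ?thesis by linarith
  qed
  have "L \<le> v L"
  proof (rule field_le_epsilon)
    fix e :: real assume "0 < e"
    define \<eta> where "\<eta> = min (1 / 2) (e / (L + 1))"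
    have L1: "0 < L + 1" using \<open>0 \<le> L\<close> by simp
    have \<eta>: "0 < \<eta>" "\<eta> < 1" "\<eta> \<le> e / (L + 1)" using \<open>0 < e\<close> L1 by (auto simp: \<eta>_def)
    have "\<eta> * (L + 1) \<le> e" using \<eta>(3) L1 by (simp only: pos_le_divide_eq)
    then have "\<eta> * L \<le> e" using \<eta>(1) by (simp add: algebra_simps)
    then show "L \<le> v L + e" using le[OF \<eta>(1,2)] by (simp add: algebra_simps)
  qed
  then have "ennreal L \<le> ennreal (v L)" by (rule ennreal_leI)
  also have "\<dots> = variation f 0 L" using fin by (simp add: v_def)
  finally show ?thesis
    using unit_speed_ae[OF f_lip \<open>0 \<le> L\<close>] by (simp add: f_def)
qed

section \<open>The Jacobian\<close>

text \<open>
The distance from \<open>x\<close> takes all values below \<open>r\<close> on \<open>\<Gamma> \<inter> ball x r\<close>.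
\<close>

lemma hausdorff1_connected_ball_ge:
  assumes "connected \<Gamma>" "x \<in> \<Gamma>" "y \<in> \<Gamma>" "r \<le> dist x y"
  shows "ennreal r \<le> hausdorff1 (\<Gamma> \<inter> ball x r)"
proof -
  have "ennreal (r - 0) \<le> hausdorff1 (\<Gamma> \<inter> ball x r)"
  proof (rule hausdorff1_ge_of_lipschitz_image)
    show "1-lipschitz_on UNIV (dist x)"
      by (rule lipschitz_on_dist)
    have conn: "connected (dist x ` \<Gamma>)"
      by (intro connected_continuous_image continuous_intros assms)
    show "{0..<r} \<subseteq> dist x ` (\<Gamma> \<inter> ball x r)"
    proof
      fix s assume s: "s \<in> {0..<r}"
      have "dist x x \<in> dist x ` \<Gamma>" "dist x y \<in> dist x ` \<Gamma>" using assms by auto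
      then have "{dist x x..dist x y} \<subseteq> dist x ` \<Gamma>"
        by (rule connected_contains_Icc[OF conn])
      moreover have "s \<in> {dist x x..dist x y}" using s assms(4) by simp
      ultimately have "s \<in> dist x ` \<Gamma>" by blast
      then show "s \<in> dist x ` (\<Gamma> \<inter> ball x r)" using s by auto
    qed
  qed
  then show ?thesis by simp
qed

text \<open>
By connectedness the denominator of the density is at least \<open>r\<close>, while it exceeds the numerator by
at most the measure of the part outside \<open>E\<close>, which is \<open>o(r)\<close>.
\<close>

lemma density_point_of_thin_outside:
  fixes \<sigma> :: "real \<Rightarrow> 'a::metric_space"
  assumes \<sigma>: "1-lipschitz_on {0..L} \<sigma>" and "0 < L" and E: "E \<subseteq> \<sigma> ` {0..L}" "closed E"
    and x: "x \<in> E" "thin_outside \<sigma> L E x" and y: "y \<in> \<sigma> ` {0..L}" "y \<noteq> x"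
  shows "density_point (\<sigma> ` {0..L}) E x"
proof -
  let ?\<Gamma> = "\<sigma> ` {0..L}"
  let ?a = "\<lambda>r. hausdorff1 (E \<inter> ?\<Gamma> \<inter> ball x r)" and ?b = "\<lambda>r. hausdorff1 (?\<Gamma> \<inter> ball x r)"
  have cont: "continuous_on {0..L} \<sigma>" using \<sigma> by (rule lipschitz_on_continuous_on)
  have conn: "connected ?\<Gamma>" by (intro connected_continuous_image cont) simp
  have fin: "?b r < top" for r
  proof -
    have "?b r \<le> hausdorff1 ?\<Gamma>" by (rule hausdorff1_mono) auto
    also have "\<dots> \<le> ennreal (6 * measure lebesgue {0..L})"
      by (rule hausdorff1_image_le[OF \<sigma> \<open>0 < L\<close>]) auto
    finally show ?thesis by (auto intro: le_less_trans)
  qed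
  have key: "eventually (\<lambda>r. ennreal (1 - 6 * c) \<le> ?a r / ?b r \<and> ?a r / ?b r \<le> 1) (at_right 0)" if c: "0 < c" for c
  proof -
    obtain \<delta> where \<delta>: "0 < \<delta>"
      "\<And>r. 0 < r \<Longrightarrow> r < \<delta> \<Longrightarrow> measure lebesgue {t \<in> {0..L}. \<sigma> t \<notin> E \<and> \<sigma> t \<in> ball x r} < c * r"
      using thin_outsideD[OF x(2) c] by blast
    have "eventually (\<lambda>r. r < min \<delta> (dist x y)) (at_right 0)"
      using \<delta>(1) y(2) by (intro order_tendstoD[OF tendsto_ident_at]) auto
    moreover have "eventually (\<lambda>r::real. 0 < r) (at_right 0)" by (rule eventually_at_right_less)
    ultimately show ?thesis
    proof eventually_elim
      case (elim r)
      let ?N = "{t \<in> {0..L}. \<sigma> t \<notin> E \<and> \<sigma> t \<in> ball x r}"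
      have N: "?N \<in> lmeasurable"
        using lmeasurable_continuous_vimage_open[OF cont, of "- E \<inter> ball x r"] E(2) by (simp add: open_Compl open_Int)
      have "?b r \<le> hausdorff1 ((E \<inter> ?\<Gamma> \<inter> ball x r) \<union> \<sigma> ` ?N)"
        by (rule hausdorff1_mono) auto
      also have "\<dots> \<le> ?a r + hausdorff1 (\<sigma> ` ?N)" by (rule hausdorff1_Un_le)
      also have "hausdorff1 (\<sigma> ` ?N) \<le> ennreal (6 * measure lebesgue ?N)"
        by (rule hausdorff1_image_le[OF \<sigma> \<open>0 < L\<close> N]) auto
      also have "\<dots> \<le> ennreal (6 * (c * r))"
        using \<delta>(2)[of r] elim by (intro ennreal_leI) auto
      finally have b_le: "?b r \<le> ?a r + ennreal (6 * (c * r))" by (simp add: add_left_mono)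
      have a_le: "?a r \<le> ?b r" by (rule hausdorff1_mono) auto
      have r_le: "ennreal r \<le> ?b r"
        using x(1) E(1) y(1) elim by (intro hausdorff1_connected_ball_ge[OF conn]) auto
      define a b where "a = enn2real (?a r)" and "b = enn2real (?b r)"
      have a: "?a r = ennreal a" "0 \<le> a" and b: "?b r = ennreal b" "0 \<le> b"
        using fin[of r] le_less_trans[OF a_le fin] by (auto simp: a_def b_def)
      have "r \<le> b" "a \<le> b" using r_le a_le a b by (auto simp: ennreal_le_iff)
      have "ennreal b \<le> ennreal (a + 6 * (c * r))"
        using b_le a b elim that by (simp add: ennreal_plus)
      then have "b \<le> a + 6 * (c * r)" using a elim that by (subst (asm) ennreal_le_iff) auto
      have "0 < b" using \<open>r \<le> b\<close> elim by simp
      have "6 * (c * r) \<le> 6 * c * b" using \<open>r \<le> b\<close> that by simp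
      then have "(1 - 6 * c) * b \<le> a" using \<open>b \<le> a + 6 * (c * r)\<close> by (simp add: algebra_simps)
      then have "1 - 6 * c \<le> a / b" using \<open>0 < b\<close> by (simp add: field_simps)
      moreover have "a / b \<le> 1" using \<open>a \<le> b\<close> \<open>0 < b\<close> by simp
      moreover have "?a r / ?b r = ennreal (a / b)"
        unfolding a(1) b(1) using a(2) \<open>0 < b\<close> by (rule divide_ennreal)
      ultimately show ?case by (auto intro: ennreal_leI simp: ennreal_le_1)
    qed
  qed
  show ?thesis
    unfolding density_point_def
  proof (rule order_tendstoI)
    fix z :: ennreal assume "z < 1"
    then obtain z' where z': "z = ennreal z'" "0 \<le> z'" "z' < 1"
      by (cases z) (auto simp: ennreal_less_one_iff)
    have "eventually (\<lambda>r. ennreal (1 - 6 * ((1 - z') / 12)) \<le> ?a r / ?b r \<and> ?a r / ?b r \<le> 1) (at_right 0)"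
      using z' by (intro key) auto
    then show "eventually (\<lambda>r. z < ?a r / ?b r) (at_right 0)"
    proof eventually_elim
      case (elim r)
      have "z < ennreal (1 - 6 * ((1 - z') / 12))"
        unfolding z'(1) using z' by (intro ennreal_lessI) (simp_all add: field_simps)
      then show ?case using elim by (auto intro: less_le_trans)
    qed
  next
    fix z :: ennreal assume "1 < z"
    have "eventually (\<lambda>r. ennreal (1 - 6 * 1) \<le> ?a r / ?b r \<and> ?a r / ?b r \<le> 1) (at_right 0)"
      by (rule key) simp
    then show "eventually (\<lambda>r. ?a r / ?b r < z) (at_right 0)"
      by eventually_elim (use \<open>1 < z\<close> in \<open>auto intro: le_less_trans\<close>)
  qed
qed

text \<open>
The witness for the parametrization is not \<open>\<sigma>\<close> but the inverse \<open>\<phi>\<close> of \<open>h\<close> on \<open>\<sigma> ` K\<close>.  Then \<open>h \<circ> \<phi>\<close> is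
the identity, with derivative \<open>1\<close>, and only the metric speed of \<open>\<phi>\<close> remains.  It is \<open>1\<close> because
\<open>\<bar>h (\<sigma> s) - h (\<sigma> t)\<bar> \<le> dist (\<sigma> s) (\<sigma> t) \<le> \<bar>s - t\<bar>\<close> and the quotient of the outer terms tends
to \<open>1\<close>.  This choice avoids differentiating \<open>h \<circ> \<sigma>\<close>, whose slopes are known only in absolute value.
\<close>

lemma has_jacobian_one:
  fixes \<sigma> :: "real \<Rightarrow> 'a::metric_space" and h :: "'a \<Rightarrow> real"
  assumes \<sigma>: "1-lipschitz_on {0..L} \<sigma>" and "0 < L" and h: "1-lipschitz_on UNIV h"
    and K: "compact K" "K \<subseteq> {0..L}"
    and expand: "\<And>s t. s \<in> K \<Longrightarrow> t \<in> K \<Longrightarrow> \<bar>s - t\<bar> \<le> 2 * \<bar>h (\<sigma> s) - h (\<sigma> t)\<bar>"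
    and t: "t \<in> K" "unit_speed_at (h \<circ> \<sigma>) L t" "thin_outside \<sigma> L (\<sigma> ` K) (\<sigma> t)"
    and y: "y \<in> \<sigma> ` {0..L}" "y \<noteq> \<sigma> t"
  shows "has_jacobian (\<sigma> ` {0..L}) h (\<sigma> t) 1"
proof -
  define f where "f = h \<circ> \<sigma>"
  have h_le: "\<bar>f s - f u\<bar> \<le> dist (\<sigma> s) (\<sigma> u)" for s u
    using lipschitz_onD[OF h, of "\<sigma> s" "\<sigma> u"] by (simp add: f_def dist_real_def)
  have \<sigma>_le: "dist (\<sigma> s) (\<sigma> u) \<le> \<bar>s - u\<bar>" if "s \<in> K" "u \<in> K" for s u
    using lipschitz_onD[OF \<sigma> subsetD[OF K(2) that(1)] subsetD[OF K(2) that(2)]] by (simp add: dist_real_def)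
  have f_ge: "\<bar>s - u\<bar> \<le> 2 * \<bar>f s - f u\<bar>" if "s \<in> K" "u \<in> K" for s u
    using expand[OF that] by (simp add: f_def)
  have inj: "inj_on f K" using f_ge by (fastforce intro: inj_onI)
  define \<phi> where "\<phi> = \<sigma> \<circ> inv_into K f"
  have \<phi>: "\<phi> (f s) = \<sigma> s" if "s \<in> K" for s using that inj by (simp add: \<phi>_def)
  let ?E = "\<sigma> ` K" and ?S = "f ` K"
  have "compact ?E"
    by (intro compact_continuous_image K(1) continuous_on_subset[OF lipschitz_on_continuous_on[OF \<sigma>] K(2)])
  then have "density_point (\<sigma> ` {0..L}) ?E (\<sigma> t)"
    using K(2) t y by (intro density_point_of_thin_outside[OF \<sigma> \<open>0 < L\<close>]) (auto intro: compact_imp_closed)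
  moreover have "bilipschitz_on ?S \<phi>"
    unfolding bilipschitz_on_def
  proof (intro exI[of _ 2] conjI ballI)
    fix p q assume "p \<in> ?S" "q \<in> ?S"
    then obtain s u where su: "s \<in> K" "u \<in> K" "p = f s" "q = f u" by auto
    show "dist p q / 2 \<le> dist (\<phi> p) (\<phi> q)"
      using h_le[of s u] su zero_le_dist[of p q] by (simp add: \<phi> dist_real_def)
    show "dist (\<phi> p) (\<phi> q) \<le> 2 * dist p q"
      using \<sigma>_le[of s u] f_ge[of s u] su by (simp add: \<phi> dist_real_def)
  qed simp
  moreover have "\<phi> ` ?S = ?E" using \<phi> by (force simp: image_image)
  moreover have "has_metric_speed \<phi> 1 (f t) ?S"
    unfolding has_metric_speed_def
  proof (rule tendstoI)
    fix e :: real assume "0 < e"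
    \<comment> \<open>This \<open>\<eta>\<close> ensures \<open>1 / (1 - \<eta>) < 1 + e\<close>.\<close>
    define \<eta> where "\<eta> = e / (2 * (1 + e))"
    have "\<eta> * (2 * (1 + e)) = e"
      using nonzero_divide_eq_eq[of "2 * (1 + e)" e \<eta>] \<open>0 < e\<close> by (simp add: \<eta>_def)
    then have "\<eta> * (1 + e) = e / 2" by (simp add: algebra_simps)
    moreover have "0 < \<eta>" "\<eta> < 1" using \<open>0 < e\<close> by (simp_all add: \<eta>_def pos_divide_less_eq)
    ultimately have \<eta>: "0 < \<eta>" "\<eta> < 1" "\<eta> * (1 + e) < e" using \<open>0 < e\<close> by simp_all
    obtain \<delta> where \<delta>: "0 < \<delta>" "\<And>s. s \<in> {0..L} \<Longrightarrow> \<bar>s - t\<bar> < \<delta> \<Longrightarrow> (1 - \<eta>) * \<bar>s - t\<bar> \<le> dist (f s) (f t)"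
      using t(2) \<eta>(1) unfolding unit_speed_at_def f_def by metis
    show "eventually (\<lambda>p. dist (dist (\<phi> p) (\<phi> (f t)) / \<bar>p - f t\<bar>) 1 < e) (at (f t) within ?S)"
      unfolding eventually_at
    proof (intro exI[of _ "\<delta> / 2"] conjI ballI impI)
      fix p assume p: "p \<in> ?S" "p \<noteq> f t \<and> dist p (f t) < \<delta> / 2"
      then obtain s where s: "s \<in> K" "p = f s" by auto
      have "\<bar>s - t\<bar> < \<delta>" using f_ge[OF s(1) t(1)] p s by (simp add: dist_real_def)
      then have "(1 - \<eta>) * \<bar>s - t\<bar> \<le> \<bar>p - f t\<bar>"
        using \<delta>(2)[of s] s K(2) by (auto simp: dist_real_def)
      moreover have "(1 - \<eta>) * dist (\<sigma> s) (\<sigma> t) \<le> (1 - \<eta>) * \<bar>s - t\<bar>"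
        using \<eta> \<sigma>_le[OF s(1) t(1)] by (intro mult_left_mono) auto
      ultimately have up: "(1 - \<eta>) * dist (\<sigma> s) (\<sigma> t) \<le> \<bar>p - f t\<bar>" by linarith
      have pos: "0 < \<bar>p - f t\<bar>" using p by simp
      have "1 \<le> dist (\<sigma> s) (\<sigma> t) / \<bar>p - f t\<bar>"
        using h_le[of s t] s pos by (simp add: field_simps)
      moreover have "dist (\<sigma> s) (\<sigma> t) / \<bar>p - f t\<bar> < 1 + e"
      proof -
        have "1 < (1 - \<eta>) * (1 + e)" using \<eta> by (simp add: algebra_simps)
        then have "1 / (1 - \<eta>) < 1 + e" using \<eta> by (simp add: field_simps)
        moreover have "dist (\<sigma> s) (\<sigma> t) / \<bar>p - f t\<bar> \<le> 1 / (1 - \<eta>)"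
          using up pos \<eta> by (simp add: field_simps)
        ultimately show ?thesis by linarith
      qed
      ultimately show "dist (dist (\<phi> p) (\<phi> (f t)) / \<bar>p - f t\<bar>) 1 < e"
        using \<phi>[OF s(1)] \<phi>[OF t(1)] s(2) by (simp add: dist_real_def)
    qed (use \<delta>(1) in simp)
  qed
  moreover have "((h \<circ> \<phi>) has_real_derivative 1) (at (f t) within ?S)"
  proof (rule has_field_derivative_transform_within[OF _ zero_less_one])
    show "((\<lambda>p. p) has_real_derivative 1) (at (f t) within ?S)" by (rule DERIV_ident)
    show "f t \<in> ?S" using t(1) by simp
    show "p = (h \<circ> \<phi>) p" if "p \<in> ?S" for p using that \<phi> by (auto simp: f_def)
  qed
  ultimately show ?thesis
    unfolding has_jacobian_def using t(1) \<phi>[OF t(1)] K(2)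
    by (intro exI[of _ ?E] exI[of _ ?S] exI[of _ \<phi>] exI[of _ "f t"] exI[of _ 1] exI[of _ 1]) auto
qed

lemma jacobian_one_ae:
  fixes \<sigma> :: "real \<Rightarrow> 'a::metric_space" and h :: "'a \<Rightarrow> real"
  assumes \<sigma>: "1-lipschitz_on {0..L} \<sigma>" and "0 < L" and h: "1-lipschitz_on UNIV h"
    and speed: "negligible {t \<in> {0..L}. \<not> unit_speed_at (h \<circ> \<sigma>) L t}"
  shows "hausdorff1 {x \<in> \<sigma> ` {0..L}. \<not> has_jacobian (\<sigma> ` {0..L}) h x 1} = 0"
proof -
  define f where "f = h \<circ> \<sigma>"
  have \<sigma>c: "continuous_on {0..L} \<sigma>" using \<sigma> by (rule lipschitz_on_continuous_on)
  have f_cont: "continuous_on {0..L} f"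
    unfolding f_def
    by (intro continuous_on_compose \<sigma>c continuous_on_subset[OF lipschitz_on_continuous_on[OF h]]) auto
  have half: "0 < (1 / 2 :: real)" by simp
  obtain K :: "nat \<Rightarrow> real set" where K: "\<forall>i. compact (K i) \<and> K i \<subseteq> {0..L}"
      "\<forall>i. \<forall>s\<in>K i. \<forall>t\<in>K i. (1 - 1 / 2) * \<bar>s - t\<bar> \<le> dist (f s) (f t)"
      "negligible ({0..L} - (\<Union>i. K i))"
    by (rule expanding_pieces[OF f_cont half speed[folded f_def]])
  define N where "N = {t \<in> {0..L}. \<not> unit_speed_at f L t} \<union> ({0..L} - (\<Union>i. K i))"
  define A where "A i = {x \<in> \<sigma> ` K i. \<not> thin_outside \<sigma> L (\<sigma> ` K i) x}" for i
  have "hausdorff1 (\<sigma> ` N) = 0"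
    using speed K(3) by (intro hausdorff1_negligible_image[OF \<sigma> \<open>0 < L\<close>]) (auto simp: N_def f_def)
  moreover have "hausdorff1 (A i) = 0" for i
  proof -
    have "compact (\<sigma> ` K i)"
      using K(1) by (intro compact_continuous_image continuous_on_subset[OF \<sigma>c]) auto
    then show ?thesis unfolding A_def by (rule thin_outside_ae[OF \<sigma>c])
  qed
  then have "hausdorff1 (\<Union>i. A i) = 0" by (rule hausdorff1_null_UNION)
  ultimately have null: "hausdorff1 (\<sigma> ` N \<union> (\<Union>i. A i)) = 0"
    using hausdorff1_Un_le[of "\<sigma> ` N" "\<Union>i. A i"] by simp
  moreover have "{x \<in> \<sigma> ` {0..L}. \<not> has_jacobian (\<sigma> ` {0..L}) h x 1} \<subseteq> \<sigma> ` N \<union> (\<Union>i. A i)"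
  proof
    fix x assume x: "x \<in> {x \<in> \<sigma> ` {0..L}. \<not> has_jacobian (\<sigma> ` {0..L}) h x 1}"
    then obtain t where t: "t \<in> {0..L}" "x = \<sigma> t" by auto
    show "x \<in> \<sigma> ` N \<union> (\<Union>i. A i)"
    proof (rule ccontr)
      assume "x \<notin> \<sigma> ` N \<union> (\<Union>i. A i)"
      then have nN: "t \<notin> N" and nA: "\<And>i. \<sigma> t \<notin> A i" using t by auto
      obtain i where i: "t \<in> K i" using nN t(1) by (auto simp: N_def)
      have us: "unit_speed_at f L t" using nN t(1) by (auto simp: N_def)
      then obtain \<delta> where \<delta>: "0 < \<delta>" "\<forall>s\<in>{0..L}. \<bar>s - t\<bar> < \<delta> \<longrightarrow> (1 - 1 / 2) * \<bar>s - t\<bar> \<le> dist (f s) (f t)"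
        using half unfolding unit_speed_at_def by blast
      \<comment> \<open>A second point of the curve exists because \<open>h \<circ> \<sigma>\<close> moves near \<open>t\<close>.\<close>
      define s where "s = (if t + min (\<delta> / 2) (L / 2) \<le> L then t + min (\<delta> / 2) (L / 2) else t - min (\<delta> / 2) (L / 2))"
      have s: "s \<in> {0..L}" "s \<noteq> t" "\<bar>s - t\<bar> < \<delta>"
        using \<delta>(1) \<open>0 < L\<close> t(1) by (auto simp: s_def min_def split: if_splits)
      then have "(1 - 1 / 2) * \<bar>s - t\<bar> \<le> dist (f s) (f t)" using \<delta>(2) by blast
      then have "\<sigma> s \<noteq> \<sigma> t" using s(2) by (auto simp: f_def)
      have "has_jacobian (\<sigma> ` {0..L}) h (\<sigma> t) 1"
      proof (rule has_jacobian_one[OF \<sigma> \<open>0 < L\<close> h, of "K i"])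
        show "\<bar>p - q\<bar> \<le> 2 * \<bar>h (\<sigma> p) - h (\<sigma> q)\<bar>" if "p \<in> K i" "q \<in> K i" for p q
        proof -
          have "(1 - 1 / 2) * \<bar>p - q\<bar> \<le> dist (f p) (f q)" using K(2) that by blast
          then show ?thesis by (simp add: f_def dist_real_def)
        qed
        show "thin_outside \<sigma> L (\<sigma> ` K i) (\<sigma> t)" using nA[of i] i by (auto simp: A_def)
        show "\<sigma> s \<in> \<sigma> ` {0..L}" "\<sigma> s \<noteq> \<sigma> t" using s(1) \<open>\<sigma> s \<noteq> \<sigma> t\<close> by auto
      qed (use K(1) i us in \<open>auto simp: f_def\<close>)
      then show False using x t(2) by simp
    qed
  qed
  ultimately show ?thesis by (rule hausdorff1_null_subset)
qed

section \<open>Comparison of the variations\<close>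

text \<open>
Here the exact constant \<open>B\<close> matters, in contrast to \<open>hausdorff1_image_le\<close>.  Cover \<open>C\<close> by intervals of
nearly the same total length and enclose their images in intervals.
\<close>

lemma lipschitz_image_outer_measure:
  fixes k :: "real \<Rightarrow> real"
  assumes C: "C \<in> lmeasurable" "bounded C" and "0 \<le> B"
    and k: "\<And>s t. s \<in> C \<Longrightarrow> t \<in> C \<Longrightarrow> \<bar>k s - k t\<bar> \<le> B * \<bar>s - t\<bar>" and "0 < e"
  obtains T where "k ` C \<subseteq> T" "T \<in> lmeasurable" "measure lebesgue T \<le> B * measure lebesgue C + e"
proof -
  obtain a b where ab: "C \<subseteq> cbox a b" using C(2) by (meson bounded_subset_cbox_symmetric)
  define e' where "e' = e / (B + 1)"
  have e': "0 < e'" "B * e' \<le> e" using \<open>0 < e\<close> \<open>0 \<le> B\<close> by (auto simp: e'_def field_simps)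
  obtain \<D> where \<D>: "countable \<D>" "\<And>I. I \<in> \<D> \<Longrightarrow> I \<subseteq> cbox a b \<and> I \<noteq> {} \<and> (\<exists>c d. I = cbox c d)"
     "pairwise (\<lambda>A B. interior A \<inter> interior B = {}) \<D>" "C \<subseteq> \<Union>\<D>" "\<Union>\<D> \<in> lmeasurable"
     "measure lebesgue (\<Union>\<D>) \<le> measure lebesgue C + e'"
    using measurable_outer_intervals_bounded[OF C(1) ab e'(1)] by metis
  have cbox: "I \<in> lmeasurable" "convex I" if "I \<in> \<D>" for I
    using \<D>(2)[OF that] by auto
  have "\<exists>T. k ` (C \<inter> I) \<subseteq> T \<and> compact T \<and> measure lebesgue T \<le> B * measure lebesgue I" if I: "I \<in> \<D>" for I
  proof -
    obtain p q where pq: "I = {p..q}" "p \<le> q" using \<D>(2)[OF I] by (auto simp: cbox_interval)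
    have "ediameter (k ` (C \<inter> I)) \<le> ennreal (B * (q - p))"
    proof (rule ediameter_leI, rule ennreal_leI)
      fix x y assume "x \<in> k ` (C \<inter> I)" "y \<in> k ` (C \<inter> I)"
      then obtain s t where st: "s \<in> C" "t \<in> C" "s \<in> {p..q}" "t \<in> {p..q}" "x = k s" "y = k t" using pq by auto
      have "\<bar>x - y\<bar> \<le> B * \<bar>s - t\<bar>" using k st by simp
      also have "\<dots> \<le> B * (q - p)" using st \<open>0 \<le> B\<close> by (intro mult_left_mono) auto
      finally show "dist x y \<le> B * (q - p)" by (simp add: dist_real_def)
    qed
    moreover from this have "ediameter (k ` (C \<inter> I)) < top" by (rule le_less_trans) simp
    then obtain T where T: "k ` (C \<inter> I) \<subseteq> T" "compact T" "emeasure lborel T \<le> ediameter (k ` (C \<inter> I))"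
      by (rule enclosing_interval)
    ultimately have le: "emeasure lborel T \<le> ennreal (B * (q - p))" by (meson order_trans)
    have "measure lebesgue T \<le> B * (q - p)"
      using le borel_compact[OF T(2)] pq \<open>0 \<le> B\<close>
      by (simp add: measure_def) (intro enn2real_leI mult_nonneg_nonneg; simp)
    then show ?thesis using T pq by auto
  qed
  then obtain T where T: "\<And>I. I \<in> \<D> \<Longrightarrow> k ` (C \<inter> I) \<subseteq> T I" "\<And>I. I \<in> \<D> \<Longrightarrow> compact (T I)"
     "\<And>I. I \<in> \<D> \<Longrightarrow> measure lebesgue (T I) \<le> B * measure lebesgue I"
    by metis
  have bound: "measure lebesgue (\<Union>I\<in>F. T I) \<le> B * measure lebesgue C + e" if F: "F \<subseteq> \<D>" "finite F" for F
  proof -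
    have "measure lebesgue (\<Union>I\<in>F. T I) \<le> (\<Sum>I\<in>F. measure lebesgue (T I))"
      using F T(2) by (intro measure_UNION_le) (auto intro: fmeasurableD lmeasurable_compact)
    also have "\<dots> \<le> (\<Sum>I\<in>F. B * measure lebesgue I)"
      using F T(3) by (intro sum_mono) auto
    also have "\<dots> = B * (\<Sum>I\<in>F. measure lebesgue I)" by (simp add: sum_distrib_left)
    also have "(\<Sum>I\<in>F. measure lebesgue I) = measure lebesgue (\<Union>F)"
    proof (rule measure_negligible_finite_Union[symmetric])
      show "pairwise (\<lambda>S T. negligible (S \<inter> T)) F"
      proof (rule pairwiseI)
        fix S T assume "S \<in> F" "T \<in> F" "S \<noteq> T"
        then have "S \<in> \<D>" "T \<in> \<D>" "interior S \<inter> interior T = {}"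
          using F \<D>(3) by (auto simp: pairwise_def)
        then show "negligible (S \<inter> T)"
          using cbox by (subst negligible_convex_interior) (auto simp: interior_Int intro: convex_Int)
      qed
    qed (use F cbox in auto)
    also have "B * measure lebesgue (\<Union>F) \<le> B * measure lebesgue (\<Union>\<D>)"
      using F \<D>(5) cbox \<open>0 \<le> B\<close>
      by (intro mult_left_mono measure_mono_fmeasurable) (auto intro!: sets.finite_Union fmeasurableD)
    also have "\<dots> \<le> B * (measure lebesgue C + e')" using \<D>(6) \<open>0 \<le> B\<close> by (rule mult_left_mono)
    also have "\<dots> \<le> B * measure lebesgue C + e" using e'(2) by (simp add: algebra_simps)
    finally show ?thesis .
  qed
  have Tm: "T I \<in> lmeasurable" if "I \<in> \<D>" for I using T(2)[OF that] by (rule lmeasurable_compact)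
  show thesis
  proof (rule that[of "\<Union>I\<in>\<D>. T I"])
    show "(\<Union>I\<in>\<D>. T I) \<in> lmeasurable" by (rule fmeasurable_UN_bound[OF \<D>(1) Tm bound])
    show "measure lebesgue (\<Union>I\<in>\<D>. T I) \<le> B * measure lebesgue C + e"
      by (rule measure_UN_bound[OF \<D>(1) Tm bound])
    show "k ` C \<subseteq> (\<Union>I\<in>\<D>. T I)"
    proof
      fix y assume "y \<in> k ` C"
      then obtain t where t: "t \<in> C" "y = k t" by auto
      then obtain I where I: "I \<in> \<D>" "t \<in> I" using \<D>(4) by auto
      then have "y \<in> T I" using T(1)[OF I(1)] t by auto
      then show "y \<in> (\<Union>I\<in>\<D>. T I)" using I(1) by auto
    qed
  qed
qed

lemma sum_variation_le:
  fixes p :: "nat \<Rightarrow> real"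
  assumes "\<And>i. i < n \<Longrightarrow> p i \<le> p (Suc i)"
  shows "(\<Sum>i<n. variation g (p i) (p (Suc i))) \<le> variation g (p 0) (p n)"
  using assms
proof (induction n)
  case (Suc n)
  have le: "p 0 \<le> p m" if "m \<le> Suc n" for m
    using that
  proof (induction m)
    case (Suc m)
    then show ?case using Suc.prems \<open>\<And>i. i < Suc n \<Longrightarrow> p i \<le> p (Suc i)\<close>[of m] by simp
  qed simp
  have "(\<Sum>i<Suc n. variation g (p i) (p (Suc i))) \<le> variation g (p 0) (p n) + variation g (p n) (p (Suc n))"
    using Suc by (auto intro: add_mono)
  also have "\<dots> \<le> variation g (p 0) (p (Suc n))"
    using le[of n] Suc.prems by (intro variation_superadditive) auto
  finally show ?case .
qed simp

lemma emeasure_image_le_variation: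
  fixes f :: "real \<Rightarrow> real"
  assumes "compact C" "C \<subseteq> {p..q}" "continuous_on C f" "p \<le> q"
  shows "emeasure lborel (f ` C) \<le> variation f p q"
proof (cases "variation f p q < top")
  case True
  have "ediameter (f ` C) \<le> variation f p q"
  proof (rule ediameter_leI)
    have *: "ennreal (dist (f s) (f t)) \<le> variation f p q" if "s \<in> C" "t \<in> C" "s \<le> t" for s t
    proof -
      have "ennreal (dist (f s) (f t)) \<le> variation f s t" using that by (intro dist_le_variation)
      also have "\<dots> \<le> variation f p q" using that assms(2) by (intro variation_mono) auto
      finally show ?thesis .
    qed
    fix x y assume "x \<in> f ` C" "y \<in> f ` C"
    then obtain s t where "s \<in> C" "t \<in> C" "x = f s" "y = f t" by auto
    then show "ennreal (dist x y) \<le> variation f p q"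
      using *[of s t] *[of t s] by (cases "s \<le> t") (auto simp: dist_commute)
  qed
  moreover from this have "ediameter (f ` C) < top" using True by (rule le_less_trans)
  then obtain I where I: "f ` C \<subseteq> I" "compact I" "emeasure lborel I \<le> ediameter (f ` C)"
    by (rule enclosing_interval)
  moreover have "emeasure lborel (f ` C) \<le> emeasure lborel I"
    using I borel_compact by (intro emeasure_mono) auto
  ultimately show ?thesis by (meson order_trans)
qed (simp flip: less_top)

lemma finite_disjoint_compacts_apart:
  fixes C :: "nat \<Rightarrow> real set"
  assumes "\<And>i. i < m \<Longrightarrow> compact (C i)" "\<And>i j. i < m \<Longrightarrow> j < m \<Longrightarrow> i \<noteq> j \<Longrightarrow> C i \<inter> C j = {}"
  obtains \<kappa> where "0 < \<kappa>" "\<And>i j s t. i < m \<Longrightarrow> j < m \<Longrightarrow> i \<noteq> j \<Longrightarrow> s \<in> C i \<Longrightarrow> t \<in> C j \<Longrightarrow> \<kappa> \<le> dist s t"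
proof -
  have "\<exists>d>0. \<forall>s\<in>C i. \<forall>t\<in>C j. d \<le> dist s t" if "i < m" "j < m" "i \<noteq> j" for i j
    using separate_compact_closed[of "C i" "C j"] assms that by (auto intro: compact_imp_closed)
  then obtain d where d: "\<And>i j. i < m \<Longrightarrow> j < m \<Longrightarrow> i \<noteq> j \<Longrightarrow> 0 < d i j"
     "\<And>i j s t. i < m \<Longrightarrow> j < m \<Longrightarrow> i \<noteq> j \<Longrightarrow> s \<in> C i \<Longrightarrow> t \<in> C j \<Longrightarrow> d i j \<le> dist s t"
    by metis
  let ?P = "{(i, j). i < m \<and> j < m \<and> i \<noteq> j}"
  let ?D = "insert 1 ((\<lambda>(i, j). d i j) ` ?P)"
  have "finite ?P" by (rule finite_subset[of _ "{..<m} \<times> {..<m}"]) auto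
  then have fin: "finite ?D" by simp
  show thesis
  proof (rule that[of "Min ?D"])
    show "0 < Min ?D" using fin d(1) by (subst Min_gr_iff) auto
    fix i j s t assume ij: "i < m" "j < m" "i \<noteq> j" "s \<in> C i" "t \<in> C j"
    have "Min ?D \<le> d i j" using fin ij by (intro Min_le) force+
    then show "Min ?D \<le> dist s t" using d(2)[OF ij] by linarith
  qed
qed

text \<open>
A value is counted once for each \<open>C i\<close> on which it is attained, as in Banach's indicatrix formula.  Cut
\<open>{c..d}\<close> into intervals so short that each meets at most one \<open>C i\<close>; the image of an interval is no longer
than the variation on it.
\<close>

lemma sum_measure_images_le_variation:
  fixes f :: "real \<Rightarrow> real" and C :: "nat \<Rightarrow> real set"
  assumes f: "continuous_on {c..d} f" and "c \<le> d"
    and C: "\<And>i. i < m \<Longrightarrow> compact (C i)" "\<And>i. i < m \<Longrightarrow> C i \<subseteq> {c..d}"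
      "\<And>i j. i < m \<Longrightarrow> j < m \<Longrightarrow> i \<noteq> j \<Longrightarrow> C i \<inter> C j = {}"
  shows "(\<Sum>i<m. emeasure lborel (f ` C i)) \<le> variation f c d"
proof -
  obtain \<kappa> where \<kappa>: "0 < \<kappa>" "\<And>i j s t. i < m \<Longrightarrow> j < m \<Longrightarrow> i \<noteq> j \<Longrightarrow> s \<in> C i \<Longrightarrow> t \<in> C j \<Longrightarrow> \<kappa> \<le> dist s t"
    using finite_disjoint_compacts_apart[of m C] C(1,3) by metis
  obtain N where N: "(d - c) / \<kappa> < real N" using reals_Archimedean2 by blast
  define n where "n = Suc N"
  have n: "0 < n" "(d - c) / real n < \<kappa>"
  proof -
    have "(d - c) / \<kappa> < real n" using N by (simp add: n_def)
    then have "d - c < real n * \<kappa>" using \<kappa>(1) by (simp add: field_simps)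
    moreover show "0 < n" by (simp add: n_def)
    ultimately show "(d - c) / real n < \<kappa>" by (simp add: field_simps)
  qed
  define p where "p k = c + real k * ((d - c) / real n)" for k
  have p_step: "p (Suc k) = p k + (d - c) / real n" for k
    unfolding p_def of_nat_Suc distrib_right by simp
  have w0: "0 \<le> (d - c) / real n" using \<open>c \<le> d\<close> by simp
  have p0: "p 0 = c" and pn: "p n = d" using n(1) by (simp_all add: p_def)
  define J where "J k = {p k..p (Suc k)}" for k
  have cover: "\<exists>k<n. t \<in> J k" if "t \<in> {c..d}" for t
  proof -
    have "\<exists>k<n. t \<in> J k" if "c \<le> t" "t \<le> p n" "0 < n" for n
      using that
    proof (induction n)
      case (Suc n)
      show ?case
      proof (cases "t \<le> p n \<and> 0 < n")
        case True
        then show ?thesis using Suc by (meson less_SucI)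
      next
        case False
        then have "p n \<le> t" using Suc.prems p0 by (cases n) auto
        then show ?thesis using Suc.prems by (intro exI[of _ n]) (auto simp: J_def)
      qed
    qed simp
    then show ?thesis using that pn n(1) by auto
  qed
  have piece: "(\<Sum>i<m. emeasure lborel (f ` (C i \<inter> J k))) \<le> variation f (p k) (p (Suc k))" for k
  proof -
    have pk: "p k \<le> p (Suc k)" using w0 by (simp add: p_step)
    have one: "emeasure lborel (f ` (C i \<inter> J k)) \<le> variation f (p k) (p (Suc k))" if "i < m" for i
    proof (rule emeasure_image_le_variation)
      show "compact (C i \<inter> J k)" unfolding J_def using C(1)[OF that] by (intro compact_Int_closed) auto
      show "continuous_on (C i \<inter> J k) f" using C(2)[OF that] by (intro continuous_on_subset[OF f]) auto
    qed (auto simp: J_def pk)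
    show ?thesis
    proof (cases "\<exists>i<m. C i \<inter> J k \<noteq> {}")
      case True
      then obtain i where i: "i < m" "C i \<inter> J k \<noteq> {}" by blast
      have "C j \<inter> J k = {}" if "j < m" "j \<noteq> i" for j
      proof (rule ccontr)
        assume "C j \<inter> J k \<noteq> {}"
        then obtain s t where st: "s \<in> C i" "t \<in> C j" "s \<in> J k" "t \<in> J k" using i(2) by blast
        have "\<bar>s - t\<bar> \<le> (d - c) / real n" using st(3,4) by (auto simp: J_def p_step abs_le_iff)
        moreover have "\<kappa> \<le> \<bar>s - t\<bar>" using \<kappa>(2)[of i j s t] st i that by (simp add: dist_real_def)
        ultimately show False using n(2) by linarith
      qed
      then have "(\<Sum>j<m. emeasure lborel (f ` (C j \<inter> J k))) = (\<Sum>j\<in>{i}. emeasure lborel (f ` (C j \<inter> J k)))"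
        using i(1) by (intro sum.mono_neutral_right) auto
      then show ?thesis using one[OF i(1)] by simp
    next
      case False
      then have "(\<Sum>i<m. emeasure lborel (f ` (C i \<inter> J k))) = 0" by (intro sum.neutral) auto
      then show ?thesis by simp
    qed
  qed
  have meas: "f ` (C i \<inter> J k) \<in> sets lborel" if "i < m" for i k
  proof -
    have "compact (C i \<inter> J k)" unfolding J_def using C(1)[OF that] by (intro compact_Int_closed) auto
    moreover have "continuous_on (C i \<inter> J k) f" using C(2)[OF that] by (intro continuous_on_subset[OF f]) auto
    ultimately show ?thesis by (auto intro: borel_compact compact_continuous_image)
  qed
  have "(\<Sum>i<m. emeasure lborel (f ` C i)) \<le> (\<Sum>i<m. \<Sum>k<n. emeasure lborel (f ` (C i \<inter> J k)))"
  proof (rule sum_mono)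
    fix i assume "i \<in> {..<m}"
    then have i: "i < m" by simp
    have "f ` C i \<subseteq> (\<Union>k<n. f ` (C i \<inter> J k))"
    proof
      fix y assume "y \<in> f ` C i"
      then obtain t where t: "t \<in> C i" "y = f t" by auto
      then have "t \<in> {c..d}" using C(2)[OF i] by blast
      then obtain k where "k < n" "t \<in> J k" using cover by blast
      then show "y \<in> (\<Union>k<n. f ` (C i \<inter> J k))" using t by auto
    qed
    then have "emeasure lborel (f ` C i) \<le> emeasure lborel (\<Union>k<n. f ` (C i \<inter> J k))"
      using meas[OF i] by (intro emeasure_mono sets.finite_UN) auto
    also have "\<dots> \<le> (\<Sum>k<n. emeasure lborel (f ` (C i \<inter> J k)))"
      using meas[OF i] by (intro emeasure_subadditive_finite) auto
    finally show "emeasure lborel (f ` C i) \<le> (\<Sum>k<n. emeasure lborel (f ` (C i \<inter> J k)))" .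
  qed
  also have "\<dots> = (\<Sum>k<n. \<Sum>i<m. emeasure lborel (f ` (C i \<inter> J k)))" by (rule sum.swap)
  also have "\<dots> \<le> (\<Sum>k<n. variation f (p k) (p (Suc k)))" by (intro sum_mono piece)
  also have "\<dots> \<le> variation f (p 0) (p n)" by (rule sum_variation_le) (simp add: p_step w0)
  finally show ?thesis by (simp add: p0 pn)
qed

text \<open>
Remove from the \<open>i\<close>-th piece all times at which \<open>\<sigma>\<close> returns to the images of earlier pieces, and shrink the
rest to a compact set.  Points of the curve that are lost in this way are images of a set \<open>R\<close> of small
measure: a point covered by some piece is attained by the first such piece at a time that is not removed.
\<close>

lemma disjoint_compact_pieces:
  fixes \<sigma> :: "real \<Rightarrow> 'a::metric_space" and K :: "nat \<Rightarrow> real set"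
  assumes \<sigma>: "continuous_on {0..L} \<sigma>"
    and K: "\<And>i. compact (K i)" "\<And>i. K i \<subseteq> {0..L}" "negligible ({0..L} - (\<Union>i. K i))" and "0 < \<epsilon>"
  obtains m C R where "\<forall>i. compact (C i) \<and> C i \<subseteq> K i"
    "\<forall>i j. i \<noteq> j \<longrightarrow> \<sigma> ` C i \<inter> \<sigma> ` C j = {}"
    "R \<in> lmeasurable" "R \<subseteq> {0..L}" "measure lebesgue R < \<epsilon>"
    "\<sigma> ` {0..L} \<subseteq> \<sigma> ` R \<union> (\<Union>i<m. \<sigma> ` C i)"
proof -
  define D where "D m = {0..L} - (\<Union>i<m. K i)" for m
  have K_meas: "K i \<in> lmeasurable" for i using K(1) by (rule lmeasurable_compact)
  have D_meas: "D m \<in> lmeasurable" for m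
    unfolding D_def using K_meas by (intro fmeasurable_Diff sets.finite_UN) (auto dest: fmeasurableD)
  have "decseq D" by (auto simp: decseq_def D_def)
  moreover have "emeasure lebesgue (D m) \<noteq> \<infinity>" for m using fmeasurableD2[OF D_meas] by simp
  moreover have "range D \<subseteq> sets lebesgue" using fmeasurableD[OF D_meas] by blast
  ultimately have "(\<lambda>m. measure lebesgue (D m)) \<longlonglongrightarrow> measure lebesgue (\<Inter>m. D m)"
    by (intro Lim_measure_decseq)
  moreover have "(\<Inter>m. D m) \<subseteq> {0..L} - (\<Union>i. K i)" by (auto simp: D_def)
  then have "measure lebesgue (\<Inter>m. D m) = 0"
    using negligible_subset[OF K(3)] negligible_imp_measure0 by blast
  ultimately have lim: "(\<lambda>m. measure lebesgue (D m)) \<longlonglongrightarrow> 0" by simp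
  have "0 < \<epsilon> / 2" using \<open>0 < \<epsilon>\<close> by simp
  then have "eventually (\<lambda>m. measure lebesgue (D m) < \<epsilon> / 2) sequentially"
    by (rule order_tendstoD(2)[OF lim])
  then obtain m where m: "measure lebesgue (D m) < \<epsilon> / 2" by (auto simp: eventually_sequentially)
  define A where "A i = K i \<inter> {t \<in> {0..L}. \<sigma> t \<in> - (\<Union>j<i. \<sigma> ` K j)}" for i
  have A_meas: "A i \<in> lmeasurable" for i
  proof -
    have "compact (\<Union>j<i. \<sigma> ` K j)"
      by (intro compact_UN compact_continuous_image K(1) continuous_on_subset[OF \<sigma> K(2)]) simp
    then have "open (- (\<Union>j<i. \<sigma> ` K j))" by (intro open_Compl compact_imp_closed)
    then show ?thesis
      unfolding A_def by (intro fmeasurable.Int K_meas lmeasurable_continuous_vimage_open[OF \<sigma>])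
  qed
  define e where "e = \<epsilon> / (2 * (real m + 1))"
  have e: "0 < e" using \<open>0 < \<epsilon>\<close> by (simp add: e_def)
  have me: "real m * e \<le> \<epsilon> / 2"
  proof -
    have "e * (2 * (real m + 1)) = \<epsilon>"
      using nonzero_divide_eq_eq[of "2 * (real m + 1)" \<epsilon> e] by (simp add: e_def)
    then show ?thesis using e by (simp add: algebra_simps)
  qed
  have "\<exists>T. compact T \<and> T \<subseteq> A i \<and> A i - T \<in> lmeasurable \<and> measure lebesgue (A i - T) \<le> e" for i
  proof -
    obtain T where T: "closed T" "T \<subseteq> A i" "A i - T \<in> lmeasurable" "emeasure lebesgue (A i - T) < ennreal e"
      by (rule sets_lebesgue_inner_closed[OF fmeasurableD[OF A_meas[of i]] e])
    have "A i \<subseteq> {0..L}" unfolding A_def by blast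
    then have "bounded T" using T(2) bounded_subset[OF bounded_closed_interval] by (metis order_trans)
    then have "compact T" using T(1) by (simp add: compact_eq_bounded_closed)
    moreover have "measure lebesgue (A i - T) \<le> e"
      using T(3,4) e by (simp add: emeasure_eq_measure2 ennreal_less_iff)
    ultimately show ?thesis using T by blast
  qed
  then obtain C where C: "\<And>i. compact (C i)" "\<And>i. C i \<subseteq> A i" "\<And>i. A i - C i \<in> lmeasurable"
      "\<And>i. measure lebesgue (A i - C i) \<le> e"
    by metis
  let ?R = "D m \<union> (\<Union>i<m. A i - C i)"
  show thesis
  proof (rule that[of C ?R m])
    show "\<forall>i. compact (C i) \<and> C i \<subseteq> K i" using C(1,2) by (auto simp: A_def)
    show "\<forall>i j. i \<noteq> j \<longrightarrow> \<sigma> ` C i \<inter> \<sigma> ` C j = {}"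
    proof (intro allI impI)
      fix i j :: nat assume "i \<noteq> j"
      have *: "\<sigma> ` C i \<inter> \<sigma> ` C j = {}" if "i < j" for i j
      proof -
        have "\<sigma> ` C i \<subseteq> \<sigma> ` K i" using C(2)[of i] by (auto simp: A_def)
        moreover have "\<sigma> ` C j \<inter> \<sigma> ` K i = {}" using C(2)[of j] that by (auto simp: A_def)
        ultimately show ?thesis by blast
      qed
      show "\<sigma> ` C i \<inter> \<sigma> ` C j = {}" using *[of i j] *[of j i] \<open>i \<noteq> j\<close> by (cases "i < j") auto
    qed
    show "?R \<in> lmeasurable" using D_meas C(3) by (intro fmeasurable.Un fmeasurable.finite_UN) auto
    show "?R \<subseteq> {0..L}" by (auto simp: D_def A_def)
    have "measure lebesgue ?R \<le> measure lebesgue (D m) + measure lebesgue (\<Union>i<m. A i - C i)"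
      using D_meas C(3) by (intro measure_Un_le sets.finite_UN) (auto dest: fmeasurableD)
    also have "measure lebesgue (\<Union>i<m. A i - C i) \<le> (\<Sum>i<m. measure lebesgue (A i - C i))"
      using C(3) by (intro measure_UNION_le) (auto dest: fmeasurableD)
    also have "\<dots> \<le> (\<Sum>i<m. e)" by (intro sum_mono C(4))
    also have "\<dots> \<le> \<epsilon> / 2" using me by simp
    finally show "measure lebesgue ?R < \<epsilon>" using m by simp
    show "\<sigma> ` {0..L} \<subseteq> \<sigma> ` ?R \<union> (\<Union>i<m. \<sigma> ` C i)"
    proof
      fix x assume "x \<in> \<sigma> ` {0..L}"
      then obtain t where t: "t \<in> {0..L}" "x = \<sigma> t" by auto
      show "x \<in> \<sigma> ` ?R \<union> (\<Union>i<m. \<sigma> ` C i)"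
      proof (cases "\<exists>i<m. x \<in> \<sigma> ` K i")
        case True
        \<comment> \<open>For the first piece through \<open>x\<close>, no time of a visit to \<open>x\<close> counts as a return to earlier images.\<close>
        define i where "i = (LEAST i. x \<in> \<sigma> ` K i)"
        obtain i0 where i0: "i0 < m" "x \<in> \<sigma> ` K i0" using True by blast
        have xi: "x \<in> \<sigma> ` K i" unfolding i_def using i0(2) by (rule LeastI)
        have "i \<le> i0" unfolding i_def using i0(2) by (rule Least_le)
        then have "i < m" using i0(1) by simp
        have "x \<notin> \<sigma> ` K j" if "j < i" for j using not_less_Least[of j] that unfolding i_def by blast
        then have notin: "x \<notin> (\<Union>j<i. \<sigma> ` K j)" by blast
        obtain s where s: "s \<in> K i" "x = \<sigma> s" using xi by blast
        have "s \<in> {0..L}" using s(1) K(2)[of i] by blast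
        then have "s \<in> A i" using s notin by (auto simp: A_def)
        then show ?thesis using s(2) \<open>i < m\<close> by blast
      next
        case False
        then have "t \<in> D m" using t by (auto simp: D_def)
        then show ?thesis using t(2) by blast
      qed
    qed
  qed
qed

text \<open>
Let \<open>g\<close> be the distance from \<open>\<gamma> c\<close>.  By continuity \<open>g \<circ> \<gamma>\<close> takes all values in \<open>{0..dist (\<gamma> c) (\<gamma> d)}\<close>.
On a piece \<open>\<sigma> ` C i\<close> the function \<open>h\<close> shrinks distances at most by the factor \<open>1 - \<eta>\<close>, so that there \<open>g\<close> is a
Lipschitz function of \<open>h\<close> and takes values in a set not much larger than the image under \<open>h\<close>.  The images
under \<open>h\<close> of the parts of \<open>\<gamma>\<close> in the disjoint pieces have total length at most the variation of \<open>h \<circ> \<gamma>\<close>, and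
the points outside all pieces contribute little because \<open>g \<circ> \<sigma>\<close> is 1-Lipschitz.
\<close>

lemma dist_le_variation_of_unit_speed:
  fixes \<sigma> \<gamma> :: "real \<Rightarrow> 'a::metric_space" and h :: "'a \<Rightarrow> real"
  assumes \<sigma>: "1-lipschitz_on {0..L} \<sigma>" and h: "1-lipschitz_on UNIV h"
    and speed: "negligible {t \<in> {0..L}. \<not> unit_speed_at (h \<circ> \<sigma>) L t}"
    and \<gamma>: "continuous_on {c..d} \<gamma>" "\<gamma> ` {c..d} \<subseteq> \<sigma> ` {0..L}" and "c \<le> d"
  shows "ennreal (dist (\<gamma> c) (\<gamma> d)) \<le> variation (h \<circ> \<gamma>) c d"
proof (cases "variation (h \<circ> \<gamma>) c d < top")
  case True
  define v where "v = enn2real (variation (h \<circ> \<gamma>) c d)"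
  have v: "variation (h \<circ> \<gamma>) c d = ennreal v" "0 \<le> v" using True by (auto simp: v_def)
  define g where "g = dist (\<gamma> c)"
  have g_lip: "\<bar>g x - g y\<bar> \<le> dist x y" for x y
    using dist_triangle[of "\<gamma> c" x y] dist_triangle[of "\<gamma> c" y x] by (auto simp: g_def dist_commute)
  let ?D = "dist (\<gamma> c) (\<gamma> d)"
  have \<sigma>c: "continuous_on {0..L} \<sigma>" using \<sigma> by (rule lipschitz_on_continuous_on)
  have hc: "continuous_on S h" for S using lipschitz_on_continuous_on[OF h] continuous_on_subset by blast
  have h\<gamma>: "continuous_on {c..d} (h \<circ> \<gamma>)" by (intro continuous_on_compose \<gamma> hc)
  have approx: "?D \<le> 3 * \<eta> + v / (1 - \<eta>)" if \<eta>: "0 < \<eta>" "\<eta> < 1" for \<eta>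
  proof -
    have h\<sigma>: "continuous_on {0..L} (h \<circ> \<sigma>)" by (intro continuous_on_compose \<sigma>c hc)
    obtain K :: "nat \<Rightarrow> real set" where K': "\<forall>i. compact (K i) \<and> K i \<subseteq> {0..L}"
      "\<forall>i. \<forall>s\<in>K i. \<forall>t\<in>K i. (1 - \<eta>) * \<bar>s - t\<bar> \<le> dist ((h \<circ> \<sigma>) s) ((h \<circ> \<sigma>) t)"
      "negligible ({0..L} - (\<Union>i. K i))"
      by (rule expanding_pieces[OF h\<sigma> \<eta>(1) speed])
    have K: "compact (K i)" "K i \<subseteq> {0..L}" for i using K'(1) by auto
    have K_exp: "(1 - \<eta>) * \<bar>s - t\<bar> \<le> dist ((h \<circ> \<sigma>) s) ((h \<circ> \<sigma>) t)" if "s \<in> K i" "t \<in> K i" for i s t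
      using K'(2) that by blast
    obtain m C R where C': "\<forall>i. compact (C i) \<and> C i \<subseteq> K i" "\<forall>i j. i \<noteq> j \<longrightarrow> \<sigma> ` C i \<inter> \<sigma> ` C j = {}"
      and R: "R \<in> lmeasurable" "R \<subseteq> {0..L}" "measure lebesgue R < \<eta>"
        "\<sigma> ` {0..L} \<subseteq> \<sigma> ` R \<union> (\<Union>i<m. \<sigma> ` C i)"
      by (rule disjoint_compact_pieces[OF \<sigma>c K K'(3) \<eta>(1)])
    have C: "compact (C i)" "C i \<subseteq> K i" for i using C'(1) by auto
    have C_disj: "\<sigma> ` C i \<inter> \<sigma> ` C j = {}" if "i \<noteq> j" for i j using C'(2) that by blast
    define B where "B i = {c..d} \<inter> \<gamma> -` (\<sigma> ` C i)" for i
    have CL: "C i \<subseteq> {0..L}" for i using C(2) K(2) by blast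
    have B_comp: "compact (B i)" for i
    proof -
      have "compact (\<sigma> ` C i)"
        by (intro compact_continuous_image C(1) continuous_on_subset[OF \<sigma>c CL])
      then have "closed (B i)"
        unfolding B_def by (intro continuous_closed_preimage \<gamma>(1) compact_imp_closed) auto
      moreover have "bounded (B i)" by (rule bounded_subset[of "{c..d}"]) (auto simp: B_def)
      ultimately show ?thesis by (simp add: compact_eq_bounded_closed)
    qed
    have B_disj: "B i \<inter> B j = {}" if "i \<noteq> j" for i j
      using C_disj[OF that] by (auto simp: B_def)
    define F where "F i = (h \<circ> \<gamma>) ` B i" for i
    have F_comp: "compact (F i)" for i
      unfolding F_def using B_comp
      by (intro compact_continuous_image continuous_on_subset[OF h\<gamma>]) (auto simp: B_def)
    have "(\<Sum>i<m. emeasure lborel (F i)) \<le> ennreal v"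
      unfolding F_def v(1)[symmetric] using B_comp B_disj
      by (intro sum_measure_images_le_variation h\<gamma> \<open>c \<le> d\<close>) (auto simp: B_def)
    moreover have "emeasure lborel (F i) = ennreal (measure lebesgue (F i))" for i
    proof -
      have "emeasure lborel (F i) = emeasure lebesgue (F i)"
        using borel_compact[OF F_comp] by simp
      then show ?thesis using lmeasurable_compact[OF F_comp] by (simp add: emeasure_eq_measure2)
    qed
    ultimately have "ennreal (\<Sum>i<m. measure lebesgue (F i)) \<le> ennreal v" by (simp add: sum_ennreal)
    then have F_sum: "(\<Sum>i<m. measure lebesgue (F i)) \<le> v" using v(2) by (simp add: ennreal_le_iff)
    have dist_E: "dist x y \<le> 1 / (1 - \<eta>) * \<bar>h x - h y\<bar>"
      if xy: "x \<in> \<sigma> ` C i" "y \<in> \<sigma> ` C i" for i x y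
    proof -
      obtain s t where st: "s \<in> C i" "t \<in> C i" "x = \<sigma> s" "y = \<sigma> t" using xy by blast
      have "s \<in> K i" "t \<in> K i" "s \<in> {0..L}" "t \<in> {0..L}" using st C(2) CL by blast+
      then have "(1 - \<eta>) * \<bar>s - t\<bar> \<le> \<bar>h x - h y\<bar>" "dist x y \<le> \<bar>s - t\<bar>"
        using K_exp[of s i t] lipschitz_onD[OF \<sigma>, of s t] st by (auto simp: dist_real_def)
      moreover from this have "(1 - \<eta>) * dist x y \<le> (1 - \<eta>) * \<bar>s - t\<bar>"
        using \<eta> by (intro mult_left_mono) auto
      ultimately have "(1 - \<eta>) * dist x y \<le> \<bar>h x - h y\<bar>" by linarith
      then show ?thesis using \<eta> by (simp add: field_simps)
    qed
    define e where "e = \<eta> / (real m + 1)"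
    have e: "0 < e" using \<eta> by (simp add: e_def)
    have me: "real m * e \<le> \<eta>"
    proof -
      have "e * (real m + 1) = \<eta>"
        using nonzero_divide_eq_eq[of "real m + 1" \<eta> e] by (simp add: e_def)
      then show ?thesis using e by (simp add: algebra_simps)
    qed
    have "\<exists>T. (g \<circ> \<gamma>) ` B i \<subseteq> T \<and> T \<in> lmeasurable \<and> measure lebesgue T \<le> 1 / (1 - \<eta>) * measure lebesgue (F i) + e" for i
    proof -
      have B0: "0 \<le> 1 / (1 - \<eta>)" using \<eta>(2) by simp
      define k where "k = g \<circ> \<gamma> \<circ> inv_into (B i) (h \<circ> \<gamma>)"
      have k_lip: "\<bar>k u - k w\<bar> \<le> 1 / (1 - \<eta>) * \<bar>u - w\<bar>" if "u \<in> F i" "w \<in> F i" for u w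
      proof -
        let ?s = "inv_into (B i) (h \<circ> \<gamma>) u" and ?t = "inv_into (B i) (h \<circ> \<gamma>) w"
        have st: "?s \<in> B i" "?t \<in> B i" "h (\<gamma> ?s) = u" "h (\<gamma> ?t) = w"
          using that inv_into_into[of u "h \<circ> \<gamma>" "B i"] inv_into_into[of w "h \<circ> \<gamma>" "B i"]
            f_inv_into_f[of u "h \<circ> \<gamma>" "B i"] f_inv_into_f[of w "h \<circ> \<gamma>" "B i"] by (auto simp: F_def)
        have "\<bar>k u - k w\<bar> \<le> dist (\<gamma> ?s) (\<gamma> ?t)" using g_lip by (simp add: k_def)
        also have "\<dots> \<le> 1 / (1 - \<eta>) * \<bar>u - w\<bar>"
          using dist_E[of "\<gamma> ?s" i "\<gamma> ?t"] st by (simp add: B_def)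
        finally show ?thesis .
      qed
      have "(g \<circ> \<gamma>) ` B i \<subseteq> k ` F i"
      proof
        fix y assume "y \<in> (g \<circ> \<gamma>) ` B i"
        then obtain s where s: "s \<in> B i" "y = g (\<gamma> s)" by auto
        let ?s = "inv_into (B i) (h \<circ> \<gamma>) (h (\<gamma> s))"
        have mem: "h (\<gamma> s) \<in> (h \<circ> \<gamma>) ` B i" using s by auto
        have "?s \<in> B i" "h (\<gamma> ?s) = h (\<gamma> s)"
          using inv_into_into[OF mem] f_inv_into_f[OF mem] by simp_all
        then have "dist (\<gamma> ?s) (\<gamma> s) \<le> 1 / (1 - \<eta>) * 0"
          using dist_E[of "\<gamma> ?s" i "\<gamma> s"] s(1) by (simp add: B_def)
        then have "k (h (\<gamma> s)) = y" using s(2) by (simp add: k_def)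
        then show "y \<in> k ` F i" using s(1) by (auto simp: F_def)
      qed
      moreover obtain T where "k ` F i \<subseteq> T" "T \<in> lmeasurable" "measure lebesgue T \<le> 1 / (1 - \<eta>) * measure lebesgue (F i) + e"
        by (rule lipschitz_image_outer_measure[OF lmeasurable_compact[OF F_comp[of i]]
          compact_imp_bounded[OF F_comp[of i]] B0 k_lip e])
      ultimately show ?thesis by blast
    qed
    then obtain T where T: "\<And>i. (g \<circ> \<gamma>) ` B i \<subseteq> T i" "\<And>i. T i \<in> lmeasurable"
        "\<And>i. measure lebesgue (T i) \<le> 1 / (1 - \<eta>) * measure lebesgue (F i) + e"
      by metis
    have g\<sigma>_lip: "\<bar>(g \<circ> \<sigma>) s - (g \<circ> \<sigma>) t\<bar> \<le> 1 * \<bar>s - t\<bar>" if "s \<in> R" "t \<in> R" for s t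
    proof -
      have "s \<in> {0..L}" "t \<in> {0..L}" using that R(2) by blast+
      then show ?thesis
        using g_lip[of "\<sigma> s" "\<sigma> t"] lipschitz_onD[OF \<sigma>, of s t] by (simp add: dist_real_def)
    qed
    have "bounded R" using R(2) by (rule bounded_subset[rotated]) simp
    obtain TR where TR: "(g \<circ> \<sigma>) ` R \<subseteq> TR" "TR \<in> lmeasurable" "measure lebesgue TR \<le> 1 * measure lebesgue R + \<eta>"
      by (rule lipschitz_image_outer_measure[OF R(1) \<open>bounded R\<close> zero_le_one g\<sigma>_lip \<eta>(1)])
    have "{0..?D} \<subseteq> TR \<union> (\<Union>i<m. T i)"
    proof
      fix y assume y: "y \<in> {0..?D}"
      have "continuous_on {c..d} (\<lambda>s. g (\<gamma> s))" unfolding g_def by (intro continuous_intros \<gamma>(1))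
      then have "\<exists>s\<ge>c. s \<le> d \<and> g (\<gamma> s) = y"
        using y \<open>c \<le> d\<close> by (intro IVT') (auto simp: g_def)
      then obtain s where s: "s \<in> {c..d}" "g (\<gamma> s) = y" by auto
      have "\<gamma> s \<in> \<sigma> ` R \<union> (\<Union>i<m. \<sigma> ` C i)" using s(1) \<gamma>(2) R(4) by blast
      then show "y \<in> TR \<union> (\<Union>i<m. T i)"
      proof
        assume "\<gamma> s \<in> \<sigma> ` R"
        then obtain r where "r \<in> R" "\<gamma> s = \<sigma> r" by blast
        then have "y \<in> (g \<circ> \<sigma>) ` R" using s(2) by auto
        then show ?thesis using TR(1) by blast
      next
        assume "\<gamma> s \<in> (\<Union>i<m. \<sigma> ` C i)"
        then obtain i where i: "i < m" "\<gamma> s \<in> \<sigma> ` C i" by blast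
        then have "s \<in> B i" using s(1) by (simp add: B_def)
        then have "y \<in> (g \<circ> \<gamma>) ` B i" using s(2) by auto
        then show ?thesis using T(1)[of i] i(1) by blast
      qed
    qed
    moreover have "TR \<union> (\<Union>i<m. T i) \<in> lmeasurable"
      using TR(2) T(2) by (intro fmeasurable.Un fmeasurable.finite_UN) auto
    ultimately have "measure lebesgue {0..?D} \<le> measure lebesgue (TR \<union> (\<Union>i<m. T i))"
      by (intro measure_mono_fmeasurable) auto
    also have "\<dots> \<le> measure lebesgue TR + measure lebesgue (\<Union>i<m. T i)"
      using TR(2) T(2) by (intro measure_Un_le sets.finite_UN) (auto dest: fmeasurableD)
    also have "measure lebesgue (\<Union>i<m. T i) \<le> (\<Sum>i<m. measure lebesgue (T i))"
      using T(2) by (intro measure_UNION_le) (auto dest: fmeasurableD)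
    also have "\<dots> \<le> (\<Sum>i<m. 1 / (1 - \<eta>) * measure lebesgue (F i) + e)" by (intro sum_mono T(3))
    also have "\<dots> = 1 / (1 - \<eta>) * (\<Sum>i<m. measure lebesgue (F i)) + real m * e"
      by (simp add: sum.distrib sum_distrib_left)
    also have "1 / (1 - \<eta>) * (\<Sum>i<m. measure lebesgue (F i)) \<le> 1 / (1 - \<eta>) * v"
      using F_sum \<eta> by (intro mult_left_mono) auto
    finally have "?D \<le> measure lebesgue TR + (v / (1 - \<eta>) + real m * e)" by simp
    then show ?thesis using TR(3) R(3) me by linarith
  qed
  have "?D \<le> v"
  proof (rule field_le_epsilon)
    fix \<epsilon> :: real assume "0 < \<epsilon>"
    define \<eta> where "\<eta> = min (1 / 2) (\<epsilon> / (3 + ?D))"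
    have D3: "0 < 3 + ?D" by (rule add_pos_nonneg) auto
    have \<eta>: "0 < \<eta>" "\<eta> < 1" "\<eta> \<le> \<epsilon> / (3 + ?D)" using \<open>0 < \<epsilon>\<close> D3 by (auto simp: \<eta>_def)
    have "\<eta> * (3 + ?D) \<le> \<epsilon>" using \<eta>(3) D3 by (simp only: pos_le_divide_eq)
    have "(1 - \<eta>) * ?D \<le> (1 - \<eta>) * (3 * \<eta> + v / (1 - \<eta>))"
      using approx[OF \<eta>(1,2)] \<eta> by (intro mult_left_mono) auto
    also have "\<dots> = (1 - \<eta>) * (3 * \<eta>) + v" using \<eta> by (simp add: distrib_left)
    also have "(1 - \<eta>) * (3 * \<eta>) \<le> 1 * (3 * \<eta>)" using \<eta> by (intro mult_right_mono) auto
    finally have "?D \<le> v + \<eta> * (3 + ?D)" by (simp add: algebra_simps)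
    then show "?D \<le> v + \<epsilon>" using \<open>\<eta> * (3 + ?D) \<le> \<epsilon>\<close> by linarith
  qed
  then show ?thesis using v by (simp add: ennreal_leI)
qed (simp flip: less_top)

section \<open>Proof of the theorem\<close>

theorem theorem1p2:
  fixes \<gamma> :: "real \<Rightarrow> 'a::metric_space" and a b :: real
  assumes "a < b"
    and "\<And>h :: 'a \<Rightarrow> real. (\<exists>L. L-lipschitz_on UNIV h) \<Longrightarrow>
           continuous_on {a..b} (h \<circ> \<gamma>) \<and> h \<circ> \<gamma> \<in> BV a b"
  shows "continuous_on {a..b} \<gamma> \<and> \<gamma> \<in> BV a b \<and>
    (\<exists>S :: ('a \<Rightarrow>\<^sub>C real) set. residual_in (top_of_set BLIP1) S \<and>
       (\<forall>h\<in>S. hausdorff1 {x \<in> \<gamma> ` {a..b}. \<not> has_jacobian (\<gamma> ` {a..b}) (apply_bcontfun h) x 1} = 0) \<and>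
       (\<forall>h\<in>S. \<forall>c d. a \<le> c \<and> c \<le> d \<and> d \<le> b \<longrightarrow>
          variation (apply_bcontfun h \<circ> \<gamma>) c d = variation \<gamma> c d))"
proof -
  have lip_cont: "continuous_on {a..b} (h \<circ> \<gamma>)" and lip_bv: "variation (h \<circ> \<gamma>) a b < top"
    if "1-lipschitz_on UNIV h" for h :: "'a \<Rightarrow> real"
  proof -
    have "\<exists>L. L-lipschitz_on UNIV h" using that by blast
    from assms(2)[OF this] show "continuous_on {a..b} (h \<circ> \<gamma>)" "variation (h \<circ> \<gamma>) a b < top"
      by (auto simp: BV_def)
  qed
  have \<gamma>: "continuous_on {a..b} \<gamma>" using lip_cont by (rule continuous_of_lipschitz_compositions)
  let ?\<Gamma> = "\<gamma> ` {a..b}"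
  obtain B where B: "0 \<le> B" "\<And>h :: 'a \<Rightarrow> real. 1-lipschitz_on UNIV h \<Longrightarrow> (\<And>x. \<bar>h x\<bar> \<le> 1) \<Longrightarrow>
      variation (h \<circ> \<gamma>) a b \<le> ennreal B"
    using uniform_variation_bound[of \<gamma> a b] lip_bv by blast
  have \<Gamma>: "compact ?\<Gamma>" "connected ?\<Gamma>" "?\<Gamma> \<noteq> {}"
    using \<open>a < b\<close> by (auto intro: compact_continuous_image connected_continuous_image \<gamma>)
  have "0 \<le> 2 * B" using B(1) by simp
  obtain T and g :: "real \<Rightarrow> 'a" where T: "0 < T" "2-lipschitz_on {0..T} g" "g ` {0..T} = ?\<Gamma>"
    by (rule lipschitz_parametrization[OF \<Gamma> separated_card_bound[OF \<gamma> _ _ B(2) B(1)] \<open>0 \<le> 2 * B\<close>])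
  obtain L \<sigma> where L: "0 \<le> L" and \<sigma>: "1-lipschitz_on {0..L} \<sigma>" "\<sigma> ` {0..L} = g ` {0..T}"
      and len: "variation \<sigma> 0 L = ennreal L"
    by (rule arclength_reparametrization[OF T(2) less_imp_le[OF T(1)]])
  have \<sigma>\<Gamma>: "\<sigma> ` {0..L} = ?\<Gamma>" using \<sigma>(2) T(3) by simp
  have \<sigma>c: "continuous_on {0..L} \<sigma>" using \<sigma>(1) by (rule lipschitz_on_continuous_on)
  have "\<exists>S :: ('a \<Rightarrow>\<^sub>C real) set. residual_in (top_of_set BLIP1) S \<and>
     (\<forall>h\<in>S. hausdorff1 {x \<in> ?\<Gamma>. \<not> has_jacobian ?\<Gamma> (apply_bcontfun h) x 1} = 0 \<and>
        negligible {t \<in> {0..L}. \<not> unit_speed_at (apply_bcontfun h \<circ> \<sigma>) L t})"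
  \<comment> \<open>If \<open>L = 0\<close>, then \<open>\<Gamma>\<close> is a single point and all claims hold for every \<open>h\<close>.\<close>
  proof (cases "L = 0")
    case True
    have "residual_in (top_of_set BLIP1) (BLIP1 :: ('a \<Rightarrow>\<^sub>C real) set)"
      unfolding residual_in_def by (auto intro: exI[of _ "{}"])
    moreover have "hausdorff1 {x \<in> ?\<Gamma>. \<not> has_jacobian ?\<Gamma> h x 1} = 0" for h
    proof (rule hausdorff1_null_subset)
      show "hausdorff1 {\<sigma> 0} = 0" by simp
      show "{x \<in> ?\<Gamma>. \<not> has_jacobian ?\<Gamma> h x 1} \<subseteq> {\<sigma> 0}" using True unfolding \<sigma>\<Gamma>[symmetric] by auto
    qed
    moreover have "negligible {t \<in> {0..L}. P t}" for P
      using True by (intro negligible_subset[OF negligible_sing[of 0]]) auto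
    ultimately show ?thesis by (intro exI[of _ BLIP1] conjI ballI)
  next
    case False
    then have "0 < L" using L by simp
    have speed: "negligible {t \<in> {0..L}. \<not> unit_speed_at \<sigma> L t}"
      by (rule unit_speed_ae[OF \<sigma>(1) L]) (simp add: len)
    have half: "0 < (1 / 2 :: real)" by simp
    obtain K :: "nat \<Rightarrow> real set" where K: "\<forall>i. compact (K i) \<and> K i \<subseteq> {0..L}"
        "\<forall>i. \<forall>s\<in>K i. \<forall>t\<in>K i. (1 - 1 / 2) * \<bar>s - t\<bar> \<le> dist (\<sigma> s) (\<sigma> t)"
        "negligible ({0..L} - (\<Union>i. K i))"
      by (rule expanding_pieces[OF \<sigma>c half speed])
    have K2: "\<forall>i. \<forall>s\<in>K i. \<forall>t\<in>K i. \<bar>s - t\<bar> \<le> 2 * dist (\<sigma> s) (\<sigma> t)"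
    proof (intro allI ballI)
      fix i s t assume "s \<in> K i" "t \<in> K i"
      then have "(1 - 1 / 2) * \<bar>s - t\<bar> \<le> dist (\<sigma> s) (\<sigma> t)" using K(2) by blast
      then show "\<bar>s - t\<bar> \<le> 2 * dist (\<sigma> s) (\<sigma> t)" by simp
    qed
    have "negligible {t \<in> {0..L}. \<sigma> t = z}" for z by (rule negligible_fibre[OF K2 K(3)])
    from generic_steep[OF \<sigma>c this]
    obtain S :: "('a \<Rightarrow>\<^sub>C real) set" where S: "residual_in (top_of_set BLIP1) S"
      "\<And>h. h \<in> S \<Longrightarrow> negligible {t \<in> {0..L}. \<not> steep_at (apply_bcontfun h) (\<sigma> ` {0..L}) (\<sigma> t)}"
      by blast
    have "hausdorff1 {x \<in> ?\<Gamma>. \<not> has_jacobian ?\<Gamma> (apply_bcontfun h) x 1} = 0 \<and>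
        negligible {t \<in> {0..L}. \<not> unit_speed_at (apply_bcontfun h \<circ> \<sigma>) L t}" if h: "h \<in> S" for h
    proof -
      have "h \<in> BLIP1" using S(1) h by (auto simp: residual_in_def)
      then have lip: "1-lipschitz_on UNIV (apply_bcontfun h)" by (simp add: BLIP1_def)
      have us: "negligible {t \<in> {0..L}. \<not> unit_speed_at (apply_bcontfun h \<circ> \<sigma>) L t}"
        by (rule unit_speed_comp_of_steep[OF \<sigma>(1) L lip speed S(2)[OF h] K(1) K2 K(3)])
      then show ?thesis using jacobian_one_ae[OF \<sigma>(1) \<open>0 < L\<close> lip us] by (simp add: \<sigma>\<Gamma>)
    qed
    then show ?thesis using S(1) by blast
  qed
  then obtain S :: "('a \<Rightarrow>\<^sub>C real) set" where S: "residual_in (top_of_set BLIP1) S"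
    and jac: "\<And>h. h \<in> S \<Longrightarrow> hausdorff1 {x \<in> ?\<Gamma>. \<not> has_jacobian ?\<Gamma> (apply_bcontfun h) x 1} = 0"
    and us: "\<And>h. h \<in> S \<Longrightarrow> negligible {t \<in> {0..L}. \<not> unit_speed_at (apply_bcontfun h \<circ> \<sigma>) L t}"
    by blast
  have lip: "1-lipschitz_on UNIV (apply_bcontfun h)" if "h \<in> S" for h
    using S that by (auto simp: residual_in_def BLIP1_def)
  have var: "variation (apply_bcontfun h \<circ> \<gamma>) c d = variation \<gamma> c d"
    if h: "h \<in> S" and cd: "a \<le> c" "c \<le> d" "d \<le> b" for h c d
  proof (rule antisym)
    show "variation (apply_bcontfun h \<circ> \<gamma>) c d \<le> variation \<gamma> c d"
      by (rule variation_lipschitz_comp[OF lip[OF h]])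
    show "variation \<gamma> c d \<le> variation (apply_bcontfun h \<circ> \<gamma>) c d"
    proof (rule variation_le_if_dist_le_variation)
      fix s t assume st: "c \<le> s" "s \<le> t" "t \<le> d"
      have sub: "{s..t} \<subseteq> {a..b}" using st cd by auto
      show "ennreal (dist (\<gamma> s) (\<gamma> t)) \<le> variation (apply_bcontfun h \<circ> \<gamma>) s t"
        using sub by (intro dist_le_variation_of_unit_speed[OF \<sigma>(1) lip[OF h] us[OF h]]
            continuous_on_subset[OF \<gamma> sub] st) (auto simp: \<sigma>\<Gamma>)
    qed
  qed
  have "S \<noteq> {}" by (rule residual_nonempty[OF closed_BLIP1 BLIP1_nonempty S])
  then obtain h where "h \<in> S" by blast
  then have "variation \<gamma> a b < top" using var[of h a b] lip_bv[OF lip[OF \<open>h \<in> S\<close>]] \<open>a < b\<close> by simp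
  then have "\<gamma> \<in> BV a b" by (simp add: BV_def)
  then show ?thesis using \<gamma> S jac var by blast
qed

end
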